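(* Let $(w_L)_{L\in\mathbb{N}}$ be a sequence of non-negative weights $w_L:\mathbb{N}_0\to[0,\infty)$ satisfying: (B1) $w_L$ converges, as $L\to\infty$, in the sup-norm $\|\cdot\|_\infty$ on sequences indexed by $\mathbb{N}_0$ to a sequence $w$ with $\sum_{n=0}^\infty w(n)=1$, and either $w(0)=1$, or $$w(0)>0\quad\text{and}\quad \sup_{n\ge1}\,[w(n-1)\wedge w(n)]>0;$$ (B2) there exists $\theta\in(0,1]$ such that $\displaystyle \lim_{J\to\infty}\lim_{L\to\infty}\sup_{n>J}|n\,w_L(n)\,L-\theta|=0$. Then the system of canonical distributions $(\pi_{L,N})_{L,N}$ with weights $(w_L)_L$ exhibits a condensation transition with critical density $$\rho_c:=\sum_{n=0}^\infty n\,w(n)\in[0,\infty).$$ Furthermore, $\nu_\rho(\eta_x)=\rho_c$ for all $\rho\ge\rho_c$, and for every $\rho>0$ with $\rho\ge\rho_c$ the laws of mass partitions satisfy $$\mu_{L,N}\to\mathrm{PD}_{[0,\alpha]}(\theta)\ \text{ weakly on }\overline{\nabla}\ \text{ as }N/L\to\rho,\qquad \alpha=\alpha(\rho)=1-\frac{\rho_c}{\rho}.$$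
   Context: For $L,N\in\mathbb{N}$ let $\Omega_{L,N}=\{\eta\in\mathbb{N}_0^L:\sum_{x=1}^L\eta_x=N\}$. The canonical distribution is the probability measure $\pi_{L,N}[\eta]=\frac1{Z_{L,N}}\prod_{x=1}^Lw_L(\eta_x)$ on $\Omega_{L,N}$, where $Z_{L,N}=\sum_{\eta\in\Omega_{L,N}}\prod_{x=1}^Lw_L(\eta_x)$ is implicitly positive for the $L,N$ considered. It is permutation invariant, so single-site marginals do not depend on the site $x$. "As $N/L\to\rho$" (thermodynamic limit) means: along every sequence of pairs $(L,N)$ with $L\to\infty$, $N\to\infty$, $N/L\to\rho$. Condensation transition: the system has a condensation transition with critical density $\rho_c\ge0$ if for every $\rho\ge0$ the weak limit $\nu_\rho:=\lim_{N/L\to\rho}\pi_{L,N}[\eta_x\in\cdot\,]$ exists as a probability measure on $\mathbb{N}_0$, and its mean $\nu_\rho(\eta_x)$ satisfies $\nu_\rho(\eta_x)=\rho$ if $\rho<\rho_c$ and $\nu_\rho(\eta_x)<\rho$ if $\rho>\rho_c$. $\overline{\nabla}=\{p=(p_i)_{i\ge1}\in[0,1]^{\mathbb{N}}:\sum_ip_i\le1,\ p_1\ge p_2\ge\cdots\}$ with the product topology. The map $T:\Omega_{L,N}\to\overline{\nabla}$ is $T(\eta)=\frac1N(\widehat\eta_1,\dots,\widehat\eta_L,0,0,\dots)$, where $\widehat\eta_1\ge\dots\ge\widehat\eta_L$ are the entries of $\eta$ in decreasing order, and $\mu_{L,N}=\pi_{L,N}\circ T^{-1}$. Poisson-Dirichlet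 distribution: let $U_1,U_2,\dots$ be i.i.d. $\mathrm{Beta}(1,\theta)$ and $V_1=U_1$, $V_k=U_k\prod_{j<k}(1-U_j)$; $\mathrm{PD}(\theta)$ is the law of the decreasing rearrangement of $(V_k)_{k\ge1}$. For $\alpha\in[0,1]$, $\mathrm{PD}_{[0,\alpha]}(\theta)$ is the law of $\alpha p$ with $p\sim\mathrm{PD}(\theta)$ (for $\alpha=0$ the point mass at $(0,0,\dots)$). *)

theory Defs
  imports "HOL-Probability.Probability"
begin

section \<open>Canonical distributions\<close>

definition configs :: "nat \<Rightarrow> nat \<Rightarrow> nat list set" where
  "configs L N = {\<eta>. length \<eta> = L \<and> sum_list \<eta> = N}"

definition config_weight :: "(nat \<Rightarrow> real) \<Rightarrow> nat list \<Rightarrow> real" where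
  "config_weight v \<eta> = (\<Prod>x<length \<eta>. v (\<eta> ! x))"

definition partition_function :: "(nat \<Rightarrow> real) \<Rightarrow> nat \<Rightarrow> nat \<Rightarrow> real" where
  "partition_function v L N = (\<Sum>\<eta>\<in>configs L N. config_weight v \<eta>)"

text \<open>A measure on the finite space \<^term>\<open>configs L N\<close>; it is the null measure (rather than a
  probability measure) when the partition function vanishes.\<close>

definition canonical :: "(nat \<Rightarrow> real) \<Rightarrow> nat \<Rightarrow> nat \<Rightarrow> nat list measure" where
  "canonical v L N =
     point_measure (configs L N) (\<lambda>\<eta>. ennreal (config_weight v \<eta> / partition_function v L N))"

text \<open>Sites are numbered from 0, so only \<open>x < L\<close> is meaningful.\<close>

definition site_marginal :: "(nat \<Rightarrow> real) \<Rightarrow> nat \<Rightarrow> nat \<Rightarrow> nat \<Rightarrow> nat measure" where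
  "site_marginal v L N x = distr (canonical v L N) (count_space UNIV) (\<lambda>\<eta>. \<eta> ! x)"


section \<open>Weak convergence and the thermodynamic limit\<close>

text \<open>Weak convergence on a Borel subset \<open>S\<close> of a topological space, for measures on the ambient
  space that are concentrated on \<open>S\<close>. The space \<open>nat\<close> carries the discrete topology.\<close>

definition weakly_converges_on ::
  "'a::topological_space set \<Rightarrow> (nat \<Rightarrow> 'a measure) \<Rightarrow> 'a measure \<Rightarrow> bool" where
  "weakly_converges_on S M M' \<longleftrightarrow>
     (\<forall>f::'a \<Rightarrow> real. continuous_on S f \<longrightarrow> bounded (f ` S) \<longrightarrow>
        (\<lambda>k. LINT x:S|M k. f x) \<longlonglongrightarrow> (LINT x:S|M'. f x))"

definition thermodynamic_sequence :: "real \<Rightarrow> (nat \<Rightarrow> nat) \<Rightarrow> (nat \<Rightarrow> nat) \<Rightarrow> bool" where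
  "thermodynamic_sequence \<rho> L N \<longleftrightarrow>
     filterlim L at_top sequentially \<and> filterlim N at_top sequentially \<and>
     (\<lambda>k. real (N k) / real (L k)) \<longlonglongrightarrow> \<rho>"

text \<open>In the following, \<open>w L\<close> is the weight function used in a system with \<open>L\<close> sites.\<close>

definition site_limit :: "(nat \<Rightarrow> nat \<Rightarrow> real) \<Rightarrow> real \<Rightarrow> nat pmf \<Rightarrow> bool" where
  "site_limit w \<rho> \<nu> \<longleftrightarrow>
     (\<forall>L N x. thermodynamic_sequence \<rho> L N \<longrightarrow>
        weakly_converges_on UNIV (\<lambda>k. site_marginal (w (L k)) (L k) (N k) x) (measure_pmf \<nu>))"

definition pmf_mean :: "nat pmf \<Rightarrow> ennreal" where
  "pmf_mean \<nu> = (\<integral>\<^sup>+n. of_nat n \<partial>measure_pmf \<nu>)"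

definition condensation_transition :: "(nat \<Rightarrow> nat \<Rightarrow> real) \<Rightarrow> real \<Rightarrow> bool" where
  "condensation_transition w \<rho>\<^sub>c \<longleftrightarrow> 0 \<le> \<rho>\<^sub>c \<and>
     (\<forall>\<rho>\<ge>0. \<exists>\<nu>. site_limit w \<rho> \<nu> \<and>
        (\<rho> < \<rho>\<^sub>c \<longrightarrow> pmf_mean \<nu> = ennreal \<rho>) \<and>
        (\<rho>\<^sub>c < \<rho> \<longrightarrow> pmf_mean \<nu> < ennreal \<rho>))"

definition critical_density :: "(nat \<Rightarrow> real) \<Rightarrow> real" where
  "critical_density v = (\<Sum>n. real n * v n)"


section \<open>Mass partitions\<close>

text \<open>Partitions are indexed from 0. The topology on \<^typ>\<open>nat \<Rightarrow> real\<close> is the product topology.\<close>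

definition mass_partitions :: "(nat \<Rightarrow> real) set" where
  "mass_partitions =
     {p. (\<forall>i. p i \<in> {0..1}) \<and> summable p \<and> (\<Sum>i. p i) \<le> 1 \<and> antimono p}"

definition to_partition :: "nat \<Rightarrow> nat \<Rightarrow> nat list \<Rightarrow> nat \<Rightarrow> real" where
  "to_partition L N \<eta> = (\<lambda>i. if i < L then real (rev (sort \<eta>) ! i) / real N else 0)"

definition partition_law :: "(nat \<Rightarrow> real) \<Rightarrow> nat \<Rightarrow> nat \<Rightarrow> (nat \<Rightarrow> real) measure" where
  "partition_law v L N = distr (canonical v L N) borel (to_partition L N)"


section \<open>The Poisson-Dirichlet distribution\<close>

definition beta_distribution :: "real \<Rightarrow> real \<Rightarrow> real measure" where
  "beta_distribution a b = density lborel
     (\<lambda>x. ennreal (if x \<in> {0<..<1} then x powr (a - 1) * (1 - x) powr (b - 1) / Beta a b else 0))"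

definition stick_breaking :: "(nat \<Rightarrow> real) \<Rightarrow> nat \<Rightarrow> real" where
  "stick_breaking u k = u k * (\<Prod>j<k. 1 - u j)"

text \<open>The position of index \<open>i\<close> when the terms of \<open>v\<close> are listed in decreasing order, ties being
  broken by the index. The rearrangement is meaningful for positive null sequences (see
  \<open>decreasing_bij\<close> below), hence almost surely for stick-breaking
  sequences; spelling out the sorting permutation keeps it measurable everywhere.\<close>

definition sort_rank :: "(nat \<Rightarrow> real) \<Rightarrow> nat \<Rightarrow> nat" where
  "sort_rank v i = card {j. v i < v j \<or> v j = v i \<and> j < i}"

definition decreasing :: "(nat \<Rightarrow> real) \<Rightarrow> nat \<Rightarrow> real" where
  "decreasing v k = v (LEAST i. sort_rank v i = k)"

lemma decreasing_bij:
  fixes v :: "nat \<Rightarrow> real"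
  assumes pos: "\<And>i. 0 < v i" and lim: "v \<longlonglongrightarrow> 0"
  shows "bij (sort_rank v)" and "decreasing v \<circ> sort_rank v = v" and "antimono (decreasing v)"
proof -
  define B where "B i = {j. v i < v j \<or> v j = v i \<and> j < i}" for i
  have rank: "sort_rank v i = card (B i)" for i by (simp add: sort_rank_def B_def)
  have fin: "finite (B i)" for i
  proof -
    have "\<forall>\<^sub>F j in sequentially. v j < v i" using lim pos by (rule order_tendstoD)
    then obtain m where m: "\<And>j. j \<ge> m \<Longrightarrow> v j < v i" by (auto simp: eventually_sequentially)
    have "B i \<subseteq> {..<m}"
    proof
      fix j assume "j \<in> B i"
      then have "\<not> v j < v i" by (auto simp: B_def)
      then show "j \<in> {..<m}" using m[of j] by (cases "j < m") auto
    qed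
    then show ?thesis using finite_subset by blast
  qed
  have less: "sort_rank v j < sort_rank v i" if "j \<in> B i" for i j
    unfolding rank by (rule psubset_card_mono[OF fin]) (use that in \<open>auto simp: B_def\<close>)
  have total: "j \<in> B i \<or> i \<in> B j \<or> i = j" for i j by (auto simp: B_def)
  have inj: "inj (sort_rank v)"
    by (rule injI) (use less total in \<open>metis less_irrefl\<close>)
  have "\<exists>i. sort_rank v i = n" for n
  proof -
    have "\<not> range (sort_rank v) \<subseteq> {..n}"
      using inj finite_subset finite_imageD infinite_UNIV_nat by blast
    then obtain i where i: "n < sort_rank v i" by (metis atMost_iff imageE not_le subsetI)
    have "sort_rank v ` B i = {..<sort_rank v i}"
    proof (rule card_subset_eq)
      show "sort_rank v ` B i \<subseteq> {..<sort_rank v i}" using less by auto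
      show "card (sort_rank v ` B i) = card {..<sort_rank v i}"
        unfolding card_image[OF inj_on_subset[OF inj subset_UNIV]] by (simp add: rank)
    qed auto
    with i show ?thesis by (metis imageE lessThan_iff)
  qed
  then show bij: "bij (sort_rank v)" using inj by (metis bijI surjI)
  have eq: "decreasing v (sort_rank v i) = v i" for i
    using inj by (simp add: decreasing_def inj_eq Least_equality)
  then show "decreasing v \<circ> sort_rank v = v" by auto
  show "antimono (decreasing v)"
  proof (rule antimonoI)
    fix m n :: nat assume "m \<le> n"
    obtain i j where ij: "m = sort_rank v i" "n = sort_rank v j" using bij by (metis bij_pointE)
    have "j \<notin> B i" using less[of j i] \<open>m \<le> n\<close> ij by auto
    then show "decreasing v n \<le> decreasing v m" by (auto simp: ij eq B_def)
  qed
qed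

text \<open>The law of \<open>\<alpha> p\<close> with \<open>p\<close> Poisson-Dirichlet distributed with parameter \<open>\<theta>\<close>.\<close>

definition poisson_dirichlet :: "real \<Rightarrow> (nat \<Rightarrow> real) measure" where
  "poisson_dirichlet \<theta> =
     distr (Pi\<^sub>M UNIV (\<lambda>_. beta_distribution 1 \<theta>)) borel (\<lambda>u. decreasing (stick_breaking u))"

definition scaled_poisson_dirichlet :: "real \<Rightarrow> real \<Rightarrow> (nat \<Rightarrow> real) measure" where
  "scaled_poisson_dirichlet \<alpha> \<theta> = distr (poisson_dirichlet \<theta>) borel (\<lambda>p i. \<alpha> * p i)"

end

theory Submission
  imports Defs "HOL-Real_Asymp.Real_Asymp"
begin

text \<open>By (B2) the weight \<open>w\<close> has finite support, and the sites carrying more than a fixed number of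
  particles behave like clusters of size \<open>n\<close> with intensity \<open>\<theta> / n\<close>. No local limit theorem for the
  bulk is used. Since one site may absorb the excess mass at polynomial cost, the partition function
  \<open>Z\<close> has a subexponential lower bound; compared with an exponential-moment upper bound this yields
  the site marginals. Hence the bulk carries density \<open>\<rho>\<^sub>c\<close>, and the size-biased identity
  \<open>N Z(L, N) = L \<Sum>\<^sub>n n w(n) Z(L - 1, N - n)\<close> becomes
  \<open>(N - \<rho>\<^sub>c L) Z(L, N) \<approx> \<theta> (Z(L, 0) + \<dots> + Z(L, N))\<close>. So the partial sums of \<open>Z\<close> grow like
  \<open>(N - \<rho>\<^sub>c L)\<close> to the power \<open>\<theta>\<close>, which is the distribution function of \<open>1 - U\<close> with \<open>U\<close>
  distributed as \<open>Beta(1, \<theta>)\<close>. By induction this determines the limits of the expected products of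
  power sums \<open>\<Sum>\<^sub>i p\<^sub>i\<^sup>a\<close> with \<open>a \<ge> 2\<close>. They satisfy the recursion of the stick-breaking construction, and by
  Stone-Weierstrass such products determine weak convergence of mass partitions.\<close>


section \<open>Configurations and partition functions\<close>

text \<open>Bounds that are sharp only up to subexponential factors suffice for the marginals
  because Jensen's inequality places the marginal, multiplied by the number of sites, in an
  exponent: after taking roots such factors are gone, and tilts of both signs pin the value down. Up
  to the critical density the difficulty is that the absorbing site needs room, so the bulk is
  tilted to a density slightly below the target and the gap is closed afterwards. Size-biasing
  removes one site while the weights stay those of the larger system; hence the hypotheses are
  formulated along sequences in which weights and number of sites are decoupled. Estimates are
  uniform over windows of masses, because the growth of the partial sums of \<open>Z\<close> is
  obtained by multiplying one-step ratios. Exponents at least 2 serve twice: such power sums are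
  continuous on the compact space of partitions, although total mass is not, and a spare factor n /
  N suppresses the bulk sites in the size-biased recursion. At the critical density the surplus has
  density zero and the growth law is empty; there the power sums are shown directly to
  vanish.\<close>

lemma configs_0: "configs 0 N = (if N = 0 then {[]} else {})"
  by (auto simp: configs_def)

lemma configs_Suc: "configs (Suc l) N = (\<Union>n\<le>N. (#) n ` configs l (N - n))"
  by (auto simp: configs_def length_Suc_conv image_iff)

lemma finite_configs [simp]: "finite (configs l N)"
proof (induction l arbitrary: N)
  case 0
  then show ?case by (simp add: configs_0)
next
  case (Suc l)
  then show ?case by (auto simp: configs_Suc)
qed

lemma sum_configs_Suc:
  fixes f :: "nat list \<Rightarrow> 'a::comm_monoid_add"
  shows "(\<Sum>\<eta>\<in>configs (Suc l) N. f \<eta>) = (\<Sum>n\<le>N. \<Sum>\<eta>\<in>configs l (N - n). f (n # \<eta>))"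
proof -
  have "(\<Sum>\<eta>\<in>configs (Suc l) N. f \<eta>) = (\<Sum>n\<le>N. \<Sum>\<eta>\<in>(#) n ` configs l (N - n). f \<eta>)"
    unfolding configs_Suc by (rule sum.UNION_disjoint) auto
  also have "\<dots> = (\<Sum>n\<le>N. \<Sum>\<eta>\<in>configs l (N - n). f (n # \<eta>))"
    by (intro sum.cong[OF refl] sum.reindex[THEN trans]) (auto simp: inj_on_def)
  finally show ?thesis .
qed

lemma config_weight_prod_list: "config_weight v \<eta> = prod_list (map v \<eta>)"
  by (simp add: config_weight_def prod.list_conv_set_nth lessThan_atLeast0)

lemma config_weight_Cons [simp]: "config_weight v (n # \<eta>) = v n * config_weight v \<eta>"
  by (simp add: config_weight_prod_list)

lemma config_weight_nonneg:
  assumes "\<And>n. 0 \<le> v n"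
  shows "0 \<le> config_weight v \<eta>"
  unfolding config_weight_def by (intro prod_nonneg) (use assms in auto)

section \<open>Removing a single site\<close>

definition remove_site :: "nat \<Rightarrow> 'a list \<Rightarrow> 'a list" where
  "remove_site x \<eta> = take x \<eta> @ drop (Suc x) \<eta>"

text \<open>Weights and sums over sites depend on the multiset of entries only, so this identity
  transfers all of them to the configuration without the site \<open>x\<close>.\<close>

lemma mset_remove_site:
  assumes "x < length \<eta>"
  shows "mset \<eta> = add_mset (\<eta> ! x) (mset (remove_site x \<eta>))"
  by (subst id_take_nth_drop[OF assms]) (simp add: remove_site_def)

lemma config_weight_remove_site:
  assumes "x < length \<eta>"
  shows "config_weight v \<eta> = v (\<eta> ! x) * config_weight v (remove_site x \<eta>)"
proof -
  have "prod_list (map v \<eta>) = prod_mset (image_mset v (mset \<eta>))"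
    by (metis mset_map prod_mset_prod_list)
  also have "\<dots> = v (\<eta> ! x) * prod_mset (image_mset v (mset (remove_site x \<eta>)))"
    by (simp add: mset_remove_site[OF assms])
  also have "\<dots> = v (\<eta> ! x) * prod_list (map v (remove_site x \<eta>))"
    by (metis mset_map prod_mset_prod_list)
  finally show ?thesis by (simp add: config_weight_prod_list)
qed

lemma sum_list_remove_site:
  fixes h :: "'b \<Rightarrow> 'a::comm_monoid_add"
  assumes "x < length \<eta>"
  shows "sum_list (map h \<eta>) = h (\<eta> ! x) + sum_list (map h (remove_site x \<eta>))"
proof -
  have "sum_list (map h \<eta>) = sum_mset (image_mset h (mset \<eta>))"
    by (metis mset_map sum_mset_sum_list)
  also have "\<dots> = h (\<eta> ! x) + sum_mset (image_mset h (mset (remove_site x \<eta>)))"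
    by (simp add: mset_remove_site[OF assms])
  also have "\<dots> = h (\<eta> ! x) + sum_list (map h (remove_site x \<eta>))"
    by (metis mset_map sum_mset_sum_list)
  finally show ?thesis .
qed

text \<open>Moving site \<open>x\<close> to the front permutes the configurations. The right side
  does not mention \<open>x\<close>: this is the permutation invariance of the canonical
  distribution in the form used below.\<close>

lemma sum_configs_pick_site:
  fixes f :: "nat \<Rightarrow> nat list \<Rightarrow> 'a::comm_monoid_add"
  assumes "x < Suc l"
  shows "(\<Sum>\<eta>\<in>configs (Suc l) N. f (\<eta> ! x) (remove_site x \<eta>)) =
         (\<Sum>n\<le>N. \<Sum>\<eta>\<in>configs l (N - n). f n \<eta>)"
proof -
  \<comment> \<open>The inverse of moving site \<open>x\<close> to the front: the head is inserted
    back at position \<open>x\<close>.\<close>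
  define ins where "ins = (\<lambda>\<eta>::nat list. take x (tl \<eta>) @ hd \<eta> # drop x (tl \<eta>))"
  have len: "length (remove_site x \<eta>) = l" if "length \<eta> = Suc l" for \<eta> :: "nat list"
    using assms that by (simp add: remove_site_def)
  have "bij_betw (\<lambda>\<eta>. \<eta> ! x # remove_site x \<eta>) (configs (Suc l) N) (configs (Suc l) N)"
  proof (rule bij_betw_byWitness[where f' = ins])
    show "\<forall>\<eta>\<in>configs (Suc l) N. ins (\<eta> ! x # remove_site x \<eta>) = \<eta>"
      using assms by (auto simp: ins_def configs_def remove_site_def id_take_nth_drop[symmetric])
    show "\<forall>\<eta>\<in>configs (Suc l) N. ins \<eta> ! x # remove_site x (ins \<eta>) = \<eta>"
    proof
      fix \<eta> assume "\<eta> \<in> configs (Suc l) N"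
      then obtain n \<eta>' where \<eta>: "\<eta> = n # \<eta>'" "length \<eta>' = l"
        by (auto simp: configs_def length_Suc_conv)
      then show "ins \<eta> ! x # remove_site x (ins \<eta>) = \<eta>"
        using assms by (simp add: ins_def remove_site_def nth_append)
    qed
    show "(\<lambda>\<eta>. \<eta> ! x # remove_site x \<eta>) ` configs (Suc l) N \<subseteq> configs (Suc l) N"
      using assms len by (auto simp: configs_def sum_list_remove_site[of x _ "\<lambda>n. n", simplified])
    show "ins ` configs (Suc l) N \<subseteq> configs (Suc l) N"
    proof
      fix \<zeta> assume "\<zeta> \<in> ins ` configs (Suc l) N"
      then obtain \<eta> where *: "\<zeta> = ins \<eta>" "\<eta> \<in> configs (Suc l) N" by blast
      from *(2) obtain n \<eta>' where \<eta>: "\<eta> = n # \<eta>'" "length \<eta>' = l" "n + sum_list \<eta>' = N"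
        by (auto simp: configs_def length_Suc_conv)
      have "sum_list (take x \<eta>') + sum_list (drop x \<eta>') = sum_list \<eta>'"
        by (metis append_take_drop_id sum_list_append)
      then show "\<zeta> \<in> configs (Suc l) N"
        using assms * \<eta> by (auto simp: ins_def configs_def)
    qed
  qed
  then have "(\<Sum>\<eta>\<in>configs (Suc l) N. f (\<eta> ! x) (remove_site x \<eta>)) =
      (\<Sum>\<eta>\<in>configs (Suc l) N. f (hd \<eta>) (tl \<eta>))"
    using sum.reindex_bij_betw[where g = "\<lambda>\<eta>. f (hd \<eta>) (tl \<eta>)"] by fastforce
  then show ?thesis by (simp add: sum_configs_Suc)
qed

section \<open>Partition functions: recursion, tilting and crude bounds\<close>

abbreviation "Z \<equiv> partition_function"

lemma Z_0: "Z v 0 N = (if N = 0 then 1 else 0)"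
  by (simp add: partition_function_def configs_0 config_weight_def)

lemma Z_Suc: "Z v (Suc l) N = (\<Sum>n\<le>N. v n * Z v l (N - n))"
  by (simp add: partition_function_def sum_configs_Suc sum_distrib_left)

lemma Z_nonneg: "(\<And>n. 0 \<le> v n) \<Longrightarrow> 0 \<le> Z v l N"
  unfolding partition_function_def by (intro sum_nonneg config_weight_nonneg)

lemma Z_mono:
  assumes "\<And>n. 0 \<le> u n" "\<And>n. u n \<le> v n"
  shows "Z u l N \<le> Z v l N"
  unfolding partition_function_def config_weight_def
  by (intro sum_mono prod_mono) (use assms in auto)

lemma Z_mass_0: "Z v l 0 = v 0 ^ l"
  by (induction l) (auto simp: Z_0 Z_Suc)

text \<open>Counts only the configuration with all particles on one site.\<close>

lemma Z_single:
  assumes "\<And>n. 0 \<le> v n"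
  shows "v N * v 0 ^ l \<le> Z v (Suc l) N"
proof -
  have "v N * Z v l (N - N) \<le> (\<Sum>n\<le>N. v n * Z v l (N - n))"
    by (rule member_le_sum) (auto intro!: mult_nonneg_nonneg Z_nonneg assms)
  then show ?thesis by (simp add: Z_Suc Z_mass_0)
qed

text \<open>The number of sites and the total mass are fixed, so a geometric factor in the weights
  is a constant on \<open>configs l N\<close>: the canonical distribution does not see it, and the
  tilt may be chosen freely in each estimate.\<close>

lemma Z_tilt: "Z (\<lambda>i. y * (v i * x ^ i)) l N = y ^ l * (x ^ N * Z v l N)"
proof (induction l arbitrary: N)
  case 0
  then show ?case by (simp add: Z_0)
next
  case (Suc l)
  have "y * (v n * x ^ n) * (y ^ l * (x ^ (N - n) * Z v l (N - n))) =
      y ^ Suc l * (x ^ N * (v n * Z v l (N - n)))" if "n \<le> N" for n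
  proof -
    have "x ^ N = x ^ n * x ^ (N - n)" using that by (simp add: power_add[symmetric])
    then show ?thesis by simp
  qed
  then show ?case by (auto simp: Z_Suc Suc sum_distrib_left intro!: sum.cong)
qed

text \<open>Dropping the mass constraint leaves independent sites. The cutoff at \<open>N\<close> is
  kept because weights with a tail of order 1 / n are not summable over all n.\<close>

lemma Z_le_power:
  assumes "\<And>n. 0 \<le> v n"
  shows "Z v l N \<le> (\<Sum>i\<le>N. v i) ^ l"
proof (induction l arbitrary: N)
  case 0
  then show ?case by (simp add: Z_0)
next
  case (Suc l)
  have "Z v (Suc l) N \<le> (\<Sum>n\<le>N. v n * (\<Sum>i\<le>N. v i) ^ l)"
    unfolding Z_Suc
  proof (intro sum_mono mult_left_mono assms)
    fix n
    have "Z v l (N - n) \<le> (\<Sum>i\<le>N - n. v i) ^ l" by (rule Suc)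
    also have "\<dots> \<le> (\<Sum>i\<le>N. v i) ^ l"
      by (intro power_mono sum_mono2 sum_nonneg) (use assms in auto)
    finally show "Z v l (N - n) \<le> (\<Sum>i\<le>N. v i) ^ l" .
  qed
  then show ?case by (simp add: sum_distrib_right[symmetric])
qed

lemma sum_sum_diff_swap:
  fixes f :: "nat \<Rightarrow> nat \<Rightarrow> 'a::comm_monoid_add"
  shows "(\<Sum>m\<le>B. \<Sum>n\<le>m. f n (m - n)) = (\<Sum>n\<le>B. \<Sum>m\<le>B - n. f n m)"
proof -
  have "(\<Sum>m\<le>B. \<Sum>n\<le>m. f n (m - n)) = (\<Sum>(m, n)\<in>(SIGMA m:{..B}. {..m}). f n (m - n))"
    by (rule sum.Sigma) auto
  also have "\<dots> = (\<Sum>(n, m)\<in>(SIGMA n:{..B}. {..B - n}). f n m)"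
    by (rule sum.reindex_bij_witness[where i = "\<lambda>(n, m). (n + m, n)" and j = "\<lambda>(m, n). (n, m - n)"])
       auto
  also have "\<dots> = (\<Sum>n\<le>B. \<Sum>m\<le>B - n. f n m)"
    by (rule sum.Sigma[symmetric]) auto
  finally show ?thesis .
qed

text \<open>With at most \<open>J\<close> particles per site the total mass never exceeds
  \<open>l * J\<close>, so the sum over masses removes the constraint exactly. This normalises the
  law of the mass of \<open>l\<close> independent truncated sites.\<close>

lemma sum_Z_eq_power:
  assumes "\<And>i. i > J \<Longrightarrow> u i = 0" and "l * J \<le> B"
  shows "(\<Sum>m\<le>B. Z u l m) = (\<Sum>i\<le>J. u i) ^ l"
  using assms(2)
proof (induction l arbitrary: B)
  case 0
  then show ?case by (simp add: Z_0)
next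
  case (Suc l)
  have "(\<Sum>m\<le>B. Z u (Suc l) m) = (\<Sum>n\<le>B. u n * (\<Sum>m\<le>B - n. Z u l m))"
    by (simp add: Z_Suc sum_sum_diff_swap[of "\<lambda>n m. u n * Z u l m"] sum_distrib_left)
  also have "\<dots> = (\<Sum>n\<le>J. u n * (\<Sum>m\<le>B - n. Z u l m))"
    using Suc.prems by (intro sum.mono_neutral_right) (auto simp: assms(1))
  also have "\<dots> = (\<Sum>n\<le>J. u n * (\<Sum>i\<le>J. u i) ^ l)"
    using Suc.prems by (intro sum.cong refl) (subst Suc.IH; simp)
  finally show ?case by (simp add: sum_distrib_right[symmetric])
qed

text \<open>The set \<open>S\<close> collects the allowed masses of \<open>l\<close> sites with the
  smaller weights \<open>u\<close>; one further site carries the remaining \<open>N - m\<close>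
  particles with the full weight \<open>v\<close>.\<close>

lemma Z_ge_last_site:
  assumes "\<And>n. 0 \<le> u n" "\<And>n. u n \<le> v n" "S \<subseteq> {..N}"
  shows "(\<Sum>m\<in>S. v (N - m) * Z u l m) \<le> Z v (Suc l) N"
proof -
  have v: "0 \<le> v n" for n using assms(1,2) order_trans by blast
  have "(\<Sum>m\<in>S. v (N - m) * Z u l m) \<le> (\<Sum>m\<in>S. v (N - m) * Z v l m)"
    by (intro sum_mono mult_left_mono Z_mono assms v)
  also have "\<dots> \<le> (\<Sum>m\<le>N. v (N - m) * Z v l m)"
    by (intro sum_mono2 mult_nonneg_nonneg v Z_nonneg assms) auto
  also have "\<dots> = (\<Sum>n\<le>N. v n * Z v l (N - n))"
    by (rule sum.reindex_bij_witness[where i = "\<lambda>m. N - m" and j = "\<lambda>m. N - m"]) auto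
  finally show ?thesis by (simp add: Z_Suc)
qed

text \<open>A Mecke-type formula: summing over a configuration together with a marked site is the
  same as choosing the occupation of the marked site and then the rest, once for each of the
  \<open>Suc l\<close> positions.\<close>

lemma sum_configs_sum_sites:
  fixes f :: "nat \<Rightarrow> nat list \<Rightarrow> real"
  shows "(\<Sum>\<eta>\<in>configs (Suc l) N. \<Sum>x<Suc l. f (\<eta> ! x) (remove_site x \<eta>)) =
         real (Suc l) * (\<Sum>n\<le>N. \<Sum>\<eta>\<in>configs l (N - n). f n \<eta>)"
proof -
  have "(\<Sum>\<eta>\<in>configs (Suc l) N. \<Sum>x<Suc l. f (\<eta> ! x) (remove_site x \<eta>)) =
      (\<Sum>x<Suc l. \<Sum>\<eta>\<in>configs (Suc l) N. f (\<eta> ! x) (remove_site x \<eta>))"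
    by (rule sum.swap)
  also have "\<dots> = (\<Sum>x<Suc l. \<Sum>n\<le>N. \<Sum>\<eta>\<in>configs l (N - n). f n \<eta>)"
    by (intro sum.cong refl sum_configs_pick_site) simp
  finally show ?thesis by simp
qed

lemma sum_configs_weight_sites:
  "(\<Sum>\<eta>\<in>configs (Suc l) N. config_weight v \<eta> * (\<Sum>x<Suc l. h (\<eta> ! x))) =
     real (Suc l) * (\<Sum>n\<le>N. h n * (v n * Z v l (N - n)))"
proof -
  have "(\<Sum>\<eta>\<in>configs (Suc l) N. config_weight v \<eta> * (\<Sum>x<Suc l. h (\<eta> ! x))) =
    (\<Sum>\<eta>\<in>configs (Suc l) N. \<Sum>x<Suc l. h (\<eta> ! x) * (v (\<eta> ! x) * config_weight v (remove_site x \<eta>)))"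
    by (intro sum.cong refl)
       (auto simp: sum_distrib_left configs_def config_weight_remove_site mult.commute
         simp del: sum.lessThan_Suc intro!: sum.cong)
  also have "\<dots> = real (Suc l) * (\<Sum>n\<le>N. \<Sum>\<eta>\<in>configs l (N - n). h n * (v n * config_weight v \<eta>))"
    by (rule sum_configs_sum_sites)
  finally show ?thesis by (simp add: partition_function_def sum_distrib_left)
qed

lemma sum_nth_eq_sum_list:
  fixes h :: "'b \<Rightarrow> 'a::comm_monoid_add"
  shows "length \<eta> = l \<Longrightarrow> (\<Sum>x<l. h (\<eta> ! x)) = sum_list (map h \<eta>)"
  by (simp add: sum_list_sum_nth lessThan_atLeast0)

text \<open>Marks a site with weight equal to its occupation; summed over the sites, these weights
  give the constant \<open>N\<close>.\<close>

lemma Z_mass_identity: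
  "real N * Z v (Suc l) N = real (Suc l) * (\<Sum>n\<le>N. real n * (v n * Z v l (N - n)))"
proof -
  have eq: "(\<Sum>x<Suc l. real (\<eta> ! x)) = real N" if "\<eta> \<in> configs (Suc l) N" for \<eta>
  proof -
    have "(\<Sum>x<Suc l. real (\<eta> ! x)) = real (\<Sum>x<Suc l. \<eta> ! x)" by simp
    also have "(\<Sum>x<Suc l. \<eta> ! x) = N"
      using that sum_nth_eq_sum_list[of \<eta> "Suc l" "\<lambda>n. n"] by (simp add: configs_def del: sum.lessThan_Suc)
    finally show ?thesis .
  qed
  have "real N * Z v (Suc l) N =
    (\<Sum>\<eta>\<in>configs (Suc l) N. config_weight v \<eta> * (\<Sum>x<Suc l. real (\<eta> ! x)))"
    by (simp add: partition_function_def sum_distrib_left eq mult.commute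
         del: sum.lessThan_Suc)
  then show ?thesis by (simp only: sum_configs_weight_sites)
qed

text \<open>The mass function of the single-site marginal (see
  \<open>integral_site_marginal\<close>). The guard \<open>n \<le> N\<close> is there because
  subtraction on naturals would otherwise produce \<open>Z v (l - 1) 0\<close>.\<close>

definition site_prob :: "(nat \<Rightarrow> real) \<Rightarrow> nat \<Rightarrow> nat \<Rightarrow> nat \<Rightarrow> real" where
  "site_prob v l N n = (if n \<le> N then v n * Z v (l - 1) (N - n) / Z v l N else 0)"

lemma site_prob_nonneg: "(\<And>n. 0 \<le> v n) \<Longrightarrow> 0 \<le> site_prob v l N n"
  by (simp add: site_prob_def Z_nonneg)

lemma sum_site_prob:
  assumes "0 < l" "Z v l N \<noteq> 0"
  shows "(\<Sum>n\<le>N. site_prob v l N n) = 1"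
proof -
  obtain k where k: "l = Suc k" using assms(1) gr0_implies_Suc by blast
  have "(\<Sum>n\<le>N. site_prob v l N n) = (\<Sum>n\<le>N. v n * Z v k (N - n)) / Z v l N"
    by (simp add: site_prob_def k sum_divide_distrib)
  then show ?thesis using assms(2) by (simp add: Z_Suc k)
qed

lemma sum_mean_site_prob:
  assumes "0 < l" "Z v l N \<noteq> 0"
  shows "real l * (\<Sum>n\<le>N. real n * site_prob v l N n) = real N"
proof -
  obtain k where k: "l = Suc k" using assms(1) gr0_implies_Suc by blast
  have "(\<Sum>n\<le>N. real n * site_prob v l N n) = (\<Sum>n\<le>N. real n * (v n * Z v k (N - n))) / Z v l N"
    by (simp add: site_prob_def k sum_divide_distrib)
  then have "real l * (\<Sum>n\<le>N. real n * site_prob v l N n) = real N * Z v l N / Z v l N"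
    by (simp only: Z_mass_identity k times_divide_eq_right)
  then show ?thesis using assms(2) by simp
qed

text \<open>Jensen's inequality for the number of sites with occupation \<open>n\<close>.\<close>

lemma exp_site_prob_le:
  fixes t :: real
  assumes v: "\<And>n. 0 \<le> v n" and l: "0 < l" and pos: "0 < Z v l N"
  shows "Z v l N * exp (t * (real l * site_prob v l N n)) \<le>
         Z (\<lambda>i. v i * exp (t * (if i = n then 1 else 0))) l N"
proof -
  obtain k where k: "l = Suc k" using l gr0_implies_Suc by blast
  define K where "K \<eta> = (\<Sum>x<l. if \<eta> ! x = n then 1 else (0::real))" for \<eta> :: "nat list"
  define s where "s = real l * site_prob v l N n"
  have mean: "(\<Sum>\<eta>\<in>configs l N. config_weight v \<eta> * K \<eta>) = s * Z v l N"
  proof -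
    have "(\<Sum>\<eta>\<in>configs l N. config_weight v \<eta> * K \<eta>) =
       real l * (\<Sum>i\<le>N. (if i = n then 1 else 0) * (v i * Z v k (N - i)))"
      unfolding K_def k by (rule sum_configs_weight_sites)
    also have "(\<Sum>i\<le>N. (if i = n then 1 else 0) * (v i * Z v k (N - i))) =
       (if n \<le> N then v n * Z v k (N - n) else 0)"
      by (subst sum.cong[OF refl, where h = "\<lambda>i. if i = n then v n * Z v k (N - n) else 0"]) auto
    finally show ?thesis using pos by (simp add: s_def site_prob_def k)
  qed
  have weight: "config_weight (\<lambda>i. v i * exp (t * (if i = n then 1 else 0))) \<eta> =
      config_weight v \<eta> * exp (t * K \<eta>)" if "\<eta> \<in> configs l N" for \<eta>
    using that unfolding K_def config_weight_def configs_def
    by (auto simp: prod.distrib[symmetric] exp_sum sum_distrib_left intro!: prod.cong)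
  \<comment> \<open>The expression \<open>exp (t * s) * (1 + (t * K \<eta> - t * s))\<close> is the
    tangent of the exponential at \<open>t * s\<close>. Since \<open>K\<close> has canonical mean
    \<open>s\<close>, the tangent has mean \<open>exp (t * s)\<close>, and it lies below the
    exponential.\<close>
  have "(\<Sum>\<eta>\<in>configs l N. config_weight v \<eta> * exp (t * s) * (1 + (t * K \<eta> - t * s))) =
     exp (t * s) * (1 - t * s) * (\<Sum>\<eta>\<in>configs l N. config_weight v \<eta>) +
     exp (t * s) * t * (\<Sum>\<eta>\<in>configs l N. config_weight v \<eta> * K \<eta>)"
    unfolding sum_distrib_left sum.distrib[symmetric]
    by (intro sum.cong refl) (simp add: algebra_simps)
  also have "\<dots> = Z v l N * exp (t * s)"
    unfolding mean by (simp add: partition_function_def algebra_simps)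
  finally have "Z v l N * exp (t * s) =
     (\<Sum>\<eta>\<in>configs l N. config_weight v \<eta> * exp (t * s) * (1 + (t * K \<eta> - t * s)))" ..
  also have "\<dots> \<le> (\<Sum>\<eta>\<in>configs l N. config_weight v \<eta> * exp (t * K \<eta>))"
  proof (rule sum_mono)
    fix \<eta>
    have "exp (t * s) * (1 + (t * K \<eta> - t * s)) \<le> exp (t * s) * exp (t * K \<eta> - t * s)"
      by (intro mult_left_mono exp_ge_add_one_self) auto
    also have "\<dots> = exp (t * K \<eta>)" by (simp add: exp_add[symmetric])
    finally show "config_weight v \<eta> * exp (t * s) * (1 + (t * K \<eta> - t * s)) \<le>
        config_weight v \<eta> * exp (t * K \<eta>)"
      using config_weight_nonneg[of v, OF v] by (simp add: mult.assoc mult_left_mono)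
  qed
  also have "\<dots> = Z (\<lambda>i. v i * exp (t * (if i = n then 1 else 0))) l N"
    unfolding partition_function_def using weight by simp
  finally show ?thesis by (simp add: s_def)
qed

section \<open>Power sums of configurations\<close>

definition power_sum :: "nat \<Rightarrow> nat list \<Rightarrow> real" where
  "power_sum a \<eta> = sum_list (map (\<lambda>n. real n ^ a) \<eta>)"

lemma power_sum_nonneg: "0 \<le> power_sum a \<eta>"
  unfolding power_sum_def by (intro sum_list_nonneg) auto

lemma power_sum_le:
  assumes "1 \<le> a"
  shows "power_sum a \<eta> \<le> real (sum_list \<eta>) ^ a"
proof -
  obtain b where a: "a = Suc b" using assms by (cases a) auto
  have "power_sum a \<eta> \<le> real (sum_list \<eta>) ^ a"
  proof -
    have "real n * real n ^ b \<le> real n * real (sum_list \<eta>) ^ b" if "n \<in> set \<eta>" for n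
      using member_le_sum_list[OF that] by (intro mult_left_mono power_mono) auto
    then have "sum_list (map (\<lambda>n. real n ^ a) \<eta>) \<le> sum_list (map (\<lambda>n. real (sum_list \<eta>) ^ b * real n) \<eta>)"
      by (intro sum_list_mono) (simp add: a mult.commute)
    also have "\<dots> = real (sum_list \<eta>) ^ b * real (sum_list \<eta>)"
    proof -
      have "sum_list (map real \<eta>) = real (sum_list \<eta>)" by (induction \<eta>) auto
      then show ?thesis by (simp add: sum_list_const_mult)
    qed
    finally show ?thesis by (simp add: power_sum_def a mult.commute)
  qed
  then show ?thesis .
qed

text \<open>An unnormalised expectation of a product of power sums. Exponents are attached to
  indices, so a factor may occur repeatedly although \<open>I\<close> is a set; the recursion runs
  over subsets of \<open>I\<close>.\<close>

definition moment_sum :: "(nat \<Rightarrow> nat) \<Rightarrow> (nat \<Rightarrow> real) \<Rightarrow> nat \<Rightarrow> nat \<Rightarrow> nat set \<Rightarrow> real" where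
  "moment_sum a v l N I = (\<Sum>\<eta>\<in>configs l N. config_weight v \<eta> * (\<Prod>i\<in>I. power_sum (a i) \<eta>))"

lemma moment_sum_empty [simp]: "moment_sum a v l N {} = Z v l N"
  by (simp add: moment_sum_def partition_function_def)

lemma moment_sum_nonneg: "(\<And>n. 0 \<le> v n) \<Longrightarrow> 0 \<le> moment_sum a v l N I"
  unfolding moment_sum_def
  by (intro sum_nonneg mult_nonneg_nonneg config_weight_nonneg prod_nonneg power_sum_nonneg) auto

lemma moment_sum_le:
  assumes v: "\<And>n. 0 \<le> v n" and a: "\<And>i. i \<in> I \<Longrightarrow> 1 \<le> a i"
  shows "moment_sum a v l N I \<le> Z v l N * real N ^ (\<Sum>i\<in>I. a i)"
proof -
  have "moment_sum a v l N I \<le> (\<Sum>\<eta>\<in>configs l N. config_weight v \<eta> * (\<Prod>i\<in>I. real N ^ a i))"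
    unfolding moment_sum_def
  proof (intro sum_mono mult_left_mono config_weight_nonneg prod_mono conjI power_sum_nonneg v)
    fix \<eta> i assume "\<eta> \<in> configs l N" "i \<in> I"
    then show "power_sum (a i) \<eta> \<le> real N ^ a i"
      using power_sum_le[OF a, of i \<eta>] by (simp add: configs_def)
  qed
  then show ?thesis by (simp add: partition_function_def sum_distrib_right power_sum[symmetric] prod.cong)
qed

text \<open>The factor with index \<open>k\<close> is expanded over sites, which marks a site
  carrying \<open>n\<close> particles. Every other power sum splits into the term of the marked site
  and the power sum of the rest; \<open>B\<close> is the set of factors that take the marked
  site.\<close>

lemma moment_sum_rec:
  assumes I: "finite I" "k \<in> I"
  shows "moment_sum a v (Suc l) N I = real (Suc l) *
    (\<Sum>n\<le>N. \<Sum>B\<in>Pow (I - {k}). v n * real n ^ (\<Sum>i\<in>insert k B. a i) * moment_sum a v l (N - n) (I - {k} - B))"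
proof -
  define f where "f n \<eta> = (\<Sum>B\<in>Pow (I - {k}). v n * real n ^ (\<Sum>i\<in>insert k B. a i) *
       (config_weight v \<eta> * (\<Prod>i\<in>I - {k} - B. power_sum (a i) \<eta>)))" for n \<eta>
  have "config_weight v \<eta> * (\<Prod>i\<in>I. power_sum (a i) \<eta>) = (\<Sum>x<Suc l. f (\<eta> ! x) (remove_site x \<eta>))"
    if \<eta>: "\<eta> \<in> configs (Suc l) N" for \<eta>
  proof -
    have len: "length \<eta> = Suc l" using \<eta> by (simp add: configs_def)
    have "config_weight v \<eta> * (\<Prod>i\<in>I. power_sum (a i) \<eta>) =
      config_weight v \<eta> * (power_sum (a k) \<eta> * (\<Prod>i\<in>I - {k}. power_sum (a i) \<eta>))"
      by (simp add: prod.remove[OF I])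
    also have "power_sum (a k) \<eta> = (\<Sum>x<Suc l. real (\<eta> ! x) ^ a k)"
      unfolding power_sum_def by (rule sum_nth_eq_sum_list[OF len, symmetric])
    also have "config_weight v \<eta> * ((\<Sum>x<Suc l. real (\<eta> ! x) ^ a k) * (\<Prod>i\<in>I - {k}. power_sum (a i) \<eta>)) =
       (\<Sum>x<Suc l. config_weight v \<eta> * (real (\<eta> ! x) ^ a k * (\<Prod>i\<in>I - {k}. power_sum (a i) \<eta>)))"
      by (simp only: sum_distrib_left sum_distrib_right)
    also have "\<dots> = (\<Sum>x<Suc l. f (\<eta> ! x) (remove_site x \<eta>))"
    proof (intro sum.cong refl)
      fix x assume "x \<in> {..<Suc l}"
      then have x: "x < length \<eta>" using len by simp
      have fB: "finite B" "k \<notin> B" if "B \<in> Pow (I - {k})" for B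
        using that I finite_subset by auto
      have "(\<Prod>i\<in>I - {k}. power_sum (a i) \<eta>) =
        (\<Prod>i\<in>I - {k}. real (\<eta> ! x) ^ a i + power_sum (a i) (remove_site x \<eta>))"
        by (simp add: power_sum_def sum_list_remove_site[OF x])
      also have "\<dots> = (\<Sum>B\<in>Pow (I - {k}). (\<Prod>i\<in>B. real (\<eta> ! x) ^ a i) *
          (\<Prod>i\<in>I - {k} - B. power_sum (a i) (remove_site x \<eta>)))"
        using I by (intro prod_add) auto
      finally show "config_weight v \<eta> * (real (\<eta> ! x) ^ a k * (\<Prod>i\<in>I - {k}. power_sum (a i) \<eta>)) =
          f (\<eta> ! x) (remove_site x \<eta>)"
        using fB unfolding f_def config_weight_remove_site[OF x, of v]
        by (simp only: sum_distrib_left)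
           (auto simp: power_sum power_add intro!: sum.cong)
    qed
    finally show ?thesis .
  qed
  then have "moment_sum a v (Suc l) N I =
      (\<Sum>\<eta>\<in>configs (Suc l) N. \<Sum>x<Suc l. f (\<eta> ! x) (remove_site x \<eta>))"
    unfolding moment_sum_def by (rule sum.cong[OF refl])
  also have "\<dots> = real (Suc l) * (\<Sum>n\<le>N. \<Sum>\<eta>\<in>configs l (N - n). f n \<eta>)"
    by (rule sum_configs_sum_sites)
  also have "(\<lambda>n. \<Sum>\<eta>\<in>configs l (N - n). f n \<eta>) =
    (\<lambda>n. \<Sum>B\<in>Pow (I - {k}). v n * real n ^ (\<Sum>i\<in>insert k B. a i) * moment_sum a v l (N - n) (I - {k} - B))"
    unfolding f_def moment_sum_def by (subst sum.swap) (simp add: sum_distrib_left)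
  finally show ?thesis .
qed


section \<open>Large deviations of the bulk\<close>

text \<open>Chernoff's bound on both sides: outside the window one of two exponentials in the mass
  is at least 1, and after the tilt the sum over all masses factorises into a power.\<close>

lemma Z_large_deviation:
  assumes u: "\<And>i. 0 \<le> u i" "\<And>i. i > J \<Longrightarrow> u i = 0" and B: "k * J \<le> B" and t: "0 < t"
  shows "(\<Sum>m\<in>{m. m \<le> B \<and> \<not> \<bar>real m - \<mu> * real k\<bar> \<le> \<epsilon> * real k}. Z u k m) \<le>
     (\<Sum>i\<le>J. u i * exp (t * (real i - \<mu> - \<epsilon>))) ^ k + (\<Sum>i\<le>J. u i * exp (- t * (real i - \<mu> + \<epsilon>))) ^ k"
proof -
  have tilt: "Z (\<lambda>i. u i * exp (s * (real i - b))) k m = Z u k m * exp (s * (real m - b * real k))"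
    for s b m
  proof -
    have "(\<lambda>i. u i * exp (s * (real i - b))) = (\<lambda>i. exp (- s * b) * (u i * exp s ^ i))"
      by (auto simp: exp_of_nat_mult[symmetric] exp_add[symmetric] algebra_simps)
    then show ?thesis
      by (simp only: Z_tilt)
         (simp add: exp_of_nat_mult[symmetric] exp_add[symmetric] algebra_simps)
  qed
  have total: "(\<Sum>m\<le>B. Z u k m * exp (s * (real m - b * real k))) =
      (\<Sum>i\<le>J. u i * exp (s * (real i - b))) ^ k" for s b
    unfolding tilt[symmetric] by (rule sum_Z_eq_power) (use u B in auto)
  have "(\<Sum>m\<in>{m. m \<le> B \<and> \<not> \<bar>real m - \<mu> * real k\<bar> \<le> \<epsilon> * real k}. Z u k m) \<le>
     (\<Sum>m\<in>{m. m \<le> B \<and> \<not> \<bar>real m - \<mu> * real k\<bar> \<le> \<epsilon> * real k}.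
        Z u k m * exp (t * (real m - (\<mu> + \<epsilon>) * real k)) +
        Z u k m * exp (- t * (real m - (\<mu> - \<epsilon>) * real k)))"
  proof (rule sum_mono)
    fix m assume "m \<in> {m. m \<le> B \<and> \<not> \<bar>real m - \<mu> * real k\<bar> \<le> \<epsilon> * real k}"
    then have "0 < real m - (\<mu> + \<epsilon>) * real k \<or> real m - (\<mu> - \<epsilon>) * real k < 0"
      by (auto simp: abs_le_iff algebra_simps)
    then have "0 \<le> t * (real m - (\<mu> + \<epsilon>) * real k) \<or> 0 \<le> - t * (real m - (\<mu> - \<epsilon>) * real k)"
      using t by (auto simp: mult_le_0_iff)
    then have "1 \<le> exp (t * (real m - (\<mu> + \<epsilon>) * real k)) + exp (- t * (real m - (\<mu> - \<epsilon>) * real k))"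
      by (metis add_increasing add_increasing2 exp_ge_zero one_le_exp_iff)
    then have "Z u k m * 1 \<le> Z u k m * (exp (t * (real m - (\<mu> + \<epsilon>) * real k)) +
        exp (- t * (real m - (\<mu> - \<epsilon>) * real k)))"
      by (intro mult_left_mono Z_nonneg u)
    then show "Z u k m \<le> Z u k m * exp (t * (real m - (\<mu> + \<epsilon>) * real k)) +
        Z u k m * exp (- t * (real m - (\<mu> - \<epsilon>) * real k))"
      by (simp add: distrib_left)
  qed
  also have "\<dots> \<le> (\<Sum>m\<le>B. Z u k m * exp (t * (real m - (\<mu> + \<epsilon>) * real k)) +
        Z u k m * exp (- t * (real m - (\<mu> - \<epsilon>) * real k)))"
    by (intro sum_mono2) (auto intro!: add_nonneg_nonneg mult_nonneg_nonneg Z_nonneg u)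
  also have "\<dots> = (\<Sum>i\<le>J. u i * exp (t * (real i - (\<mu> + \<epsilon>)))) ^ k +
      (\<Sum>i\<le>J. u i * exp (- t * (real i - (\<mu> - \<epsilon>)))) ^ k"
    by (simp only: sum.distrib total)
  finally show ?thesis by (simp add: algebra_simps)
qed

text \<open>Both sums equal \<open>c\<close> at \<open>t = 0\<close> and have derivative
  \<open>- \<epsilon> * c\<close> there, so one small positive \<open>t\<close> decreases
  both.\<close>

lemma exponential_tilt_decreases:
  fixes g :: "nat \<Rightarrow> real"
  assumes c: "(\<Sum>i\<le>J. g i) = c" "0 < c" and mean: "(\<Sum>i\<le>J. real i * g i) = \<mu> * c" and \<epsilon>: "0 < \<epsilon>"
  obtains t where "0 < t" "(\<Sum>i\<le>J. g i * exp (t * (real i - \<mu> - \<epsilon>))) < c"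
    "(\<Sum>i\<le>J. g i * exp (- t * (real i - \<mu> + \<epsilon>))) < c"
proof -
  \<comment> \<open>The sign \<open>s\<close> selects the upper or the lower deviation, and
    \<open>b\<close> is the corresponding edge of the window.\<close>
  define f where "f s b t = (\<Sum>i\<le>J. g i * exp (s * t * (real i - b)))" for s b t :: real
  have deriv: "(f s b has_real_derivative (s * (\<mu> - b) * c)) (at 0)" for s b
  proof -
    have "(f s b has_real_derivative (\<Sum>i\<le>J. g i * (s * (real i - b)))) (at 0)"
      unfolding f_def by (auto intro!: derivative_eq_intros sum.cong)
    also have "(\<Sum>i\<le>J. g i * (s * (real i - b))) = s * (\<Sum>i\<le>J. real i * g i) - s * b * (\<Sum>i\<le>J. g i)"
      by (simp add: sum_distrib_left sum_subtractf[symmetric] algebra_simps)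
    also have "\<dots> = s * (\<mu> - b) * c" by (simp add: mean c algebra_simps)
    finally show ?thesis .
  qed
  have "\<exists>d>0. \<forall>h>0. h < d \<longrightarrow> f s b (0 + h) < f s b 0" if "s * (\<mu> - b) * c < 0" for s b
    by (rule DERIV_neg_dec_right[OF deriv that])
  note * = this
  obtain d1 where d1: "0 < d1" "\<And>h. 0 < h \<Longrightarrow> h < d1 \<Longrightarrow> f 1 (\<mu> + \<epsilon>) h < f 1 (\<mu> + \<epsilon>) 0"
    using *[of 1 "\<mu> + \<epsilon>"] c \<epsilon> by (auto simp: mult_less_0_iff)
  obtain d2 where d2: "0 < d2" "\<And>h. 0 < h \<Longrightarrow> h < d2 \<Longrightarrow> f (-1) (\<mu> - \<epsilon>) h < f (-1) (\<mu> - \<epsilon>) 0"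
    using *[of "-1" "\<mu> - \<epsilon>"] c \<epsilon> by (auto simp: mult_less_0_iff)
  define t where "t = min d1 d2 / 2"
  have t: "0 < t" "t < d1" "t < d2" using d1(1) d2(1) by (auto simp: t_def min_def)
  show ?thesis
    by (rule that[OF t(1)]) (use d1(2)[of t] d2(2)[of t] t c in \<open>simp_all add: f_def algebra_simps\<close>)
qed

lemma eventually_less_of_tendsto:
  fixes f g :: "nat \<Rightarrow> real"
  assumes "f \<longlonglongrightarrow> a" "a < b" "g \<longlonglongrightarrow> b"
  shows "\<forall>\<^sub>F j in sequentially. f j < g j"
proof -
  obtain m where m: "a < m" "m < b" using dense[OF assms(2)] by blast
  show ?thesis
    using order_tendstoD(2)[OF assms(1) m(1)] order_tendstoD(1)[OF assms(3) m(2)]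
    by eventually_elim simp
qed

text \<open>Room between strict inequalities of limits; the k-th powers of the factor
  \<open>q\<close> supply geometric decay.\<close>

lemma ex_factor_less_1:
  fixes a b c :: real
  assumes "a < c" "b < c" "0 < c"
  shows "\<exists>q. 0 < q \<and> q < 1 \<and> a < q * c \<and> b < q * c"
proof -
  obtain p where p: "max (max a b) 0 < p" "p < c" using dense[of "max (max a b) 0" c] assms by auto
  then have "0 < p / c \<and> p / c < 1 \<and> a < p / c * c \<and> b < p / c * c" using assms by (auto simp: field_simps)
  then show ?thesis by blast
qed

text \<open>A crude substitute for the logarithmic growth of harmonic sums: with \<open>N\<close> of
  the order of the number of sites, the square root divided by that number still vanishes. Each new
  term is at most the increment of \<open>2 * sqrt\<close>.\<close>

lemma sum_inverse_le_sqrt: "(\<Sum>i\<in>{J<..N}. 1 / real i) \<le> 2 * sqrt (real N)"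
proof (induction N)
  case 0
  then show ?case by simp
next
  case (Suc N)
  define r where "r = sqrt (real N)" define s where "s = sqrt (real (Suc N))"
  have rs: "0 \<le> r" "r \<le> s" "1 \<le> s" "s\<^sup>2 = r\<^sup>2 + 1" "real (Suc N) = s\<^sup>2" by (auto simp: r_def s_def)
  have "(s - r) * (s + r) = 1" using rs(4) by (simp add: algebra_simps power2_eq_square)
  moreover have "(s - r) * (s + r) \<le> (s - r) * (2 * s)" using rs by (intro mult_left_mono) auto
  ultimately have *: "1 \<le> 2 * (s - r) * s" by (simp only: mult.assoc mult.left_commute)
  have "2 * (s - r) * s * 1 \<le> 2 * (s - r) * s * s"
    using rs by (intro mult_left_mono) auto
  with * have "1 \<le> 2 * (s - r) * s\<^sup>2" by (simp add: power2_eq_square mult.assoc)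
  then have "1 / real (Suc N) \<le> 2 * s - 2 * r"
    unfolding rs(5) using rs(3) by (subst divide_le_eq) (auto simp: algebra_simps)
  moreover have "(\<Sum>i\<in>{J<..Suc N}. 1 / real i) \<le> (\<Sum>i\<in>{J<..N}. 1 / real i) + 1 / real (Suc N)"
  proof (cases "J < Suc N")
    case True
    then have "{J<..Suc N} = insert (Suc N) {J<..N}" by auto
    then show ?thesis by simp
  next
    case False
    then show ?thesis by simp
  qed
  ultimately show ?case using Suc by (simp add: r_def s_def)
qed

section \<open>Tilted weights and the standing assumptions along a sequence of systems\<close>

definition tilt_norm :: "(nat \<Rightarrow> real) \<Rightarrow> real \<Rightarrow> real" where
  "tilt_norm w \<phi> = (\<Sum>n. w n * \<phi> ^ n)"

text \<open>The mean of the law with mass function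
  \<open>w n * \<phi> ^ n / tilt_norm w \<phi>\<close>, the grand canonical measure with fugacity
  \<open>\<phi>\<close>. These laws are the limits of the site marginals.\<close>

definition tilt_mean :: "(nat \<Rightarrow> real) \<Rightarrow> real \<Rightarrow> real" where
  "tilt_mean w \<phi> = (\<Sum>n. real n * w n * \<phi> ^ n) / tilt_norm w \<phi>"

text \<open>System \<open>j\<close> has \<open>l j\<close> sites and weights \<open>v j\<close>, and
  no relation between the two is imposed beyond the limits. So every thermodynamic sequence is an
  instance and deleting a site keeps one. Masses are not part of the locale, since many of them are
  compared within one system.\<close>

locale condensing_weights =
  fixes v :: "nat \<Rightarrow> nat \<Rightarrow> real" and l :: "nat \<Rightarrow> nat" and w :: "nat \<Rightarrow> real" and \<theta> :: real
  assumes l_lim: "filterlim l at_top sequentially"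
    and v_nonneg: "\<forall>\<^sub>F j in sequentially. \<forall>n. 0 \<le> v j n"
    and v_lim: "uniform_limit UNIV v w sequentially"
    and w_sums: "w sums 1" and w0: "0 < w 0" and theta_pos: "0 < \<theta>"
    and tail: "\<And>\<epsilon>. 0 < \<epsilon> \<Longrightarrow>
       \<exists>J. \<forall>\<^sub>F j in sequentially. \<forall>n>J. \<bar>real n * v j n * real (l j) - \<theta>\<bar> \<le> \<epsilon>"
begin

lemma v_tendsto: "(\<lambda>j. v j n) \<longlonglongrightarrow> w n"
  using tendsto_uniform_limitI[OF v_lim] by simp

lemma w_nonneg: "0 \<le> w n"
  by (rule tendsto_lowerbound[OF v_tendsto]) (use v_nonneg in \<open>auto elim: eventually_mono\<close>)

lemma l_real: "filterlim (\<lambda>j. real (l j)) at_top sequentially"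
  using l_lim filterlim_real_sequentially by (rule filterlim_compose[rotated])

lemma eventually_l_ge: "\<forall>\<^sub>F j in sequentially. b \<le> l j"
  using l_lim by (auto simp: filterlim_at_top)

lemma eventually_l_real_ge: "\<forall>\<^sub>F j in sequentially. b \<le> real (l j)"
  using l_real by (auto simp: filterlim_at_top)

text \<open>For fixed \<open>n > J\<close> the upper bound forces \<open>v j n\<close> to vanish
  like 1 / \<open>l j\<close>. The lower bound later prices the absorbing site, and the upper bound
  controls the tails of generating sums.\<close>

lemma cutoff:
  "\<exists>J. (\<forall>n>J. w n = 0) \<and> (\<forall>\<^sub>F j in sequentially.
     \<forall>n>J. \<theta> / 2 \<le> real n * v j n * real (l j) \<and> real n * v j n * real (l j) \<le> 2 * \<theta>)"
proof -
  obtain J where J: "\<forall>\<^sub>F j in sequentially. \<forall>n>J. \<bar>real n * v j n * real (l j) - \<theta>\<bar> \<le> \<theta> / 2"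
    using tail[of "\<theta> / 2"] theta_pos by auto
  have J': "\<forall>\<^sub>F j in sequentially. \<forall>n>J. \<theta> / 2 \<le> real n * v j n * real (l j) \<and> real n * v j n * real (l j) \<le> 2 * \<theta>"
    using J
  proof eventually_elim
    case (elim j)
    show ?case
    proof (intro allI impI)
      fix n assume "J < n"
      with elim have "\<bar>real n * v j n * real (l j) - \<theta>\<bar> \<le> \<theta> / 2" by blast
      then show "\<theta> / 2 \<le> real n * v j n * real (l j) \<and> real n * v j n * real (l j) \<le> 2 * \<theta>"
        using theta_pos unfolding abs_le_iff by argo
    qed
  qed
  have "w n = 0" if "n > J" for n
  proof -
    have "(\<lambda>j. (2 * \<theta> / real n) / real (l j)) \<longlonglongrightarrow> 0"
      by (rule real_tendsto_divide_at_top[OF tendsto_const l_real])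
    then have "w n \<le> 0"
    proof (rule tendsto_le[OF trivial_limit_sequentially _ v_tendsto])
      show "\<forall>\<^sub>F j in sequentially. v j n \<le> 2 * \<theta> / real n / real (l j)"
        using J' eventually_l_ge[of 1]
      proof eventually_elim
        case (elim j)
        then have "real n * v j n * real (l j) \<le> 2 * \<theta>" using that by blast
        then show ?case using that elim(2) by (simp add: field_simps)
      qed
    qed
    with w_nonneg[of n] show ?thesis by simp
  qed
  with J' show ?thesis by blast
qed

lemma w_support: "\<exists>J. \<forall>n>J. w n = 0"
  using cutoff by blast

lemma sum_cutoff:
  assumes "\<forall>n>J. w n = 0"
  shows "(\<Sum>n\<le>J. w n) = 1" "critical_density w = (\<Sum>n\<le>J. real n * w n)"
    "tilt_norm w \<phi> = (\<Sum>n\<le>J. w n * \<phi> ^ n)"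
    "tilt_mean w \<phi> = (\<Sum>n\<le>J. real n * w n * \<phi> ^ n) / (\<Sum>n\<le>J. w n * \<phi> ^ n)"
proof -
  have eq: "(\<Sum>n. f n) = (\<Sum>n\<le>J. f n)" if "\<And>n. w n = 0 \<Longrightarrow> f n = 0" for f :: "nat \<Rightarrow> real"
    by (rule suminf_finite) (use that assms in auto)
  show "(\<Sum>n\<le>J. w n) = 1" using eq[of w] w_sums by (simp add: sums_iff)
  show "critical_density w = (\<Sum>n\<le>J. real n * w n)" by (simp add: critical_density_def eq)
  show n: "tilt_norm w \<phi> = (\<Sum>n\<le>J. w n * \<phi> ^ n)" by (simp add: tilt_norm_def eq)
  show "tilt_mean w \<phi> = (\<Sum>n\<le>J. real n * w n * \<phi> ^ n) / (\<Sum>n\<le>J. w n * \<phi> ^ n)"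
    by (simp add: tilt_mean_def n eq)
qed

lemma tilt_norm_bounds:
  assumes "0 \<le> \<phi>" "\<phi> \<le> 1"
  shows "w 0 \<le> tilt_norm w \<phi>" "tilt_norm w \<phi> \<le> 1"
proof -
  obtain J where J: "\<forall>n>J. w n = 0" using w_support by blast
  have "w 0 * \<phi> ^ 0 \<le> (\<Sum>n\<le>J. w n * \<phi> ^ n)"
    by (rule member_le_sum) (auto intro!: mult_nonneg_nonneg w_nonneg zero_le_power assms)
  then show "w 0 \<le> tilt_norm w \<phi>" by (simp add: sum_cutoff(3)[OF J])
  have "(\<Sum>n\<le>J. w n * \<phi> ^ n) \<le> (\<Sum>n\<le>J. w n * 1)"
    by (intro sum_mono mult_left_mono power_le_one w_nonneg assms)
  then show "tilt_norm w \<phi> \<le> 1" by (simp add: sum_cutoff(3)[OF J] sum_cutoff(1)[OF J])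
qed

lemma tilt_norm_pos: "0 \<le> \<phi> \<Longrightarrow> \<phi> \<le> 1 \<Longrightarrow> 0 < tilt_norm w \<phi>"
  using tilt_norm_bounds(1) w0 by force

lemma tilt_mean_1: "tilt_mean w 1 = critical_density w"
proof -
  obtain J where J: "\<forall>n>J. w n = 0" using w_support by blast
  show ?thesis using sum_cutoff[OF J] by simp
qed

lemma critical_density_nonneg: "0 \<le> critical_density w"
proof -
  obtain J where J: "\<forall>n>J. w n = 0" using w_support by blast
  show ?thesis unfolding sum_cutoff(2)[OF J] by (intro sum_nonneg mult_nonneg_nonneg w_nonneg) auto
qed

lemma tilt_mean_nonneg:
  assumes "0 \<le> \<phi>" "\<phi> \<le> 1"
  shows "0 \<le> tilt_mean w \<phi>"
proof -
  obtain J where J: "\<forall>n>J. w n = 0" using w_support by blast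
  show ?thesis unfolding sum_cutoff(4)[OF J]
    by (intro divide_nonneg_nonneg sum_nonneg mult_nonneg_nonneg w_nonneg zero_le_power assms) auto
qed

text \<open>One site is gone but the weights are still those of the original system; the tail
  condition only changes by the factor \<open>1 - 1 / l j\<close>. This allows size-biasing to be
  iterated in the induction on moments.\<close>

lemma shift: "condensing_weights v (\<lambda>j. l j - 1) w \<theta>"
proof (unfold_locales, goal_cases)
  case 1
  show ?case unfolding filterlim_at_top
  proof
    fix b show "\<forall>\<^sub>F j in sequentially. b \<le> l j - 1"
      using eventually_l_ge[of "Suc b"] by eventually_elim auto
  qed
next
  case (7 \<epsilon>)
  obtain J where J: "\<forall>\<^sub>F j in sequentially. \<forall>n>J. \<bar>real n * v j n * real (l j) - \<theta>\<bar> \<le> \<epsilon> / 2"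
    using tail[of "\<epsilon> / 2"] 7 by auto
  have "\<forall>\<^sub>F j in sequentially. \<forall>n>J. \<bar>real n * v j n * real (l j - 1) - \<theta>\<bar> \<le> \<epsilon>"
    \<comment> \<open>The last threshold makes the correction \<open>x / real (l j)\<close>, with
      \<open>x\<close> at most \<open>\<theta> + \<epsilon> / 2\<close>, no larger than
      \<open>\<epsilon> / 2\<close>.\<close>
    using J eventually_l_ge[of 1] eventually_l_real_ge[of "2 * (\<theta> + \<epsilon> / 2) / \<epsilon>"]
  proof eventually_elim
    case (elim j)
    show ?case
    proof (intro allI impI)
      fix n assume "J < n"
      define x where "x = real n * v j n * real (l j)"
      have x: "\<bar>x - \<theta>\<bar> \<le> \<epsilon> / 2" using elim \<open>J < n\<close> by (auto simp: x_def)
      have eq: "real n * v j n * real (l j - 1) = x - x / real (l j)"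
        using elim(2) by (simp add: x_def of_nat_diff field_simps)
      have "\<bar>x / real (l j)\<bar> = \<bar>x\<bar> / real (l j)" by simp
      also have "\<dots> \<le> (\<theta> + \<epsilon> / 2) / real (l j)"
        using x theta_pos by (intro divide_right_mono) linarith+
      also have "\<dots> \<le> \<epsilon> / 2"
        using elim(2,3) 7 by (simp add: field_simps)
      finally show "\<bar>real n * v j n * real (l j - 1) - \<theta>\<bar> \<le> \<epsilon>"
        unfolding eq using x by linarith
    qed
  qed
  then show ?case by blast
qed (use v_nonneg v_lim w_sums w0 theta_pos in auto)

text \<open>All particles on one site already have positive weight once \<open>v j m\<close> is
  positive. The bound \<open>J\<close> depends neither on \<open>j\<close> nor on the number of
  sites, so no density enters.\<close>

lemma Z_pos: "\<exists>J. \<forall>\<^sub>F j in sequentially. \<forall>m>J. 0 < Z (v j) (l j) m"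
proof -
  obtain J where J: "\<forall>\<^sub>F j in sequentially. \<forall>n>J. \<theta> / 2 \<le> real n * v j n * real (l j) \<and> real n * v j n * real (l j) \<le> 2 * \<theta>"
    using cutoff by blast
  have v0: "\<forall>\<^sub>F j in sequentially. 0 < v j 0"
    by (rule order_tendstoD(1)[OF v_tendsto w0])
  have "\<forall>\<^sub>F j in sequentially. \<forall>m>J. 0 < Z (v j) (l j) m"
    using J v0 v_nonneg eventually_l_ge[of 1]
  proof eventually_elim
    case (elim j)
    show ?case
    proof (intro allI impI)
      fix m assume "m > J"
      then have "0 < real m * v j m * real (l j)" using elim(1) theta_pos by (metis half_gt_zero less_le_trans)
      then have "0 < v j m" using elim(3) by (metis less_eq_real_def mult_zero_left mult_zero_right)
      then have "0 < v j m * v j 0 ^ (l j - 1)" using elim(2) by simp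
      also have "\<dots> \<le> Z (v j) (Suc (l j - 1)) m" by (rule Z_single) (use elim in auto)
      finally show "0 < Z (v j) (l j) m" using elim(4) by simp
    qed
  qed
  then show ?thesis by blast
qed


text \<open>All sites but one are in a typical bulk configuration, and the last site absorbs the surplus.\<close>

lemma Z_lower_bound:
  fixes N :: "nat \<Rightarrow> nat"
  assumes \<phi>: "0 < \<phi>" "\<phi> \<le> 1" and r1: "tilt_mean w \<phi> < r1"
    and N: "\<forall>\<^sub>F j in sequentially. r1 * real (l j) \<le> real (N j) \<and> real (N j) \<le> r2 * real (l j)"
    and \<kappa>: "0 < \<kappa>"
  shows "\<forall>\<^sub>F j in sequentially.
     (tilt_norm w \<phi> * exp (- ((r2 - tilt_mean w \<phi>) * ln (1 / \<phi>) + \<kappa>))) ^ l j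
       \<le> Z (v j) (l j) (N j) * \<phi> ^ N j"
proof -
  define \<mu> where "\<mu> = tilt_mean w \<phi>"
  define c where "c = tilt_norm w \<phi>"
  define a where "a = ln (1 / \<phi>)"
  have a: "0 \<le> a" "\<phi> = exp (- a)" using \<phi> by (auto simp: a_def ln_div)
  have \<mu>: "0 \<le> \<mu>" "\<mu> < r1" using r1 \<phi> tilt_mean_nonneg by (auto simp: \<mu>_def)
  have c: "0 < c" "c \<le> 1" using tilt_norm_pos tilt_norm_bounds \<phi> by (auto simp: c_def)
  obtain J where J: "\<forall>n>J. w n = 0"
    "\<forall>\<^sub>F j in sequentially. \<forall>n>J. \<theta> / 2 \<le> real n * v j n * real (l j) \<and> real n * v j n * real (l j) \<le> 2 * \<theta>"
    using cutoff by blast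
  have r2: "0 < r2"
  proof -
    obtain j where "r1 * real (l j) \<le> real (N j) \<and> real (N j) \<le> r2 * real (l j)" "1 \<le> l j"
      using eventually_happens[OF eventually_conj[OF N eventually_l_ge[of 1]]] by auto
    then have "r1 * real (l j) \<le> r2 * real (l j)" "0 < real (l j)" by linarith+
    then show ?thesis using \<mu> by auto
  qed
  \<comment> \<open>The first bound keeps the bulk window below \<open>r1\<close>, so the absorbing
    site stays large; the second keeps the cost \<open>\<epsilon> * (1 + a)\<close> per site within
    half of \<open>\<kappa>\<close>.\<close>
  define \<epsilon> where "\<epsilon> = min ((r1 - \<mu>) / 2) (\<kappa> / (2 * (a + 1)))"
  have \<epsilon>: "0 < \<epsilon>" "\<epsilon> \<le> (r1 - \<mu>) / 2" "\<epsilon> * (a + 1) \<le> \<kappa> / 2"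
  proof -
    show "0 < \<epsilon>" using \<mu> \<kappa> a by (auto simp: \<epsilon>_def)
    show "\<epsilon> \<le> (r1 - \<mu>) / 2" unfolding \<epsilon>_def by (rule min.cobounded1)
    have "\<epsilon> \<le> \<kappa> / (2 * (a + 1))" unfolding \<epsilon>_def by (rule min.cobounded2)
    then show "\<epsilon> * (a + 1) \<le> \<kappa> / 2" using a by (simp add: field_simps)
  qed
  define u where "u j i = (if i \<le> J then v j i * \<phi> ^ i else 0)" for j i
  define S where "S j = {m. m \<le> (l j - 1) * J \<and> \<bar>real m - \<mu> * real (l j - 1)\<bar> \<le> \<epsilon> * real (l j - 1)}" for j
  define C where "C j = (\<Sum>i\<le>J. u j i)" for j
  have u_sum: "(\<lambda>j. \<Sum>i\<le>J. u j i * f i) \<longlonglongrightarrow> (\<Sum>i\<le>J. w i * \<phi> ^ i * f i)" for f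
    unfolding u_def by (intro tendsto_sum) (auto intro!: tendsto_intros v_tendsto)
  have c_eq: "c = (\<Sum>i\<le>J. w i * \<phi> ^ i)" by (simp add: c_def sum_cutoff(3)[OF J(1)])
  have \<mu>_eq: "(\<Sum>i\<le>J. real i * (w i * \<phi> ^ i)) = \<mu> * c"
    using c by (simp add: \<mu>_def sum_cutoff(4)[OF J(1)] c_eq mult.assoc)
  obtain t where t: "0 < t" "(\<Sum>i\<le>J. w i * \<phi> ^ i * exp (t * (real i - \<mu> - \<epsilon>))) < c"
    "(\<Sum>i\<le>J. w i * \<phi> ^ i * exp (- t * (real i - \<mu> + \<epsilon>))) < c"
    using exponential_tilt_decreases[OF c_eq[symmetric] c(1) \<mu>_eq \<epsilon>(1)] by blast
  have C_lim: "C \<longlonglongrightarrow> c" using u_sum[of "\<lambda>_. 1"] by (simp add: C_def[abs_def] c_eq)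
  \<comment> \<open>At least half of the truncated tilted weight sits in the window
    \<open>S j\<close>: each of the two deviations carries at most a fraction
    \<open>q ^ (l j - 1) < 1 / 4\<close>.\<close>
  have bulk: "\<forall>\<^sub>F j in sequentially. C j ^ (l j - 1) / 2 \<le> (\<Sum>m\<in>S j. Z (u j) (l j - 1) m)"
  proof -
    define A where "A j = (\<Sum>i\<le>J. u j i * exp (t * (real i - \<mu> - \<epsilon>)))" for j
    define B where "B j = (\<Sum>i\<le>J. u j i * exp (- t * (real i - \<mu> + \<epsilon>)))" for j
    obtain q where q: "q < 1" "(\<Sum>i\<le>J. w i * \<phi> ^ i * exp (t * (real i - \<mu> - \<epsilon>))) < q * c"
      "(\<Sum>i\<le>J. w i * \<phi> ^ i * exp (- t * (real i - \<mu> + \<epsilon>))) < q * c" "0 < q"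
      using ex_factor_less_1[OF t(2,3) c(1)] by blast
    have "A \<longlonglongrightarrow> (\<Sum>i\<le>J. w i * \<phi> ^ i * exp (t * (real i - \<mu> - \<epsilon>)))" unfolding A_def by (rule u_sum)
    moreover have qC: "(\<lambda>j. q * C j) \<longlonglongrightarrow> q * c" by (intro tendsto_intros C_lim)
    ultimately have "\<forall>\<^sub>F j in sequentially. A j < q * C j" using q(2) eventually_less_of_tendsto by blast
    moreover have "B \<longlonglongrightarrow> (\<Sum>i\<le>J. w i * \<phi> ^ i * exp (- t * (real i - \<mu> + \<epsilon>)))"
      unfolding B_def by (rule u_sum)
    then have "\<forall>\<^sub>F j in sequentially. B j < q * C j" using q(3) qC eventually_less_of_tendsto by blast
    moreover have "\<forall>\<^sub>F j in sequentially. q ^ (l j - 1) < 1 / 4"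
    proof -
      have "(\<lambda>k. q ^ k) \<longlonglongrightarrow> 0" using q by (intro LIMSEQ_realpow_zero) auto
      then have "\<forall>\<^sub>F k in sequentially. q ^ k < 1 / 4" by (rule order_tendstoD) auto
      moreover have "filterlim (\<lambda>j. l j - 1) at_top sequentially"
        using condensing_weights.l_lim[OF shift] .
      ultimately show ?thesis by (rule eventually_compose_filterlim)
    qed
    ultimately show ?thesis using v_nonneg
    proof eventually_elim
      case (elim j)
      define k where "k = l j - 1"
      have u0: "0 \<le> u j i" for i using elim(4) \<phi> by (auto simp: u_def)
      have uJ: "u j i = 0" if "i > J" for i using that by (simp add: u_def)
      have C0: "0 \<le> C j" unfolding C_def by (intro sum_nonneg u0)
      have A0: "0 \<le> A j" "0 \<le> B j" unfolding A_def B_def by (auto intro!: sum_nonneg mult_nonneg_nonneg u0)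
      have "C j ^ k = (\<Sum>m\<le>k * J. Z (u j) k m)"
        unfolding C_def by (rule sum_Z_eq_power[symmetric]) (auto simp: uJ)
      also have "{..k * J} = S j \<union> {m. m \<le> k * J \<and> \<not> \<bar>real m - \<mu> * real k\<bar> \<le> \<epsilon> * real k}"
        by (auto simp: S_def k_def)
      also have "(\<Sum>m\<in>\<dots>. Z (u j) k m) = (\<Sum>m\<in>S j. Z (u j) k m) +
         (\<Sum>m\<in>{m. m \<le> k * J \<and> \<not> \<bar>real m - \<mu> * real k\<bar> \<le> \<epsilon> * real k}. Z (u j) k m)"
        by (rule sum.union_disjoint) (auto simp: S_def k_def)
      also have "\<dots> \<le> (\<Sum>m\<in>S j. Z (u j) k m) + (A j ^ k + B j ^ k)"
        unfolding A_def B_def by (intro add_left_mono Z_large_deviation u0 uJ order_refl t(1))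
      also have "A j ^ k + B j ^ k \<le> (q * C j) ^ k + (q * C j) ^ k"
        using elim A0 by (intro add_mono power_mono) auto
      also have "\<dots> = 2 * q ^ k * C j ^ k" by (simp add: power_mult_distrib)
      also have "\<dots> \<le> 1 / 2 * C j ^ k"
        using elim(3) C0 by (intro mult_right_mono) (auto simp: k_def)
      finally show ?case by (simp add: k_def)
    qed
  qed
  have C_ge: "\<forall>\<^sub>F j in sequentially. c * exp (- \<epsilon>) < C j"
    by (rule order_tendstoD(1)[OF C_lim]) (use c \<epsilon> in auto)
  \<comment> \<open>The second half of \<open>\<kappa>\<close> pays for the polynomially small
    weight of the absorbing site.\<close>
  have poly: "\<forall>\<^sub>F j in sequentially.
      exp (- (\<kappa> / 2) * real (l j)) \<le> \<theta> / (4 * r2) / (real (l j))\<^sup>2 * exp (- a * \<mu>)"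
  proof -
    define K where "K = \<theta> / (4 * r2) * exp (- a * \<mu>)"
    have "0 < K" using theta_pos r2 by (simp add: K_def)
    moreover have "0 < \<kappa> / 2" using \<kappa> by simp
    ultimately have "\<forall>\<^sub>F x in at_top. exp (- (\<kappa> / 2) * x) \<le> K / x\<^sup>2" by real_asymp
    then have "\<forall>\<^sub>F j in sequentially. exp (- (\<kappa> / 2) * real (l j)) \<le> K / (real (l j))\<^sup>2"
      using l_real by (rule eventually_compose_filterlim)
    then show ?thesis by (simp add: K_def algebra_simps)
  qed
  show ?thesis
    \<comment> \<open>The last threshold guarantees that the absorbing site holds more than
      \<open>J\<close> particles, where the lower bound on the weights is available.\<close>
    using bulk C_ge poly J(2) N v_nonneg eventually_l_ge[of 1] eventually_l_real_ge[of "real (J + 1) / ((r1 - \<mu>) / 2)"]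
  proof eventually_elim
    case (elim j)
    define k where "k = l j - 1"
    have lk: "l j = Suc k" "real (l j) = real k + 1" using elim(7) by (auto simp: k_def)
    have u0: "0 \<le> u j i" for i using elim(6) \<phi> by (auto simp: u_def)
    have vN: "0 \<le> v j n" for n using elim by auto
    \<comment> \<open>Lower bound for the tilted weight of the absorbing site. Its occupation
      \<open>s\<close> is at most \<open>r2 * l j\<close>, so its weight is at least
      \<open>\<theta> / 2 / (s * l j)\<close>, which gives the inverse square. The additional
      \<open>\<mu>\<close> in the exponent arises because the bulk has \<open>l j - 1\<close>
      sites.\<close>
    define b where "b = \<theta> / (2 * r2) / (real (l j))\<^sup>2 * exp (- a * ((r2 - \<mu> + \<epsilon>) * real (l j) + \<mu>))"
    have last: "m < N j \<and> b \<le> v j (N j - m) * \<phi> ^ (N j - m)" if "m \<in> S j" for m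
    proof -
      have m: "real m \<le> (\<mu> + \<epsilon>) * real k" "(\<mu> - \<epsilon>) * real k \<le> real m"
        using that by (auto simp: S_def k_def abs_le_iff algebra_simps)
      have "(\<mu> + \<epsilon>) * real k \<le> (\<mu> + \<epsilon>) * real (l j)" using \<mu> \<epsilon> lk by (intro mult_left_mono) auto
      with m have m': "real m \<le> (\<mu> + \<epsilon>) * real (l j)" by linarith
      have "(r1 - \<mu>) / 2 * real (l j) \<le> (r1 - \<mu> - \<epsilon>) * real (l j)"
        using \<epsilon> by (intro mult_right_mono) auto
      also have "\<dots> \<le> real (N j) - real m" using elim(5) m' by (simp add: algebra_simps)
      finally have "real (J + 1) \<le> real (N j) - real m"
        using elim(8) \<mu> by (simp add: field_simps)
      then have big: "m < N j" "J < N j - m" by linarith+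
      define s where "s = N j - m"
      have s: "real s = real (N j) - real m" "J < s" using big by (auto simp: s_def)
      have "(\<mu> - \<epsilon>) * real (l j) - \<mu> \<le> (\<mu> - \<epsilon>) * real k" using \<epsilon> by (simp add: lk algebra_simps)
      then have s_le: "real s \<le> (r2 - \<mu> + \<epsilon>) * real (l j) + \<mu>"
        using m elim(5) s by (simp add: algebra_simps)
      have s_le': "real s \<le> r2 * real (l j)" using elim(5) s by simp
      have "exp (- a * ((r2 - \<mu> + \<epsilon>) * real (l j) + \<mu>)) \<le> exp (- a * real s)"
        using s_le a by (auto intro!: mult_left_mono)
      also have "\<dots> = \<phi> ^ s" by (simp add: a(2) exp_of_nat_mult[symmetric] mult.commute)
      finally have 1: "exp (- a * ((r2 - \<mu> + \<epsilon>) * real (l j) + \<mu>)) \<le> \<phi> ^ s" .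
      have ls: "0 < real s" "0 < real (l j)" using s lk by auto
      have "\<theta> / 2 \<le> real s * v j s * real (l j)" using elim(4) s(2) by blast
      then have "\<theta> / 2 / (real s * real (l j)) \<le> v j s" using ls by (simp add: field_simps)
      moreover have "\<theta> / 2 / (r2 * real (l j) * real (l j)) \<le> \<theta> / 2 / (real s * real (l j))"
        using ls s_le' theta_pos r2 by (intro divide_left_mono mult_right_mono) auto
      ultimately have 2: "\<theta> / (2 * r2) / (real (l j))\<^sup>2 \<le> v j s" by (simp add: power2_eq_square mult.assoc)
      show ?thesis
        using big mult_mono[OF 2 1 vN exp_ge_zero] by (simp add: b_def s_def)
    qed
    have "b * (C j ^ k / 2) \<le> b * (\<Sum>m\<in>S j. Z (u j) k m)"
    proof (rule mult_left_mono)
      show "C j ^ k / 2 \<le> (\<Sum>m\<in>S j. Z (u j) k m)" using elim(1) by (simp add: k_def)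
      show "0 \<le> b" using theta_pos r2 by (simp add: b_def)
    qed
    also have "\<dots> \<le> (\<Sum>m\<in>S j. (v j (N j - m) * \<phi> ^ (N j - m)) * Z (u j) k m)"
      unfolding sum_distrib_left by (intro sum_mono mult_right_mono Z_nonneg u0) (use last in auto)
    also have "\<dots> \<le> Z (\<lambda>i. v j i * \<phi> ^ i) (Suc k) (N j)"
    proof (rule Z_ge_last_site)
      show "u j i \<le> v j i * \<phi> ^ i" for i using vN \<phi> by (simp add: u_def)
      show "S j \<subseteq> {..N j}" using last by (auto simp: less_imp_le)
    qed (rule u0)
    also have "\<dots> = Z (v j) (l j) (N j) * \<phi> ^ N j"
      using Z_tilt[of 1 "v j" \<phi>] by (simp add: lk mult.commute)
    finally have main: "b * (C j ^ k / 2) \<le> Z (v j) (l j) (N j) * \<phi> ^ N j" .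
    have "(c * exp (- ((r2 - \<mu>) * a + \<kappa>))) ^ l j =
        c ^ l j * exp (- \<epsilon> * (1 + a) * real (l j)) * exp (- (r2 - \<mu>) * a * real (l j)) *
          exp (- (\<kappa> - \<epsilon> * (1 + a)) * real (l j))"
      by (simp add: power_mult_distrib exp_of_nat_mult[symmetric] exp_add[symmetric] algebra_simps)
    also have "\<dots> \<le> c ^ k * exp (- \<epsilon> * (1 + a) * real (l j)) * exp (- (r2 - \<mu>) * a * real (l j)) *
          (\<theta> / (4 * r2) / (real (l j))\<^sup>2 * exp (- a * \<mu>))"
    proof (intro mult_mono)
      show "c ^ l j \<le> c ^ k" using c by (intro power_decreasing) (auto simp: lk)
      have "exp (- (\<kappa> - \<epsilon> * (1 + a)) * real (l j)) \<le> exp (- (\<kappa> / 2) * real (l j))"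
      proof -
        have "\<kappa> / 2 * real (l j) \<le> (\<kappa> - \<epsilon> * (1 + a)) * real (l j)"
          using \<epsilon>(3) by (intro mult_right_mono) (auto simp: add.commute)
        then show ?thesis by (simp only: exp_le_cancel_iff mult_minus_left neg_le_iff_le)
      qed
      with elim(3) show "exp (- (\<kappa> - \<epsilon> * (1 + a)) * real (l j)) \<le> \<theta> / (4 * r2) / (real (l j))\<^sup>2 * exp (- a * \<mu>)"
        by linarith
    qed (use c in auto)
    also have "\<dots> = b * ((c ^ k * exp (- \<epsilon> * real (l j))) / 2)"
      by (simp add: b_def exp_add[symmetric] algebra_simps)
    also have "\<dots> \<le> b * (C j ^ k / 2)"
    proof (rule mult_left_mono)
      have "c ^ k * exp (- \<epsilon> * real (l j)) \<le> c ^ k * exp (- \<epsilon> * real k)"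
        using c \<epsilon> by (intro mult_left_mono) (auto simp: lk)
      also have "\<dots> = (c * exp (- \<epsilon>)) ^ k"
        by (simp add: power_mult_distrib exp_of_nat_mult[symmetric] algebra_simps)
      also have "\<dots> \<le> C j ^ k" using elim(2) c by (intro power_mono) auto
      finally show "c ^ k * exp (- \<epsilon> * real (l j)) / 2 \<le> C j ^ k / 2" by simp
      show "0 \<le> b" using theta_pos r2 by (simp add: b_def)
    qed
    also note main
    finally show ?case by (simp add: c_def \<mu>_def a_def)
  qed
qed

end


section \<open>Single-site marginals\<close>

context condensing_weights
begin

text \<open>Up to a fixed cutoff the sum converges termwise; beyond it the terms are at most
  \<open>2 * \<theta> / (l j * i)\<close>, whose sum up to \<open>N j\<close> vanishes because
  \<open>N j\<close> is of the order of \<open>l j\<close>.\<close>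

lemma generating_sum_le:
  fixes N :: "nat \<Rightarrow> nat"
  assumes \<phi>: "0 < \<phi>" "\<phi> \<le> 1" and r: "0 < r"
    and N: "\<forall>\<^sub>F j in sequentially. real (N j) \<le> r * real (l j)" and N': "filterlim N at_top sequentially"
    and \<kappa>: "0 < \<kappa>"
  shows "\<forall>\<^sub>F j in sequentially. (\<Sum>i\<le>N j. v j i * \<phi> ^ i * exp (t * (if i = n then 1 else 0)))
     \<le> tilt_norm w \<phi> + w n * \<phi> ^ n * (exp t - 1) + \<kappa>"
proof -
  obtain J0 where J0: "\<forall>n>J0. w n = 0"
    "\<forall>\<^sub>F j in sequentially. \<forall>n>J0. \<theta> / 2 \<le> real n * v j n * real (l j) \<and> real n * v j n * real (l j) \<le> 2 * \<theta>"
    using cutoff by blast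
  \<comment> \<open>The cutoff includes \<open>n\<close>, so the factor \<open>e i\<close> equals 1
    on the whole tail.\<close>
  define J where "J = max J0 n"
  define e where "e i = exp (t * (if i = n then 1 else 0))" for i
  have wJ: "\<forall>n>J. w n = 0" using J0 by (simp add: J_def)
  have "(\<lambda>j. \<Sum>i\<le>J. v j i * \<phi> ^ i * e i) \<longlonglongrightarrow> (\<Sum>i\<le>J. w i * \<phi> ^ i * e i)"
    by (intro tendsto_intros v_tendsto)
  also have "(\<Sum>i\<le>J. w i * \<phi> ^ i * e i) =
      (\<Sum>i\<le>J. w i * \<phi> ^ i + (if i = n then w n * \<phi> ^ n * (exp t - 1) else 0))"
    by (intro sum.cong) (auto simp: e_def algebra_simps)
  also have "\<dots> = tilt_norm w \<phi> + w n * \<phi> ^ n * (exp t - 1)"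
    by (simp add: sum.distrib sum_cutoff(3)[OF wJ] J_def)
  finally have main: "\<forall>\<^sub>F j in sequentially. (\<Sum>i\<le>J. v j i * \<phi> ^ i * e i) <
      tilt_norm w \<phi> + w n * \<phi> ^ n * (exp t - 1) + \<kappa> / 2"
    by (rule order_tendstoD(2)) (use \<kappa> in auto)
  have "((\<lambda>x. 4 * \<theta> * sqrt (r * x) / x) \<longlongrightarrow> 0) at_top"
    using theta_pos r by real_asymp
  then have "(\<lambda>j. 4 * \<theta> * sqrt (r * real (l j)) / real (l j)) \<longlonglongrightarrow> 0"
    using l_real by (rule filterlim_compose)
  then have "\<forall>\<^sub>F j in sequentially. 4 * \<theta> * sqrt (r * real (l j)) / real (l j) < \<kappa> / 2"
    by (rule order_tendstoD(2)) (use \<kappa> in auto)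
  moreover have "\<forall>\<^sub>F j in sequentially. J \<le> N j" using N' by (auto simp: filterlim_at_top)
  ultimately show ?thesis
    using main N J0(2) v_nonneg eventually_l_ge[of 1]
  proof eventually_elim
    case (elim j)
    have lpos: "0 < real (l j)" using elim(7) by simp
    have "{..N j} = {..J} \<union> {J<..N j}" using elim(2) by auto
    then have "(\<Sum>i\<le>N j. v j i * \<phi> ^ i * e i) =
       (\<Sum>i\<le>J. v j i * \<phi> ^ i * e i) + (\<Sum>i\<in>{J<..N j}. v j i * \<phi> ^ i * e i)"
      by (simp add: sum.union_disjoint ivl_disj_int)
    also have "(\<Sum>i\<in>{J<..N j}. v j i * \<phi> ^ i * e i) \<le> (\<Sum>i\<in>{J<..N j}. 2 * \<theta> / real (l j) * (1 / real i))"
    proof (rule sum_mono)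
      fix i assume i: "i \<in> {J<..N j}"
      then have "real i * v j i * real (l j) \<le> 2 * \<theta>" "0 < i" using elim(5) by (auto simp: J_def)
      then have "v j i \<le> 2 * \<theta> / real (l j) * (1 / real i)" using lpos by (simp add: field_simps)
      moreover have "v j i * \<phi> ^ i * e i \<le> v j i * 1"
      proof -
        have "e i = 1" using i by (auto simp: e_def J_def)
        moreover have "v j i * \<phi> ^ i \<le> v j i * 1"
          using elim(6) \<phi> by (intro mult_left_mono power_le_one) auto
        ultimately show ?thesis by simp
      qed
      ultimately show "v j i * \<phi> ^ i * e i \<le> 2 * \<theta> / real (l j) * (1 / real i)" by simp
    qed
    also have "\<dots> \<le> 2 * \<theta> / real (l j) * (2 * sqrt (real (N j)))"
      unfolding sum_distrib_left[symmetric]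
      by (intro mult_left_mono sum_inverse_le_sqrt) (use theta_pos in auto)
    also have "\<dots> \<le> 2 * \<theta> / real (l j) * (2 * sqrt (r * real (l j)))"
      using elim(4) theta_pos by (intro mult_left_mono) auto
    also have "\<dots> = 4 * \<theta> * sqrt (r * real (l j)) / real (l j)" by simp
    finally show ?case using elim(1,3) unfolding e_def by linarith
  qed
qed

text \<open>Jensen's inequality is combined with the product upper bound for the perturbed weights
  and the lower bound for \<open>Z\<close>; the \<open>l j\<close>-th root leaves a bound per site.
  The term with \<open>ln (1 / \<phi>)\<close> is the price of placing the mass beyond the tilted
  mean on one site.\<close>

lemma site_prob_exponential_bound:
  fixes N :: "nat \<Rightarrow> nat"
  assumes \<phi>: "0 < \<phi>" "\<phi> \<le> 1" and r1: "tilt_mean w \<phi> < r1"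
    and N: "\<forall>\<^sub>F j in sequentially. r1 * real (l j) \<le> real (N j) \<and> real (N j) \<le> r2 * real (l j)"
    and \<kappa>: "0 < \<kappa>"
  shows "\<forall>\<^sub>F j in sequentially. t * site_prob (v j) (l j) (N j) n \<le>
     w n * \<phi> ^ n / tilt_norm w \<phi> * (exp t - 1) + (r2 - tilt_mean w \<phi>) * ln (1 / \<phi>) + \<kappa>"
proof -
  define c where "c = tilt_norm w \<phi>"
  define R where "R = (r2 - tilt_mean w \<phi>) * ln (1 / \<phi>) + \<kappa> / 2"
  define g where "g = c + w n * \<phi> ^ n * (exp t - 1)"
  have c: "0 < c" using tilt_norm_pos \<phi> by (auto simp: c_def)
  have r1_pos: "0 < r1" using r1 tilt_mean_nonneg[of \<phi>] \<phi> by linarith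
  have N_lim: "filterlim N at_top sequentially"
  proof -
    have "filterlim (\<lambda>j. real (N j)) at_top sequentially"
    proof (rule filterlim_at_top_mono)
      show "filterlim (\<lambda>j. r1 * real (l j)) at_top sequentially"
        using r1_pos l_real by (rule filterlim_tendsto_pos_mult_at_top[OF tendsto_const])
      show "\<forall>\<^sub>F j in sequentially. r1 * real (l j) \<le> real (N j)"
        using N by eventually_elim simp
    qed
    then show ?thesis by (simp add: filterlim_at_top) (metis (mono_tags, lifting) of_nat_le_iff eventually_mono)
  qed
  have N_le: "\<forall>\<^sub>F j in sequentially. real (N j) \<le> max r2 1 * real (l j)"
    using N
  proof eventually_elim
    case (elim j)
    have "r2 * real (l j) \<le> max r2 1 * real (l j)" by (intro mult_right_mono) auto
    with elim show ?case by linarith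
  qed
  have lower: "\<forall>\<^sub>F j in sequentially. (c * exp (- R)) ^ l j \<le> Z (v j) (l j) (N j) * \<phi> ^ N j"
    using Z_lower_bound[OF \<phi> r1 N, of "\<kappa> / 2"] \<kappa> by (simp add: c_def R_def)
  have "0 < c * \<kappa> / 2" using c \<kappa> by simp
  from generating_sum_le[OF \<phi> _ N_le N_lim this, of t n]
  have upper: "\<forall>\<^sub>F j in sequentially. (\<Sum>i\<le>N j. v j i * \<phi> ^ i * exp (t * (if i = n then 1 else 0)))
     \<le> g + c * \<kappa> / 2" by (simp add: g_def c_def)
  obtain J where J: "\<forall>\<^sub>F j in sequentially. \<forall>m>J. 0 < Z (v j) (l j) m" using Z_pos by blast
  have "\<forall>\<^sub>F j in sequentially. J < N j" using N_lim unfolding filterlim_at_top Suc_le_eq[symmetric] by blast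
  with lower upper J show ?thesis using v_nonneg eventually_l_ge[of 1]
  proof eventually_elim
    case (elim j)
    define S where "S = (\<Sum>i\<le>N j. v j i * \<phi> ^ i * exp (t * (if i = n then 1 else 0)))"
    define p where "p = site_prob (v j) (l j) (N j) n"
    have Zp: "0 < Z (v j) (l j) (N j)" using elim by blast
    have v0: "0 \<le> v j i" for i using elim by blast
    have "\<phi> ^ N j * (Z (v j) (l j) (N j) * exp (t * (real (l j) * p))) \<le>
        \<phi> ^ N j * Z (\<lambda>i. v j i * exp (t * (if i = n then 1 else 0))) (l j) (N j)"
      unfolding p_def using \<phi> elim(6) Zp by (intro mult_left_mono exp_site_prob_le v0) auto
    also have "\<dots> = Z (\<lambda>i. v j i * \<phi> ^ i * exp (t * (if i = n then 1 else 0))) (l j) (N j)"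
      using Z_tilt[of 1 "\<lambda>i. v j i * exp (t * (if i = n then 1 else 0))" \<phi>] by (simp add: mult_ac)
    also have "\<dots> \<le> S ^ l j"
      unfolding S_def by (rule Z_le_power) (use v0 \<phi> in auto)
    finally have "(Z (v j) (l j) (N j) * \<phi> ^ N j) * exp (t * (real (l j) * p)) \<le> S ^ l j"
      by (simp add: mult_ac)
    moreover have "(c * exp (- R)) ^ l j * exp (t * (real (l j) * p)) \<le>
        (Z (v j) (l j) (N j) * \<phi> ^ N j) * exp (t * (real (l j) * p))"
      using elim(1) by (intro mult_right_mono) auto
    moreover have "(c * exp (t * p - R)) ^ l j = (c * exp (- R)) ^ l j * exp (t * (real (l j) * p))"
      by (simp add: power_mult_distrib exp_of_nat_mult[symmetric] exp_add[symmetric] algebra_simps)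
    ultimately have "(c * exp (t * p - R)) ^ l j \<le> S ^ l j" by linarith
    then have "(c * exp (t * p - R)) ^ Suc (l j - 1) \<le> S ^ Suc (l j - 1)" using elim(6) by simp
    then have "c * exp (t * p - R) \<le> S"
      by (rule power_le_imp_le_base) (use v0 \<phi> in \<open>auto simp: S_def intro!: sum_nonneg\<close>)
    also have "\<dots> \<le> g + c * \<kappa> / 2" using elim(2) by (simp add: S_def)
    \<comment> \<open>The exponential is replaced by its tangent at 0, so that the marginal enters
      linearly.\<close>
    finally have "c * (1 + (t * p - R)) \<le> g + c * \<kappa> / 2"
      using mult_left_mono[OF exp_ge_add_one_self[of "t * p - R"], of c] c by linarith
    then have "1 + (t * p - R) \<le> g / c + \<kappa> / 2" using c by (simp add: field_simps)
    also have "g / c = 1 + w n * \<phi> ^ n / c * (exp t - 1)" using c by (simp add: g_def field_simps)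
    finally show ?case by (simp add: p_def c_def R_def)
  qed
qed

end

text \<open>Dividing by a small positive and a small negative \<open>t\<close> encloses
  \<open>p j\<close> between difference quotients of \<open>exp\<close> at 0, which tend to
  1.\<close>

lemma tendsto_of_exponential_bounds:
  fixes p :: "nat \<Rightarrow> real"
  assumes "\<And>t \<kappa>. 0 < \<kappa> \<Longrightarrow> \<forall>\<^sub>F j in sequentially. t * p j \<le> q * (exp t - 1) + \<kappa>"
  shows "p \<longlonglongrightarrow> q"
proof (rule tendstoI)
  fix e :: real assume e: "0 < e"
  have "((\<lambda>t. q * ((exp t - 1) / t)) \<longlongrightarrow> q * 1) (at 0)"
    by (intro tendsto_intros) (use DERIV_exp[of "0::real"] in \<open>simp add: DERIV_def\<close>)
  then have lim: "((\<lambda>t. q * ((exp t - 1) / t)) \<longlongrightarrow> q) (at 0)" by simp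
  have "\<forall>\<^sub>F t in at 0. dist (q * ((exp t - 1) / t)) q < e / 2"
    using tendstoD[OF lim, of "e / 2"] e by simp
  then obtain d where d: "0 < d" "\<And>t. t \<noteq> 0 \<Longrightarrow> dist t 0 < d \<Longrightarrow> dist (q * ((exp t - 1) / t)) q < e / 2"
    unfolding eventually_at by blast
  define t where "t = d / 2"
  have t: "0 < t" "dist t 0 < d" "dist (- t) 0 < d" using d(1) by (auto simp: t_def dist_real_def)
  have "\<forall>\<^sub>F j in sequentially. t * p j \<le> q * (exp t - 1) + t * e / 2"
    "\<forall>\<^sub>F j in sequentially. - t * p j \<le> q * (exp (- t) - 1) + t * e / 2"
    using assms[of "t * e / 2" t] assms[of "t * e / 2" "- t"] t(1) e by auto
  then show "\<forall>\<^sub>F j in sequentially. dist (p j) q < e"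
  proof eventually_elim
    case (elim j)
    have "p j \<le> q * ((exp t - 1) / t) + e / 2" using elim(1) t(1) by (simp add: field_simps)
    moreover have "q * ((exp (- t) - 1) / (- t)) - e / 2 \<le> p j" using elim(2) t(1) by (simp add: field_simps)
    moreover have "dist (q * ((exp t - 1) / t)) q < e / 2" "dist (q * ((exp (- t) - 1) / (- t))) q < e / 2"
      using d(2)[of t] d(2)[of "- t"] t by auto
    ultimately show ?case unfolding dist_real_def by linarith
  qed
qed

text \<open>Uniformity comes from sequential statements: a selection that picks a counterexample
  whenever one exists would violate the sequential claim. Nonemptiness supplies a point of
  \<open>S j\<close> when there is no counterexample.\<close>

lemma eventually_ball_of_selections:
  assumes "\<And>m :: nat \<Rightarrow> 'a. (\<forall>\<^sub>F j in sequentially. m j \<in> S j) \<Longrightarrow> \<forall>\<^sub>F j in sequentially. P j (m j)"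
    and "\<forall>\<^sub>F j in sequentially. S j \<noteq> {}"
  shows "\<forall>\<^sub>F j in sequentially. \<forall>m\<in>S j. P j m"
proof -
  define m where "m j = (if \<exists>x\<in>S j. \<not> P j x then SOME x. x \<in> S j \<and> \<not> P j x else SOME x. x \<in> S j)" for j
  have mS: "m j \<in> S j" if "S j \<noteq> {}" for j
    using that someI_ex[of "\<lambda>x. x \<in> S j \<and> \<not> P j x"] someI_ex[of "\<lambda>x. x \<in> S j"]
    by (auto simp: m_def)
  have "\<forall>\<^sub>F j in sequentially. P j (m j)"
    by (rule assms(1)) (rule eventually_mono[OF assms(2) mS])
  then show ?thesis
  proof eventually_elim
    case (elim j)
    show ?case
    proof (rule ccontr)
      assume *: "\<not> (\<forall>m\<in>S j. P j m)"
      then have "\<not> P j (SOME x. x \<in> S j \<and> \<not> P j x)"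
        using someI_ex[of "\<lambda>x. x \<in> S j \<and> \<not> P j x"] by blast
      with * elim show False by (auto simp: m_def split: if_splits)
    qed
  qed
qed

context condensing_weights
begin

text \<open>A window of masses at a fixed distance above criticality. Uniform estimates are needed
  on it because ratios of partial sums are multiplied over all masses between two given
  ones.\<close>

definition supercritical_range :: "real \<Rightarrow> real \<Rightarrow> nat \<Rightarrow> nat set" where
  "supercritical_range \<delta> K j = {m. (critical_density w + \<delta>) * real (l j) \<le> real m \<and> real m \<le> K * real (l j)}"

text \<open>At \<open>\<phi> = 1\<close> the excess mass costs nothing, since
  \<open>ln 1 = 0\<close>. The bound no longer depends on the density, so above criticality the
  marginals are frozen at \<open>w\<close>.\<close>

lemma site_prob_supercritical:
  assumes \<delta>: "0 < \<delta>" and m: "\<forall>\<^sub>F j in sequentially. m j \<in> supercritical_range \<delta> K j"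
  shows "(\<lambda>j. site_prob (v j) (l j) (m j) n) \<longlonglongrightarrow> w n"
proof (rule tendsto_of_exponential_bounds)
  fix t \<kappa> :: real assume "0 < \<kappa>"
  have "tilt_norm w 1 = 1" using w_sums by (simp add: tilt_norm_def sums_iff)
  then show "\<forall>\<^sub>F j in sequentially. t * site_prob (v j) (l j) (m j) n \<le> w n * (exp t - 1) + \<kappa>"
    using site_prob_exponential_bound[of 1 "critical_density w + \<delta>" m K \<kappa> t n] \<open>0 < \<kappa>\<close> m \<delta>
    by (simp add: supercritical_range_def tilt_mean_1)
qed

lemma site_prob_uniform:
  assumes \<delta>: "0 < \<delta>" and e: "0 < e"
  shows "\<forall>\<^sub>F j in sequentially. \<forall>m\<in>supercritical_range \<delta> K j. \<bar>site_prob (v j) (l j) m n - w n\<bar> < e"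
proof -
  \<comment> \<open>Enlarging the window makes it eventually nonempty, as the selection argument
    requires.\<close>
  define K' where "K' = max K (critical_density w + \<delta> + 1)"
  have "\<forall>\<^sub>F j in sequentially. \<forall>m\<in>supercritical_range \<delta> K' j. \<bar>site_prob (v j) (l j) m n - w n\<bar> < e"
  proof (rule eventually_ball_of_selections)
    show "\<forall>\<^sub>F j in sequentially. \<bar>site_prob (v j) (l j) (m j) n - w n\<bar> < e"
      if "\<forall>\<^sub>F j in sequentially. m j \<in> supercritical_range \<delta> K' j" for m
      using tendstoD[OF site_prob_supercritical[OF \<delta> that, of n] e] by (simp add: dist_real_def)
    show "\<forall>\<^sub>F j in sequentially. supercritical_range \<delta> K' j \<noteq> {}"
      using eventually_l_ge[of 1]
    proof eventually_elim
      case (elim j)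
      define x where "x = nat \<lceil>(critical_density w + \<delta>) * real (l j)\<rceil>"
      have "0 \<le> (critical_density w + \<delta>) * real (l j)" using critical_density_nonneg \<delta> by auto
      then have x: "(critical_density w + \<delta>) * real (l j) \<le> real x" "real x \<le> (critical_density w + \<delta>) * real (l j) + 1"
        unfolding x_def by linarith+
      have "(critical_density w + \<delta> + 1) * real (l j) \<le> K' * real (l j)"
        by (intro mult_right_mono) (auto simp: K'_def)
      then have "x \<in> supercritical_range \<delta> K' j" using x elim by (simp add: supercritical_range_def algebra_simps)
      then show ?case by blast
    qed
  qed
  then show ?thesis
  proof eventually_elim
    case (elim j)
    have "K * real (l j) \<le> K' * real (l j)" by (intro mult_right_mono) (auto simp: K'_def)
    then have "supercritical_range \<delta> K j \<subseteq> supercritical_range \<delta> K' j" by (auto simp: supercritical_range_def)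
    with elim show ?case by blast
  qed
qed

end


section \<open>Asymptotics of partition functions\<close>

context condensing_weights
begin

lemma supercritical_range_l_ge:
  assumes "m \<in> supercritical_range \<delta> K j"
  shows "\<delta> * real (l j) \<le> real m - critical_density w * real (l j)" "real m \<le> K * real (l j)"
  using assms by (auto simp: supercritical_range_def algebra_simps)

lemma eventually_supercritical_range:
  assumes m: "(\<lambda>j. real (m j) / real (l j)) \<longlonglongrightarrow> y" and y: "critical_density w + \<delta> < y" "y < K"
  shows "\<forall>\<^sub>F j in sequentially. m j \<in> supercritical_range \<delta> K j"
  using order_tendstoD(1)[OF m y(1)] order_tendstoD(2)[OF m y(2)] eventually_l_ge[of 1]
proof eventually_elim
  case (elim j)
  then show ?case by (simp add: supercritical_range_def field_simps)
qed

text \<open>The probability of an empty site is \<open>v j 0\<close> times this ratio. It tends to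
  \<open>w 0\<close>, and so does \<open>v j 0\<close>, with \<open>w 0\<close> positive.\<close>

lemma Z_site_ratio_uniform:
  assumes \<delta>: "0 < \<delta>" and e: "0 < e"
  shows "\<forall>\<^sub>F j in sequentially. \<forall>m\<in>supercritical_range \<delta> K j. \<bar>Z (v j) (l j - 1) m / Z (v j) (l j) m - 1\<bar> < e"
proof -
  define e1 where "e1 = e * w 0 / 4"
  have e1: "0 < e1" using e w0 by (simp add: e1_def)
  have "\<forall>\<^sub>F j in sequentially. \<bar>v j 0 - w 0\<bar> < e1"
    using tendstoD[OF v_tendsto e1, of 0] by (simp add: dist_real_def)
  moreover have "\<forall>\<^sub>F j in sequentially. w 0 / 2 < v j 0"
    by (rule order_tendstoD(1)[OF v_tendsto]) (use w0 in simp)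
  ultimately show ?thesis
    using site_prob_uniform[OF \<delta> e1, of K 0]
  proof eventually_elim
    case (elim j)
    show ?case
    proof
      fix m assume "m \<in> supercritical_range \<delta> K j"
      with elim have s: "\<bar>site_prob (v j) (l j) m 0 - w 0\<bar> < e1" by blast
      have v0: "0 < v j 0" using elim(2) w0 by linarith
      have "Z (v j) (l j - 1) m / Z (v j) (l j) m - 1 = (site_prob (v j) (l j) m 0 - v j 0) / v j 0"
        using v0 by (simp add: site_prob_def field_simps)
      also have "\<bar>\<dots>\<bar> = \<bar>site_prob (v j) (l j) m 0 - v j 0\<bar> / v j 0" using v0 by simp
      also have "\<dots> < 2 * e1 / (w 0 / 2)"
        using s elim(1,2) w0 e1 by (intro frac_less) linarith+
      also have "\<dots> = e" using w0 by (simp add: e1_def field_simps)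
      finally show "\<bar>Z (v j) (l j - 1) m / Z (v j) (l j) m - 1\<bar> < e" .
    qed
  qed
qed

lemma bulk_mean_uniform:
  assumes \<delta>: "0 < \<delta>" and e: "0 < e" and J: "\<forall>n>J. w n = 0"
  shows "\<forall>\<^sub>F j in sequentially. \<forall>m\<in>supercritical_range \<delta> K j.
    \<bar>(\<Sum>n\<le>J. real n * site_prob (v j) (l j) m n) - critical_density w\<bar> < e"
proof -
  define e1 where "e1 = e / (real (J + 1) * real (J + 1))"
  have e1: "0 < e1" using e by (simp add: e1_def)
  have "\<forall>\<^sub>F j in sequentially. \<forall>n\<in>{..J}. \<forall>m\<in>supercritical_range \<delta> K j. \<bar>site_prob (v j) (l j) m n - w n\<bar> < e1"
    by (rule eventually_ball_finite) (use site_prob_uniform[OF \<delta> e1] in auto)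
  then show ?thesis
  proof eventually_elim
    case (elim j)
    show ?case
    proof
      fix m assume m: "m \<in> supercritical_range \<delta> K j"
      have "\<bar>(\<Sum>n\<le>J. real n * site_prob (v j) (l j) m n) - critical_density w\<bar> =
          \<bar>\<Sum>n\<le>J. real n * (site_prob (v j) (l j) m n - w n)\<bar>"
        by (simp add: sum_cutoff(2)[OF J] sum_subtractf right_diff_distrib)
      also have "\<dots> \<le> (\<Sum>n\<le>J. \<bar>real n * (site_prob (v j) (l j) m n - w n)\<bar>)" by (rule sum_abs)
      also have "\<dots> \<le> (\<Sum>n\<le>J. real J * e1)"
      proof (rule sum_mono)
        fix n assume n: "n \<in> {..J}"
        then have "\<bar>site_prob (v j) (l j) m n - w n\<bar> \<le> e1" using elim m by (blast intro: less_imp_le)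
        with n show "\<bar>real n * (site_prob (v j) (l j) m n - w n)\<bar> \<le> real J * e1"
          unfolding abs_mult by (intro mult_mono) auto
      qed
      also have "\<dots> = real (J + 1) * real J * e1" by simp
      also have "\<dots> < real (J + 1) * real (J + 1) * e1" using e1 by simp
      also have "\<dots> = e" by (simp add: e1_def)
      finally show "\<bar>(\<Sum>n\<le>J. real n * site_prob (v j) (l j) m n) - critical_density w\<bar> < e" .
    qed
  qed
qed

text \<open>One site is missing because it is the one removed by size-biasing.\<close>

definition cumulative_Z :: "nat \<Rightarrow> nat \<Rightarrow> real" where
  "cumulative_Z j m = (\<Sum>i\<le>m. Z (v j) (l j - 1) i)"

lemma supercritical_range_Z_pos:
  assumes "0 < \<delta>"
  shows "\<forall>\<^sub>F j in sequentially. \<forall>m\<in>supercritical_range \<delta> K j. b < m \<and> 0 < Z (v j) (l j) m \<and> 0 < Z (v j) (l j - 1) m"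
proof -
  obtain J1 where J1: "\<forall>\<^sub>F j in sequentially. \<forall>m>J1. 0 < Z (v j) (l j) m" using Z_pos by blast
  obtain J2 where J2: "\<forall>\<^sub>F j in sequentially. \<forall>m>J2. 0 < Z (v j) (l j - 1) m"
    using condensing_weights.Z_pos[OF shift] by blast
  define J where "J = max b (max J1 J2)"
  show ?thesis using J1 J2 eventually_l_real_ge[of "real (J + 1) / \<delta>"]
  proof eventually_elim
    case (elim j)
    show ?case
    proof
      fix m assume m: "m \<in> supercritical_range \<delta> K j"
      have "real (J + 1) \<le> \<delta> * real (l j)" using elim(3) assms by (simp add: field_simps)
      also have "\<dots> \<le> (critical_density w + \<delta>) * real (l j)"
        using critical_density_nonneg by (intro mult_right_mono) auto
      also have "\<dots> \<le> real m" using m by (simp add: supercritical_range_def)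
      finally have "J < m" by simp
      then have "b < m" "J1 < m" "J2 < m" by (auto simp: J_def)
      with elim show "b < m \<and> 0 < Z (v j) (l j) m \<and> 0 < Z (v j) (l j - 1) m" by blast
    qed
  qed
qed

lemma cumulative_Z_mono:
  assumes "\<And>n. 0 \<le> v j n" "m \<le> m'"
  shows "cumulative_Z j m \<le> cumulative_Z j m'"
  unfolding cumulative_Z_def by (intro sum_mono2 Z_nonneg) (use assms in auto)

text \<open>The size-biased identity cut at \<open>J\<close>: smaller occupations contribute the
  bulk mass, larger ones carry the factor \<open>n * v j n * l j\<close>, which is close to
  \<open>\<theta>\<close>. The sum over larger occupations misses only the \<open>J + 1\<close> top
  terms of the partial sum.\<close>

lemma mass_balance:
  assumes l: "1 \<le> l j" and J: "J < m" and Z: "Z (v j) (l j) m \<noteq> 0"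
  shows "(real m - real (l j) * (\<Sum>n\<le>J. real n * site_prob (v j) (l j) m n)) * Z (v j) (l j) m =
     (\<Sum>n\<in>{J<..m}. (real n * v j n * real (l j)) * Z (v j) (l j - 1) (m - n))"
    and "(\<Sum>n\<in>{J<..m}. Z (v j) (l j - 1) (m - n)) + (\<Sum>i\<le>J. Z (v j) (l j - 1) (m - i)) = cumulative_Z j m"
proof -
  obtain k where k: "l j = Suc k" using l by (cases "l j") auto
  have split: "{..m} = {..J} \<union> {J<..m}" using J by auto
  have "real m * Z (v j) (l j) m = real (l j) * (\<Sum>n\<le>m. real n * (v j n * Z (v j) k (m - n)))"
    unfolding k by (rule Z_mass_identity)
  also have "(\<Sum>n\<le>m. real n * (v j n * Z (v j) k (m - n))) =
     (\<Sum>n\<le>J. real n * (v j n * Z (v j) k (m - n))) + (\<Sum>n\<in>{J<..m}. real n * (v j n * Z (v j) k (m - n)))"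
    unfolding split by (rule sum.union_disjoint) auto
  also have "(\<Sum>n\<le>J. real n * (v j n * Z (v j) k (m - n))) =
      (\<Sum>n\<le>J. real n * site_prob (v j) (l j) m n) * Z (v j) (l j) m"
    unfolding sum_distrib_right using J Z by (intro sum.cong) (auto simp: site_prob_def k)
  finally show "(real m - real (l j) * (\<Sum>n\<le>J. real n * site_prob (v j) (l j) m n)) * Z (v j) (l j) m =
     (\<Sum>n\<in>{J<..m}. (real n * v j n * real (l j)) * Z (v j) (l j - 1) (m - n))"
    by (simp add: algebra_simps sum_distrib_left k)
  have "cumulative_Z j m = (\<Sum>n\<le>m. Z (v j) (l j - 1) (m - n))"
    unfolding cumulative_Z_def
    by (rule sum.reindex_bij_witness[where i = "\<lambda>i. m - i" and j = "\<lambda>i. m - i"]) auto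
  also have "\<dots> = (\<Sum>i\<le>J. Z (v j) (l j - 1) (m - i)) + (\<Sum>n\<in>{J<..m}. Z (v j) (l j - 1) (m - n))"
    unfolding split by (rule sum.union_disjoint) auto
  finally show "(\<Sum>n\<in>{J<..m}. Z (v j) (l j - 1) (m - n)) + (\<Sum>i\<le>J. Z (v j) (l j - 1) (m - i)) = cumulative_Z j m"
    by simp
qed

text \<open>Quantifies the approximate relation between \<open>Z\<close> and its partial sums. All
  errors must be small relative to the partial sum, which an a priori bound of the form
  \<open>L * Z0 m \<le> C * A m\<close> makes possible.\<close>

lemma Z_cumulative_uniform:
  assumes \<delta>: "0 < \<delta>" and e: "0 < e" and K: "0 < K"
  shows "\<forall>\<^sub>F j in sequentially. \<forall>m\<in>supercritical_range \<delta> K j.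
     \<bar>(real m - critical_density w * real (l j)) * Z (v j) (l j - 1) m - \<theta> * cumulative_Z j m\<bar>
       \<le> e * cumulative_Z j m"
proof -
  define \<rho> where "\<rho> = critical_density w"
  \<comment> \<open>A numerator \<open>\<theta> + 1\<close> from the size-biased sum over the lower
    bound \<open>\<delta> / 4\<close> for the surplus per site.\<close>
  define C where "C = 4 * (\<theta> + 1) / \<delta>"
  have C: "0 < C" using \<delta> theta_pos by (simp add: C_def)
  define e1 where "e1 = min (min 1 (\<delta> / 4)) (e / (2 * ((K + 1) * C + 1)))"
  have e1: "0 < e1" "e1 \<le> 1" "e1 \<le> \<delta> / 4" "((K + 1) * C + 1) * e1 \<le> e / 2"
  proof -
    have pos: "0 < 2 * ((K + 1) * C + 1)" using K C by (auto intro!: add_pos_pos mult_pos_pos)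
    show "0 < e1" using pos e \<delta> by (simp add: e1_def)
    have "e1 \<le> min 1 (\<delta> / 4)" unfolding e1_def by (rule min.cobounded1)
    then show "e1 \<le> 1" "e1 \<le> \<delta> / 4" by simp_all
    have "e1 \<le> e / (2 * ((K + 1) * C + 1))" unfolding e1_def by (rule min.cobounded2)
    then show "((K + 1) * C + 1) * e1 \<le> e / 2" using pos by (simp add: field_simps)
  qed
  obtain J0 where J0: "\<forall>n>J0. w n = 0" using w_support by blast
  obtain J1 where J1: "\<forall>\<^sub>F j in sequentially. \<forall>n>J1. \<bar>real n * v j n * real (l j) - \<theta>\<bar> \<le> e1"
    using tail[OF e1(1)] by blast
  define J where "J = max J0 J1"
  have J: "\<forall>n>J. w n = 0" using J0 by (simp add: J_def)
  \<comment> \<open>Half the distance to criticality, so that the window still contains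
    \<open>m - i\<close> for the top terms with \<open>i \<le> J\<close>.\<close>
  have \<delta>2: "0 < \<delta> / 2" using \<delta> by simp
  show ?thesis
    using J1 supercritical_range_Z_pos[OF \<delta>2, of K J] Z_site_ratio_uniform[OF \<delta>2 e1(1), of K]
      bulk_mean_uniform[OF \<delta>2 e1(1) J, of K] v_nonneg eventually_l_ge[of 1]
      eventually_l_real_ge[of "real J / (\<delta> / 2)"] eventually_l_real_ge[of "4 * \<theta> * real (J + 1) * C / e"]
  proof eventually_elim
    case (elim j)
    define Z0 where "Z0 = Z (v j) (l j)"
    define Z1 where "Z1 = Z (v j) (l j - 1)"
    define A where "A = cumulative_Z j"
    define T where "T m = (\<Sum>n\<in>{J<..m}. Z1 (m - n))" for m
    define L where "L = real (l j)"
    have L: "1 \<le> L" using elim(6) by (simp add: L_def)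
    have Z1_nonneg: "0 \<le> Z1 m" for m unfolding Z1_def by (rule Z_nonneg) (use elim in auto)
    have A_nonneg: "0 \<le> A m" for m
      unfolding A_def cumulative_Z_def by (intro sum_nonneg Z_nonneg) (use elim in auto)
    have T_nonneg: "0 \<le> T m" for m unfolding T_def by (intro sum_nonneg Z1_nonneg)
    have A_mono: "A m \<le> A m'" if "m \<le> m'" for m m'
      unfolding A_def by (rule cumulative_Z_mono) (use elim that in auto)
    define b where "b m = (\<Sum>n\<le>J. real n * site_prob (v j) (l j) m n)" for m
    have basic: "0 < Z0 m" "\<bar>(real m - L * b m) * Z0 m - \<theta> * T m\<bar> \<le> e1 * T m" "\<bar>b m - \<rho>\<bar> < e1"
      "T m + (\<Sum>i\<le>J. Z1 (m - i)) = A m" "\<bar>Z1 m - Z0 m\<bar> \<le> e1 * Z0 m" "T m \<le> A m"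
      if m: "m \<in> supercritical_range (\<delta> / 2) K j" for m
    proof -
      have m': "J < m" "0 < Z0 m" using elim m by (auto simp: Z0_def)
      show "0 < Z0 m" by fact
      have "(real m - L * b m) * Z0 m = (\<Sum>n\<in>{J<..m}. (real n * v j n * L) * Z1 (m - n))"
        unfolding L_def b_def Z0_def Z1_def
        by (rule mass_balance(1)) (use elim m' in \<open>auto simp: Z0_def\<close>)
      then have "(real m - L * b m) * Z0 m - \<theta> * T m =
          (\<Sum>n\<in>{J<..m}. (real n * v j n * L - \<theta>) * Z1 (m - n))"
        by (simp add: T_def sum_distrib_left sum_subtractf left_diff_distrib)
      also have "\<bar>\<dots>\<bar> \<le> (\<Sum>n\<in>{J<..m}. \<bar>(real n * v j n * L - \<theta>) * Z1 (m - n)\<bar>)" by (rule sum_abs)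
      also have "\<dots> \<le> (\<Sum>n\<in>{J<..m}. e1 * Z1 (m - n))"
      proof (rule sum_mono)
        fix n assume "n \<in> {J<..m}"
        then have "\<bar>real n * v j n * L - \<theta>\<bar> \<le> e1" using elim(1) by (auto simp: J_def L_def)
        then show "\<bar>(real n * v j n * L - \<theta>) * Z1 (m - n)\<bar> \<le> e1 * Z1 (m - n)"
          using Z1_nonneg by (simp add: abs_mult mult_right_mono)
      qed
      finally show "\<bar>(real m - L * b m) * Z0 m - \<theta> * T m\<bar> \<le> e1 * T m" by (simp add: T_def sum_distrib_left)
      show "\<bar>b m - \<rho>\<bar> < e1" using elim(4) m by (auto simp: b_def \<rho>_def)
      show TA: "T m + (\<Sum>i\<le>J. Z1 (m - i)) = A m"
        unfolding T_def Z1_def A_def by (rule mass_balance(2)) (use elim m' in \<open>auto simp: Z0_def\<close>)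
      then show "T m \<le> A m" using sum_nonneg[of "{..J}" "\<lambda>i. Z1 (m - i)"] Z1_nonneg by auto
      have "\<bar>Z1 m / Z0 m - 1\<bar> < e1" using elim(3) m by (auto simp: Z1_def Z0_def)
      then have "\<bar>Z1 m / Z0 m - 1\<bar> * Z0 m \<le> e1 * Z0 m" using m'(2) by (intro mult_right_mono) auto
      also have "\<bar>Z1 m / Z0 m - 1\<bar> * Z0 m = \<bar>Z1 m - Z0 m\<bar>"
      proof -
        have "\<bar>Z1 m / Z0 m - 1\<bar> * Z0 m = \<bar>(Z1 m / Z0 m - 1) * Z0 m\<bar>" using m'(2) by (simp add: abs_mult)
        also have "(Z1 m / Z0 m - 1) * Z0 m = Z1 m - Z0 m" using m'(2) by (simp add: field_simps)
        finally show ?thesis .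
      qed
      finally show "\<bar>Z1 m - Z0 m\<bar> \<le> e1 * Z0 m" .
    qed
    \<comment> \<open>The surplus over the actual bulk mass is at least \<open>\<delta> / 4\<close>
      per site, while the size-biased sum is at most \<open>\<theta> + 1\<close> times the partial
      sum.\<close>
    have upper: "L * Z0 m \<le> C * A m" if m: "m \<in> supercritical_range (\<delta> / 2) K j" for m
    proof -
      have "L * b m \<le> L * (\<rho> + e1)" using basic(3)[OF m] L by (intro mult_left_mono) auto
      moreover have "L * e1 \<le> L * (\<delta> / 4)" using e1 L by (intro mult_left_mono) auto
      ultimately have "\<delta> / 4 * L \<le> real m - L * b m"
        using supercritical_range_l_ge(1)[OF m] by (simp add: L_def \<rho>_def algebra_simps)
      then have "\<delta> / 4 * L * Z0 m \<le> (real m - L * b m) * Z0 m"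
        using basic(1)[OF m] by (intro mult_right_mono) auto
      also have "\<dots> \<le> (\<theta> + e1) * T m" using basic(2)[OF m] by (simp add: abs_le_iff algebra_simps)
      also have "\<dots> \<le> (\<theta> + 1) * A m"
        using basic(6)[OF m] e1 theta_pos T_nonneg by (intro mult_mono) auto
      finally show ?thesis using \<delta> by (simp add: C_def field_simps)
    qed
    show ?case
    proof
      fix m assume m: "m \<in> supercritical_range \<delta> K j"
      have sub: "m - i \<in> supercritical_range (\<delta> / 2) K j" if "i \<le> J" for i
      proof -
        have "real J \<le> \<delta> / 2 * L" using elim(7) \<delta> by (simp add: L_def field_simps)
        moreover have "real m - real i \<le> real (m - i)" "real (m - i) \<le> real m" by linarith+
        ultimately show ?thesis using m that by (auto simp: supercritical_range_def L_def algebra_simps)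
      qed
      from sub[of 0] have m2: "m \<in> supercritical_range (\<delta> / 2) K j" by simp
      define s where "s = real m - \<rho> * L"
      have s: "0 \<le> s" "s \<le> K * L"
      proof -
        have "0 \<le> \<delta> * L" "0 \<le> \<rho> * L" using \<delta> L critical_density_nonneg by (auto simp: \<rho>_def)
        then show "0 \<le> s" "s \<le> K * L"
          using supercritical_range_l_ge[OF m] by (auto simp: s_def L_def \<rho>_def)
      qed
      \<comment> \<open>By the a priori bound each of the top terms is a fraction of order
        \<open>1 / L\<close> of the partial sum.\<close>
      have "(\<Sum>i\<le>J. Z1 (m - i)) \<le> (\<Sum>i\<le>J. 2 * C / L * A m)"
      proof (rule sum_mono)
        fix i assume "i \<in> {..J}"
        then have i: "m - i \<in> supercritical_range (\<delta> / 2) K j" using sub by simp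
        have "\<bar>Z1 (m - i) - Z0 (m - i)\<bar> \<le> 1 * Z0 (m - i)"
          using basic(5)[OF i] basic(1)[OF i] e1 mult_right_mono[of e1 1 "Z0 (m - i)"] by linarith
        then have "Z1 (m - i) \<le> 2 * Z0 (m - i)" by linarith
        also have "Z0 (m - i) \<le> C * A (m - i) / L" using upper[OF i] L by (simp add: field_simps)
        also have "\<dots> \<le> C * A m / L" using C L by (intro divide_right_mono mult_left_mono A_mono) auto
        finally show "Z1 (m - i) \<le> 2 * C / L * A m" by simp
      qed
      also have "\<dots> = real (J + 1) * (2 * C / L) * A m" by simp
      finally have gap: "A m - T m \<le> real (J + 1) * (2 * C / L) * A m" using basic(4)[OF m2] by linarith
      \<comment> \<open>Four errors: the missing site, the fluctuation of the bulk mean, the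
        deviation of the large weights from \<open>\<theta>\<close>, and the missing top
        terms.\<close>
      have "\<bar>s * Z1 m - \<theta> * A m\<bar> \<le> \<bar>s * (Z1 m - Z0 m)\<bar> + \<bar>(L * (b m - \<rho>)) * Z0 m\<bar> +
          \<bar>(real m - L * b m) * Z0 m - \<theta> * T m\<bar> + \<bar>\<theta> * (A m - T m)\<bar>"
      proof -
        have "s * Z1 m - \<theta> * A m = s * (Z1 m - Z0 m) + (L * (b m - \<rho>)) * Z0 m +
           ((real m - L * b m) * Z0 m - \<theta> * T m) - \<theta> * (A m - T m)"
          by (simp add: s_def algebra_simps)
        then show ?thesis by linarith
      qed
      also have "\<bar>s * (Z1 m - Z0 m)\<bar> \<le> (K * L) * (e1 * Z0 m)"
        unfolding abs_mult using s basic(5)[OF m2] by (intro mult_mono) auto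
      also have "\<bar>(L * (b m - \<rho>)) * Z0 m\<bar> \<le> (L * e1) * Z0 m"
        unfolding abs_mult using L basic(1,3)[OF m2] by (intro mult_mono) auto
      also have "\<bar>(real m - L * b m) * Z0 m - \<theta> * T m\<bar> \<le> e1 * A m"
        using basic(2,6)[OF m2] e1 mult_left_mono[of "T m" "A m" e1] by linarith
      also have "\<bar>\<theta> * (A m - T m)\<bar> \<le> \<theta> * (real (J + 1) * (2 * C / L) * A m)"
      proof -
        have "\<theta> * (A m - T m) \<le> \<theta> * (real (J + 1) * (2 * C / L) * A m)"
          using gap theta_pos by (intro mult_left_mono) auto
        moreover have "0 \<le> \<theta> * (A m - T m)" using basic(6)[OF m2] theta_pos by simp
        ultimately show ?thesis by linarith
      qed
      finally have "\<bar>s * Z1 m - \<theta> * A m\<bar> \<le> (K + 1) * e1 * (L * Z0 m) + e1 * A m +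
          (2 * \<theta> * real (J + 1) * C / L) * A m"
        by (simp add: algebra_simps)
      also have "(K + 1) * e1 * (L * Z0 m) \<le> (K + 1) * e1 * (C * A m)"
        using upper[OF m2] K e1 by (intro mult_left_mono) auto
      also have "2 * \<theta> * real (J + 1) * C / L \<le> e / 2"
        using elim(8) e L by (simp add: L_def field_simps)
      also have "(K + 1) * e1 * (C * A m) + e1 * A m + e / 2 * A m =
          (((K + 1) * C + 1) * e1 + e / 2) * A m" by (simp add: algebra_simps)
      also have "\<dots> \<le> e * A m" using e1(4) A_nonneg by (intro mult_right_mono) auto
      finally show "\<bar>(real m - critical_density w * real (l j)) * Z (v j) (l j - 1) m - \<theta> * cumulative_Z j m\<bar>
          \<le> e * cumulative_Z j m"
        using A_nonneg by (simp add: s_def \<rho>_def L_def Z1_def A_def mult_right_mono)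
    qed
  qed
qed

text \<open>A discrete regular variation argument. Write s for the mass above criticality at
  \<open>Suc m\<close>; the ratio of consecutive partial sums is then 1 - \<open>\<theta>\<close> /
  s up to e / s, while consecutive surpluses have ratio 1 - 1 / s. Comparing with powers and
  multiplying telescopes.\<close>

lemma cumulative_Z_ratio_bounds:
  assumes \<delta>: "0 < \<delta>" and e: "0 < e" "2 * e < \<theta>" and K: "0 < K"
  shows "\<forall>\<^sub>F j in sequentially. \<forall>m M. m \<in> supercritical_range \<delta> K j \<longrightarrow> M \<in> supercritical_range \<delta> K j \<longrightarrow> m \<le> M \<longrightarrow>
     0 < cumulative_Z j M \<and>
     cumulative_Z j m / cumulative_Z j M \<le>
       ((real m - critical_density w * real (l j)) / (real M - critical_density w * real (l j))) powr (\<theta> - 2 * e) \<and>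
     ((real m - critical_density w * real (l j)) / (real M - critical_density w * real (l j))) powr (\<theta> + 2 * e) \<le>
       cumulative_Z j m / cumulative_Z j M"
proof -
  \<comment> \<open>Passing from \<open>e\<close> to \<open>2 * e\<close> in the exponent absorbs
    the second-order terms in \<open>1 / x\<close>.\<close>
  have "\<forall>\<^sub>F x :: real in at_top. (1 - 1 / x) powr (\<theta> + 2 * e) \<le> 1 - (\<theta> + e) / x"
    using e theta_pos by real_asymp
  moreover have "\<forall>\<^sub>F x :: real in at_top. 1 - (\<theta> - e) / x \<le> (1 - 1 / x) powr (\<theta> - 2 * e)"
    using e theta_pos by real_asymp
  ultimately have "\<forall>\<^sub>F x :: real in at_top. (1 - 1 / x) powr (\<theta> + 2 * e) \<le> 1 - (\<theta> + e) / x \<and>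
      1 - (\<theta> - e) / x \<le> (1 - 1 / x) powr (\<theta> - 2 * e)"
    by (rule eventually_conj)
  then obtain x0 where x0: "\<And>x. x \<ge> x0 \<Longrightarrow>
      (1 - 1 / x) powr (\<theta> + 2 * e) \<le> 1 - (\<theta> + e) / x \<and> 1 - (\<theta> - e) / x \<le> (1 - 1 / x) powr (\<theta> - 2 * e)"
    unfolding eventually_at_top_linorder by blast
  show ?thesis
    using Z_cumulative_uniform[OF \<delta> e(1) K] supercritical_range_Z_pos[OF \<delta>, of K 0] v_nonneg
      eventually_l_real_ge[of "max x0 2 / \<delta>"]
  proof eventually_elim
    case (elim j)
    define A where "A = cumulative_Z j"
    define s where "s m = real m - critical_density w * real (l j)" for m
    have large: "max x0 2 \<le> s m" if "m \<in> supercritical_range \<delta> K j" for m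
    proof -
      have "max x0 2 \<le> \<delta> * real (l j)" using elim(4) \<delta> by (simp add: field_simps)
      also have "\<dots> \<le> s m" using supercritical_range_l_ge(1)[OF that] by (simp add: s_def)
      finally show ?thesis .
    qed
    have A_pos: "0 < A m" if "m \<in> supercritical_range \<delta> K j" for m
    proof -
      have "0 < Z (v j) (l j - 1) m" using elim(2) that by blast
      also have "\<dots> \<le> A m" unfolding A_def cumulative_Z_def
        by (rule member_le_sum) (use elim(3) in \<open>auto intro: Z_nonneg\<close>)
      finally show ?thesis .
    qed
    have ratio_step: "(s m / s (Suc m)) powr (\<theta> + 2 * e) \<le> A m / A (Suc m) \<and>
        A m / A (Suc m) \<le> (s m / s (Suc m)) powr (\<theta> - 2 * e)"
      if "Suc m \<in> supercritical_range \<delta> K j" for m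
    proof -
      define x where "x = s (Suc m)"
      have x: "x0 \<le> x" "2 \<le> x" using large[OF that] by (auto simp: x_def)
      have sm: "s m / s (Suc m) = 1 - 1 / x" using x by (simp add: s_def x_def field_simps)
      have Ap: "0 < A (Suc m)" using A_pos[OF that] .
      have "A m = A (Suc m) - Z (v j) (l j - 1) (Suc m)" by (simp add: A_def cumulative_Z_def)
      then have Am: "A m / A (Suc m) = 1 - Z (v j) (l j - 1) (Suc m) / A (Suc m)"
        using Ap by (simp add: field_simps)
      have "\<bar>x * Z (v j) (l j - 1) (Suc m) - \<theta> * A (Suc m)\<bar> \<le> e * A (Suc m)"
        using elim(1) that by (auto simp: x_def s_def A_def)
      then have "x * Z (v j) (l j - 1) (Suc m) \<le> (\<theta> + e) * A (Suc m)"
        "(\<theta> - e) * A (Suc m) \<le> x * Z (v j) (l j - 1) (Suc m)"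
        by (auto simp: abs_le_iff algebra_simps)
      then have "Z (v j) (l j - 1) (Suc m) / A (Suc m) \<le> (\<theta> + e) / x"
        "(\<theta> - e) / x \<le> Z (v j) (l j - 1) (Suc m) / A (Suc m)"
        using Ap x by (auto simp: field_simps)
      with x0[OF x(1)] show ?thesis unfolding sm Am by linarith
    qed
    have "0 < A M \<and> A m / A M \<le> (s m / s M) powr (\<theta> - 2 * e) \<and> (s m / s M) powr (\<theta> + 2 * e) \<le> A m / A M"
      if m: "m \<in> supercritical_range \<delta> K j" and M: "M \<in> supercritical_range \<delta> K j" and le: "m \<le> M" for m M
      using le M
    proof (induction M rule: dec_induct)
      case base
      have "0 < s m" using large[OF m] by simp
      then show ?case using A_pos[OF m] by simp
    next
      case (step M)
      have "(critical_density w + \<delta>) * real (l j) \<le> real m" using m by (simp add: supercritical_range_def)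
      then have M: "M \<in> supercritical_range \<delta> K j" using step by (auto simp: supercritical_range_def)
      note IH = step.IH[OF M]
      have pos: "0 < A (Suc M)" "0 < A M" "0 < s m" "0 < s M" "0 < s (Suc M)" "0 < A m"
        using A_pos[OF step.prems] A_pos[OF M] A_pos[OF m] large[OF m] large[OF M] large[OF step.prems] by auto
      have eqs: "A m / A (Suc M) = A m / A M * (A M / A (Suc M))"
        "s m / s (Suc M) = s m / s M * (s M / s (Suc M))" using pos by auto
      note r = ratio_step[OF step.prems]
      have mult: "(s m / s M * (s M / s (Suc M))) powr a = (s m / s M) powr a * (s M / s (Suc M)) powr a" for a
        by (rule powr_mult)
      have "A m / A M * (A M / A (Suc M)) \<le> (s m / s M) powr (\<theta> - 2 * e) * (s M / s (Suc M)) powr (\<theta> - 2 * e)"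
        using IH r pos by (intro mult_mono) auto
      moreover have "(s m / s M) powr (\<theta> + 2 * e) * (s M / s (Suc M)) powr (\<theta> + 2 * e) \<le> A m / A M * (A M / A (Suc M))"
        using IH r pos by (intro mult_mono) auto
      ultimately show ?case unfolding eqs mult using pos by blast
    qed
    then show ?case unfolding A_def s_def by blast
  qed
qed

lemma cumulative_Z_ratio_limit:
  assumes m: "(\<lambda>j. real (m j) / real (l j)) \<longlonglongrightarrow> y" and M: "(\<lambda>j. real (M j) / real (l j)) \<longlonglongrightarrow> Y"
    and y: "critical_density w < y" "critical_density w < Y" and mM: "\<forall>\<^sub>F j in sequentially. m j \<le> M j"
  shows "(\<lambda>j. cumulative_Z j (m j) / cumulative_Z j (M j)) \<longlonglongrightarrow>
     ((y - critical_density w) / (Y - critical_density w)) powr \<theta>"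
proof (rule tendstoI)
  fix e :: real assume e: "0 < e"
  define \<rho> where "\<rho> = critical_density w"
  define x where "x = (y - \<rho>) / (Y - \<rho>)"
  have x: "0 < x" using y by (simp add: x_def \<rho>_def)
  define X where "X j = (real (m j) - \<rho> * real (l j)) / (real (M j) - \<rho> * real (l j))" for j
  have X: "X \<longlonglongrightarrow> x"
  proof -
    have "(\<lambda>j. (real (m j) / real (l j) - \<rho>) / (real (M j) / real (l j) - \<rho>)) \<longlonglongrightarrow> x"
      unfolding x_def using y by (intro tendsto_intros m M) (auto simp: \<rho>_def)
    then show ?thesis
    proof (rule Lim_transform_eventually)
      show "\<forall>\<^sub>F j in sequentially. (real (m j) / real (l j) - \<rho>) / (real (M j) / real (l j) - \<rho>) = X j"
        using eventually_l_ge[of 1]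
      proof eventually_elim
        case (elim j)
        have "real (m j) / real (l j) - \<rho> = (real (m j) - \<rho> * real (l j)) / real (l j)"
          "real (M j) / real (l j) - \<rho> = (real (M j) - \<rho> * real (l j)) / real (l j)"
          using elim by (auto simp: field_simps)
        then show ?case using elim by (simp add: X_def)
      qed
    qed
  qed
  have "((\<lambda>h. x powr (\<theta> + 2 * h)) \<longlongrightarrow> x powr (\<theta> + 2 * 0)) (at 0)"
    using x by (intro tendsto_intros) auto
  then have "((\<lambda>h. x powr (\<theta> + 2 * h)) \<longlongrightarrow> x powr \<theta>) (at 0)" by simp
  from tendstoD[OF this e] obtain d where d: "0 < d"
    "\<And>h. h \<noteq> 0 \<Longrightarrow> dist h 0 < d \<Longrightarrow> dist (x powr (\<theta> + 2 * h)) (x powr \<theta>) < e"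
    unfolding eventually_at by blast
  \<comment> \<open>Small enough for both perturbed exponents to give powers within \<open>e\<close>
    of the limit, and for the condition \<open>2 * h < \<theta>\<close> of the ratio bounds.\<close>
  define h where "h = min (d / 2) (\<theta> / 4)"
  have h: "0 < h" "h < d" "2 * h < \<theta>" using d(1) theta_pos by (auto simp: h_def min_def)
  have close: "dist (x powr (\<theta> + 2 * h)) (x powr \<theta>) < e" "dist (x powr (\<theta> - 2 * h)) (x powr \<theta>) < e"
    using d(2)[of h] d(2)[of "- h"] h by (auto simp: dist_real_def)
  define \<delta> where "\<delta> = (min y Y - \<rho>) / 2"
  define K where "K = max y Y + 1"
  have \<delta>: "0 < \<delta>" "\<rho> + \<delta> < y" "\<rho> + \<delta> < Y" using y by (auto simp: \<delta>_def \<rho>_def min_def field_simps)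
  have K: "y < K" "Y < K" "0 < K" using y critical_density_nonneg by (auto simp: K_def)
  have up: "\<forall>\<^sub>F j in sequentially. X j powr (\<theta> - 2 * h) < x powr \<theta> + e"
    by (rule order_tendstoD(2)[OF tendsto_powr[OF X tendsto_const]])
       (use close x in \<open>auto simp: dist_real_def\<close>)
  have down: "\<forall>\<^sub>F j in sequentially. x powr \<theta> - e < X j powr (\<theta> + 2 * h)"
    by (rule order_tendstoD(1)[OF tendsto_powr[OF X tendsto_const]])
       (use close x in \<open>auto simp: dist_real_def\<close>)
  show "\<forall>\<^sub>F j in sequentially. dist (cumulative_Z j (m j) / cumulative_Z j (M j))
      (((y - critical_density w) / (Y - critical_density w)) powr \<theta>) < e"
    using up down mM cumulative_Z_ratio_bounds[OF \<delta>(1) h(1,3) K(3)]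
      eventually_supercritical_range[OF m \<delta>(2)[unfolded \<rho>_def] K(1)]
      eventually_supercritical_range[OF M \<delta>(3)[unfolded \<rho>_def] K(2)]
  proof eventually_elim
    case (elim j)
    then have "X j powr (\<theta> + 2 * h) \<le> cumulative_Z j (m j) / cumulative_Z j (M j)"
      "cumulative_Z j (m j) / cumulative_Z j (M j) \<le> X j powr (\<theta> - 2 * h)"
      unfolding X_def \<rho>_def by blast+
    with elim(1,2) show ?case unfolding dist_real_def x_def \<rho>_def by linarith
  qed
qed

text \<open>The constant that converts averages with weights \<open>Z / cumulative_Z\<close> into
  canonical expectations. It combines the surplus fraction of the mass, the ratio for a missing
  site, and the relation between \<open>Z\<close> and its partial sums.\<close>

lemma cumulative_Z_normalised_limit:
  assumes M: "(\<lambda>j. real (M j) / real (l j)) \<longlonglongrightarrow> Y" and Y: "critical_density w < Y"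
  shows "(\<lambda>j. cumulative_Z j (M j) / (real (M j) * Z (v j) (l j) (M j))) \<longlonglongrightarrow> (1 - critical_density w / Y) / \<theta>"
proof -
  define \<rho> where "\<rho> = critical_density w"
  define \<delta> where "\<delta> = (Y - \<rho>) / 2"
  define K where "K = Y + 1"
  have \<delta>: "0 < \<delta>" "\<rho> + \<delta> < Y" "Y < K" "0 < K" "0 < Y"
    using Y critical_density_nonneg by (auto simp: \<delta>_def \<rho>_def K_def field_simps)
  have range: "\<forall>\<^sub>F j in sequentially. M j \<in> supercritical_range \<delta> K j"
    using eventually_supercritical_range[OF M, of \<delta> K] \<delta> by (simp add: \<rho>_def)
  define s where "s j = real (M j) - \<rho> * real (l j)" for j
  have 1: "(\<lambda>j. s j * Z (v j) (l j - 1) (M j) / cumulative_Z j (M j)) \<longlonglongrightarrow> \<theta>"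
  proof (rule tendstoI)
    fix e :: real assume "0 < e"
    then have e2: "0 < e / 2" "e / 2 < e" by auto
    show "\<forall>\<^sub>F j in sequentially. dist (s j * Z (v j) (l j - 1) (M j) / cumulative_Z j (M j)) \<theta> < e"
      using range Z_cumulative_uniform[OF \<delta>(1) e2(1) \<delta>(4)] supercritical_range_Z_pos[OF \<delta>(1), of K 0] v_nonneg
    proof eventually_elim
      case (elim j)
      define A where "A = cumulative_Z j (M j)"
      have "0 < Z (v j) (l j - 1) (M j)" using elim(1,3) by blast
      also have "\<dots> \<le> A" unfolding A_def cumulative_Z_def
        by (rule member_le_sum) (use elim(4) in \<open>auto intro: Z_nonneg\<close>)
      finally have A: "0 < A" .
      have "\<bar>s j * Z (v j) (l j - 1) (M j) - \<theta> * A\<bar> \<le> e / 2 * A"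
        using elim(1,2) by (auto simp: s_def \<rho>_def A_def)
      then have "\<bar>s j * Z (v j) (l j - 1) (M j) - \<theta> * A\<bar> / A \<le> e / 2" using A by (simp add: field_simps)
      also have "\<bar>s j * Z (v j) (l j - 1) (M j) - \<theta> * A\<bar> / A = \<bar>s j * Z (v j) (l j - 1) (M j) / A - \<theta>\<bar>"
      proof -
        have "\<bar>s j * Z (v j) (l j - 1) (M j) - \<theta> * A\<bar> / A = \<bar>(s j * Z (v j) (l j - 1) (M j) - \<theta> * A) / A\<bar>"
          using A by simp
        also have "(s j * Z (v j) (l j - 1) (M j) - \<theta> * A) / A = s j * Z (v j) (l j - 1) (M j) / A - \<theta>"
          using A by (simp add: field_simps)
        finally show ?thesis .
      qed
      finally show ?case using e2 by (simp add: dist_real_def A_def)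
    qed
  qed
  have 2: "(\<lambda>j. Z (v j) (l j - 1) (M j) / Z (v j) (l j) (M j)) \<longlonglongrightarrow> 1"
  proof (rule tendstoI)
    fix e :: real assume "0 < e"
    then show "\<forall>\<^sub>F j in sequentially. dist (Z (v j) (l j - 1) (M j) / Z (v j) (l j) (M j)) 1 < e"
      using eventually_conj[OF range Z_site_ratio_uniform[OF \<delta>(1), of e K]]
      by (auto simp: dist_real_def elim: eventually_mono)
  qed
  have 3: "(\<lambda>j. 1 - \<rho> / (real (M j) / real (l j))) \<longlonglongrightarrow> 1 - \<rho> / Y"
    using \<delta> by (intro tendsto_intros M) auto
  have "(\<lambda>j. (1 - \<rho> / (real (M j) / real (l j))) * (Z (v j) (l j - 1) (M j) / Z (v j) (l j) (M j)) /
      (s j * Z (v j) (l j - 1) (M j) / cumulative_Z j (M j))) \<longlonglongrightarrow> (1 - \<rho> / Y) * 1 / \<theta>"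
    using theta_pos by (intro tendsto_intros 1 2 3) auto
  then have "(\<lambda>j. cumulative_Z j (M j) / (real (M j) * Z (v j) (l j) (M j))) \<longlonglongrightarrow> (1 - \<rho> / Y) * 1 / \<theta>"
  proof (rule Lim_transform_eventually)
    show "\<forall>\<^sub>F j in sequentially. (1 - \<rho> / (real (M j) / real (l j))) * (Z (v j) (l j - 1) (M j) / Z (v j) (l j) (M j)) /
      (s j * Z (v j) (l j - 1) (M j) / cumulative_Z j (M j)) =
      cumulative_Z j (M j) / (real (M j) * Z (v j) (l j) (M j))"
      using range supercritical_range_Z_pos[OF \<delta>(1), of K 0] eventually_l_ge[of 1]
    proof eventually_elim
      case (elim j)
      then have pos: "0 < real (M j)" "0 < real (l j)" "Z (v j) (l j - 1) (M j) \<noteq> 0" "Z (v j) (l j) (M j) \<noteq> 0" by auto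
      have "0 < \<delta> * real (l j)" using \<delta> pos by simp
      also have "\<dots> \<le> s j" using supercritical_range_l_ge(1)[OF elim(1)] by (simp add: s_def \<rho>_def)
      finally have s: "0 < s j" .
      have "1 - \<rho> / (real (M j) / real (l j)) = s j / real (M j)" using pos by (simp add: s_def field_simps)
      then show ?case using pos s by simp
    qed
  qed
  then show ?thesis by (simp add: \<rho>_def)
qed

end


section \<open>The beta distribution and weighted sums\<close>

text \<open>The expectation of U^b (1 - U)^c for U with the Beta(1, \<open>\<theta>\<close>) law,
  whose normalising constant is \<open>\<theta>\<close>.\<close>

definition beta_moment :: "real \<Rightarrow> nat \<Rightarrow> nat \<Rightarrow> real" where
  "beta_moment \<theta> b c = \<theta> * Beta (real b + 1) (real c + \<theta>)"

lemma Beta_1_left: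
  fixes \<theta> :: real
  assumes "0 < \<theta>"
  shows "Beta 1 \<theta> = 1 / \<theta>"
proof -
  have "\<theta> \<notin> \<int>\<^sub>\<le>\<^sub>0" using assms nonpos_Ints_nonpos by force
  then have "Gamma (1 + \<theta>) = \<theta> * Gamma \<theta>" using Gamma_plus1[of \<theta>] by (simp add: add.commute)
  moreover have "Gamma \<theta> \<noteq> 0" using Gamma_real_pos[OF assms] by simp
  ultimately show ?thesis by (simp add: Beta_def)
qed

text \<open>The functional equation of the beta function. It links the exponent \<open>b - 1\<close>
  left by size-biasing with the exponent \<open>b\<close> produced by breaking a stick.\<close>

lemma beta_moment_Suc:
  assumes "0 < \<theta>" "0 < b"
  shows "real b * beta_moment \<theta> (b - 1) c = (real (b + c) + \<theta>) * beta_moment \<theta> b c"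
proof -
  have "real b \<notin> \<int>\<^sub>\<le>\<^sub>0" using assms nonpos_Ints_nonpos by force
  from Beta_plus1_left[OF this, of "real c + \<theta>"] show ?thesis
    using assms by (simp add: beta_moment_def of_nat_diff algebra_simps)
qed

lemma beta_moment_0:
  assumes "0 < \<theta>"
  shows "beta_moment \<theta> 0 c = \<theta> / (real c + \<theta>)"
  using assms by (simp add: beta_moment_def Beta_1_left)

lemma beta_moment_nonneg: "0 < \<theta> \<Longrightarrow> 0 \<le> beta_moment \<theta> b c"
  by (simp add: beta_moment_def Beta_def add_nonneg_pos add_pos_nonneg less_imp_le)

lemma sets_beta_distribution [measurable_cong, simp]: "sets (beta_distribution a b) = sets borel"
  by (simp add: beta_distribution_def)

lemma space_beta_distribution [simp]: "space (beta_distribution a b) = UNIV"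
  by (simp add: beta_distribution_def)

lemma AE_beta_distribution: "AE u in beta_distribution a b. 0 < u \<and> u < 1"
  unfolding beta_distribution_def by (subst AE_density) auto

lemma nn_integral_beta_distribution:
  assumes \<theta>: "0 < \<theta>"
  shows "(\<integral>\<^sup>+u. ennreal (u ^ b * (1 - u) ^ c) \<partial>beta_distribution 1 \<theta>) = ennreal (beta_moment \<theta> b c)"
proof -
  define f where "f t = \<theta> * (t powr (real b + 1 - 1) * (1 - t) powr (real c + \<theta> - 1))" for t :: real
  have int: "(f has_integral (beta_moment \<theta> b c)) {0..1}"
    unfolding f_def beta_moment_def using \<theta> by (intro has_integral_mult_right has_integral_Beta_real) auto
  have "(\<integral>\<^sup>+u. ennreal (u ^ b * (1 - u) ^ c) \<partial>beta_distribution 1 \<theta>) =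
     (\<integral>\<^sup>+u. ennreal (if u \<in> {0<..<1} then u powr (1 - 1) * (1 - u) powr (\<theta> - 1) / Beta 1 \<theta> else 0) *
        ennreal (u ^ b * (1 - u) ^ c) \<partial>lborel)"
    unfolding beta_distribution_def by (rule nn_integral_density) auto
  also have "\<dots> = (\<integral>\<^sup>+u. ennreal (f u) * indicator {0..1} u \<partial>lborel)"
  proof (rule nn_integral_cong_AE)
    show "AE u in lborel. ennreal (if u \<in> {0<..<1} then u powr (1 - 1) * (1 - u) powr (\<theta> - 1) / Beta 1 \<theta> else 0) *
        ennreal (u ^ b * (1 - u) ^ c) = ennreal (f u) * indicator {0..1} u"
      using AE_lborel_singleton[of 0] AE_lborel_singleton[of 1]
    proof eventually_elim
      case (elim u)
      show ?case
      proof (cases "0 < u \<and> u < 1")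
        case True
        have "(1 - u) ^ c * (1 - u) powr (\<theta> - 1) = (1 - u) powr (real c + \<theta> - 1)"
          using True by (simp add: powr_realpow[symmetric] powr_add[symmetric] add_diff_eq)
        moreover have "u ^ b = u powr (real b + 1 - 1)" using True by (simp add: powr_realpow)
        ultimately show ?thesis using True \<theta>
          by (simp add: f_def Beta_1_left ennreal_mult[symmetric] mult_ac)
      next
        case False
        then show ?thesis using elim by (auto simp: indicator_def)
      qed
    qed
  qed
  also have "\<dots> = ennreal (beta_moment \<theta> b c)"
    by (rule nn_integral_has_integral_lebesgue'[OF _ int]) (use \<theta> in \<open>auto simp: f_def\<close>)
  finally show ?thesis .
qed

lemma prob_space_beta_distribution:
  assumes "0 < \<theta>"
  shows "prob_space (beta_distribution 1 \<theta>)"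
proof
  show "emeasure (beta_distribution 1 \<theta>) (space (beta_distribution 1 \<theta>)) = 1"
    using nn_integral_beta_distribution[OF assms, of 0 0] beta_moment_0[OF assms, of 0] assms
    by simp
qed

lemma integral_beta_distribution:
  assumes \<theta>: "0 < \<theta>"
  shows "(LINT u|beta_distribution 1 \<theta>. u ^ b * (1 - u) ^ c) = beta_moment \<theta> b c"
    and "integrable (beta_distribution 1 \<theta>) (\<lambda>u. u ^ b * (1 - u) ^ c)"
proof -
  have "has_bochner_integral (beta_distribution 1 \<theta>) (\<lambda>u. u ^ b * (1 - u) ^ c) (beta_moment \<theta> b c)"
  proof (rule has_bochner_integral_nn_integral)
    show "AE u in beta_distribution 1 \<theta>. 0 \<le> u ^ b * (1 - u) ^ c"
      using AE_beta_distribution[of 1 \<theta>] by eventually_elim auto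
  qed (use \<theta> nn_integral_beta_distribution beta_moment_nonneg in auto)
  then show "(LINT u|beta_distribution 1 \<theta>. u ^ b * (1 - u) ^ c) = beta_moment \<theta> b c"
    "integrable (beta_distribution 1 \<theta>) (\<lambda>u. u ^ b * (1 - u) ^ c)"
    by (auto simp: has_bochner_integral_iff)
qed

lemma measure_beta_distribution_atLeast:
  assumes \<theta>: "0 < \<theta>" and a: "0 \<le> a" "a < 1"
  shows "measure (beta_distribution 1 \<theta>) {a..} = (1 - a) powr \<theta>"
proof -
  interpret B: prob_space "beta_distribution 1 \<theta>" by (rule prob_space_beta_distribution[OF \<theta>])
  have "emeasure (beta_distribution 1 \<theta>) {..<a} =
     (\<integral>\<^sup>+u. ennreal (if u \<in> {0<..<1} then u powr (1 - 1) * (1 - u) powr (\<theta> - 1) / Beta 1 \<theta> else 0) *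
        indicator {..<a} u \<partial>lborel)"
    unfolding beta_distribution_def by (rule emeasure_density) auto
  also have "\<dots> = (\<integral>\<^sup>+u. ennreal (\<theta> * (1 - u) powr (\<theta> - 1)) * indicator {0..a} u \<partial>lborel)"
  proof (rule nn_integral_cong_AE)
    show "AE u in lborel. ennreal (if u \<in> {0<..<1} then u powr (1 - 1) * (1 - u) powr (\<theta> - 1) / Beta 1 \<theta> else 0) *
        indicator {..<a} u = ennreal (\<theta> * (1 - u) powr (\<theta> - 1)) * indicator {0..a} u"
      using AE_lborel_singleton[of 0] AE_lborel_singleton[of a]
      by eventually_elim (use a \<theta> in \<open>auto simp: indicator_def Beta_1_left mult.commute\<close>)
  qed
  also have "\<dots> = ennreal (- ((1 - a) powr \<theta>) - (- ((1 - 0) powr \<theta>)))"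
  proof (rule nn_integral_FTC_Icc)
    fix u assume "u \<in> {0..a}"
    then show "((\<lambda>u. - ((1 - u) powr \<theta>)) has_real_derivative \<theta> * (1 - u) powr (\<theta> - 1)) (at u)"
      using a by (auto intro!: derivative_eq_intros)
  qed (use a \<theta> in auto)
  finally have "emeasure (beta_distribution 1 \<theta>) {..<a} = ennreal (1 - (1 - a) powr \<theta>)" by simp
  moreover have "(1 - a) powr \<theta> \<le> 1" using a \<theta> by (intro powr_le1) auto
  ultimately have "measure (beta_distribution 1 \<theta>) {..<a} = 1 - (1 - a) powr \<theta>"
    by (simp add: measure_def)
  moreover have "UNIV - {a..} = {..<a}" by auto
  ultimately show ?thesis using B.prob_compl[of "{a..}"] by simp
qed

text \<open>Read \<open>r\<close> as the critical density and \<open>Y\<close> as the density of the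
  system: the random variable is the density left when a cluster takes the fraction \<open>u\<close>
  of the surplus.\<close>

lemma cdf_scaled_beta:
  assumes \<theta>: "0 < \<theta>" and r: "r < Y"
  defines "M \<equiv> distr (beta_distribution 1 \<theta>) borel (\<lambda>u. r + (Y - r) * (1 - u))"
  shows "x \<le> r \<Longrightarrow> cdf M x = 0"
    and "r < x \<Longrightarrow> x < Y \<Longrightarrow> cdf M x = ((x - r) / (Y - r)) powr \<theta>"
    and "Y \<le> x \<Longrightarrow> cdf M x = 1"
proof -
  interpret B: prob_space "beta_distribution 1 \<theta>" by (rule prob_space_beta_distribution[OF \<theta>])
  define a where "a = 1 - (x - r) / (Y - r)"
  have cdf: "cdf M x = measure (beta_distribution 1 \<theta>) {a..}"
  proof -
    have "(\<lambda>u. r + (Y - r) * (1 - u)) -` {..x} = {a..}"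
      using r by (auto simp: a_def field_simps)
    then show ?thesis by (simp add: M_def cdf_def measure_distr)
  qed
  show "cdf M x = 0" if "x \<le> r"
  proof -
    have "1 \<le> a" using that r by (simp add: a_def divide_le_0_iff)
    then have "AE u in beta_distribution 1 \<theta>. u \<notin> {a..}"
      using AE_beta_distribution[of 1 \<theta>] by (auto elim: eventually_mono)
    then show ?thesis unfolding cdf using B.prob_eq_0[of "{a..}"] by simp
  qed
  show "cdf M x = ((x - r) / (Y - r)) powr \<theta>" if "r < x" "x < Y"
  proof -
    have "0 \<le> a" "a < 1" using that by (auto simp: a_def field_simps)
    from measure_beta_distribution_atLeast[OF \<theta> this] show ?thesis by (simp add: cdf a_def)
  qed
  show "cdf M x = 1" if "Y \<le> x"
  proof -
    have "a \<le> 0" using that r by (simp add: a_def)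
    then have "AE u in beta_distribution 1 \<theta>. u \<in> {a..}"
      using AE_beta_distribution[of 1 \<theta>] by (auto elim: eventually_mono)
    then show ?thesis unfolding cdf using B.prob_eq_1[of "{a..}"] by simp
  qed
qed

text \<open>By Skorohod's theorem the normalised positions converge almost surely, which reduces the
  claim to dominated convergence.\<close>

lemma weighted_sum_limit:
  fixes p \<phi> :: "nat \<Rightarrow> nat \<Rightarrow> real" and N l :: "nat \<Rightarrow> nat"
  assumes \<theta>: "0 < \<theta>" and r: "0 \<le> r" "r < Y"
    and l: "filterlim (\<lambda>j. real (l j)) at_top sequentially"
    and N: "(\<lambda>j. real (N j) / real (l j)) \<longlonglongrightarrow> Y"
    and p: "\<forall>\<^sub>F j in sequentially. (\<forall>m. 0 \<le> p j m) \<and> (\<Sum>m\<le>N j. p j m) = 1"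
    and p_lim: "\<And>m y. r < y \<Longrightarrow> y < Y \<Longrightarrow> (\<lambda>j. real (m j) / real (l j)) \<longlonglongrightarrow> y \<Longrightarrow>
      (\<lambda>j. \<Sum>i\<le>m j. p j i) \<longlonglongrightarrow> ((y - r) / (Y - r)) powr \<theta>"
    and bound: "\<forall>\<^sub>F j in sequentially. \<forall>m\<le>N j. \<bar>\<phi> j m\<bar> \<le> C"
    and \<phi>_lim: "\<And>m y. r < y \<Longrightarrow> y < Y \<Longrightarrow> (\<lambda>j. real (m j) / real (l j)) \<longlonglongrightarrow> y \<Longrightarrow> (\<And>j. m j \<le> N j) \<Longrightarrow>
      (\<lambda>j. \<phi> j (m j)) \<longlonglongrightarrow> g y"
    and g [measurable]: "g \<in> borel_measurable borel"
  shows "(\<lambda>j. \<Sum>m\<le>N j. p j m * \<phi> j m) \<longlonglongrightarrow> (LINT u|beta_distribution 1 \<theta>. g (r + (Y - r) * (1 - u)))"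
proof -
  interpret B: prob_space "beta_distribution 1 \<theta>" by (rule prob_space_beta_distribution[OF \<theta>])
  define good where "good j \<longleftrightarrow> (\<forall>m. 0 \<le> p j m) \<and> (\<Sum>m\<le>N j. p j m) = 1 \<and> (\<forall>m\<le>N j. \<bar>\<phi> j m\<bar> \<le> C) \<and> 0 < l j" for j
  have l1: "\<forall>\<^sub>F j in sequentially. 0 < l j"
  proof -
    have "\<forall>\<^sub>F j in sequentially. 0 < real (l j)" using l unfolding filterlim_at_top_dense by blast
    then show ?thesis by simp
  qed
  have good: "\<forall>\<^sub>F j in sequentially. good j"
    using p bound l1 by eventually_elim (auto simp: good_def)
  define P where "P j = point_measure {..N j} (\<lambda>m. ennreal (p j m))" for j
  define pos where "pos j m = real m / real (l j)" for j m
  \<comment> \<open>Skorohod's theorem asks for a distribution at every index; the point mass is a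
    filler for the finitely many bad ones.\<close>
  define \<kappa> where "\<kappa> j = (if good j then distr (P j) borel (pos j) else return borel 0)" for j
  define M where "M = distr (beta_distribution 1 \<theta>) borel (\<lambda>u. r + (Y - r) * (1 - u))"
  have P_sets: "sets (P j) = Pow {..N j}" "space (P j) = {..N j}" for j
    by (simp_all add: P_def sets_point_measure space_point_measure)
  have meas [measurable]: "f \<in> borel_measurable (P j)" for f :: "nat \<Rightarrow> real" and j
    by (auto simp: measurable_def P_sets)
  have P_prob: "prob_space (P j)" if "good j" for j
  proof
    have "emeasure (P j) {..N j} = (\<Sum>m\<le>N j. ennreal (p j m))"
      by (simp add: P_def emeasure_point_measure_finite)
    also have "\<dots> = ennreal (\<Sum>m\<le>N j. p j m)" using that by (intro sum_ennreal) (auto simp: good_def)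
    finally show "emeasure (P j) (space (P j)) = 1" using that by (simp add: good_def P_sets)
  qed
  have P_int: "(LINT m|P j. f m) = (\<Sum>m\<le>N j. p j m * f m)" if "good j" for j and f :: "nat \<Rightarrow> real"
    unfolding P_def using that by (subst lebesgue_integral_point_measure_finite) (auto simp: good_def)
  have \<kappa>_real: "real_distribution (\<kappa> j)" for j
  proof (cases "good j")
    case True
    then show ?thesis unfolding \<kappa>_def using prob_space.real_distribution_distr[OF P_prob] by simp
  next
    case False
    then show ?thesis unfolding \<kappa>_def
      by (simp add: real_distribution_def real_distribution_axioms_def prob_space_return)
  qed
  have M_real: "real_distribution M"
    unfolding M_def by (rule B.real_distribution_distr) simp
  have cdf_\<kappa>: "cdf (\<kappa> j) x = (\<Sum>m\<in>{m\<in>{..N j}. pos j m \<le> x}. p j m)" if "good j" for j x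
  proof -
    have "cdf (\<kappa> j) x = measure (P j) {m\<in>{..N j}. pos j m \<le> x}"
      using that by (auto simp: \<kappa>_def cdf_def measure_distr P_sets vimage_def Int_def conj_commute)
    also have "\<dots> = (\<Sum>m\<in>{m\<in>{..N j}. pos j m \<le> x}. p j m)"
      unfolding P_def using that by (subst measure_point_measure_finite_if) (auto simp: good_def)
    finally show ?thesis .
  qed
  have cdf_mono: "cdf (\<kappa> j) x \<le> cdf (\<kappa> j) y" if "x \<le> y" for j x y
    using that finite_borel_measure.cdf_nondecreasing[of "\<kappa> j"] \<kappa>_real
    by (simp add: real_distribution.finite_borel_measure_M)
  have cdf_range: "0 \<le> cdf (\<kappa> j) x" "cdf (\<kappa> j) x \<le> 1" for j x
    using real_distribution.cdf_bounded_prob[OF \<kappa>_real] by (auto simp: cdf_def)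
  \<comment> \<open>The hypothesis on partial sums is applied to the largest mass whose position
    does not exceed \<open>x\<close>.\<close>
  have mid: "(\<lambda>j. cdf (\<kappa> j) x) \<longlonglongrightarrow> ((x - r) / (Y - r)) powr \<theta>" if x: "r < x" "x < Y" for x
  proof -
    define m where "m j = nat \<lfloor>x * real (l j)\<rfloor>" for j
    have m_lim: "(\<lambda>j. real (m j) / real (l j)) \<longlonglongrightarrow> x"
    proof (rule real_tendsto_sandwich)
      have "(\<lambda>j. x - 1 / real (l j)) \<longlonglongrightarrow> x - 0"
        by (intro tendsto_intros real_tendsto_divide_at_top[OF tendsto_const l])
      then show "(\<lambda>j. x - 1 / real (l j)) \<longlonglongrightarrow> x" by simp
      show "\<forall>\<^sub>F j in sequentially. x - 1 / real (l j) \<le> real (m j) / real (l j)" using l1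
      proof eventually_elim
        case (elim j)
        have "x * real (l j) - 1 \<le> real (m j)" unfolding m_def by linarith
        then have "(x * real (l j) - 1) / real (l j) \<le> real (m j) / real (l j)"
          by (rule divide_right_mono) simp
        then show ?case using elim by (simp add: diff_divide_distrib)
      qed
      show "\<forall>\<^sub>F j in sequentially. real (m j) / real (l j) \<le> x" using l1
      proof eventually_elim
        case (elim j)
        have "0 \<le> x * real (l j)" using x r by simp
        then have "real (m j) \<le> x * real (l j)" unfolding m_def by linarith
        then show ?case using elim by (simp add: divide_le_eq)
      qed
    qed simp
    have "\<forall>\<^sub>F j in sequentially. x < real (N j) / real (l j)"
      by (rule order_tendstoD(1)[OF N]) (rule x)
    then have "\<forall>\<^sub>F j in sequentially. (\<Sum>i\<le>m j. p j i) = cdf (\<kappa> j) x"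
      using good
    proof eventually_elim
      case (elim j)
      then have lj: "0 < real (l j)" by (simp add: good_def)
      have x0: "0 \<le> x * real (l j)" using x r by simp
      have xN: "x * real (l j) < real (N j)" using elim(1) lj by (simp add: field_simps)
      have "i \<le> m j \<longleftrightarrow> i \<le> N j \<and> pos j i \<le> x" for i
      proof -
        have "pos j i \<le> x \<longleftrightarrow> real i \<le> x * real (l j)" using lj by (simp add: pos_def field_simps)
        also have "\<dots> \<longleftrightarrow> i \<le> m j" using x0 unfolding m_def by linarith
        finally have *: "pos j i \<le> x \<longleftrightarrow> i \<le> m j" .
        have "m j \<le> N j" using xN x0 unfolding m_def by linarith
        with * show ?thesis by auto
      qed
      then have "{..m j} = {m\<in>{..N j}. pos j m \<le> x}" by auto
      then show ?case using cdf_\<kappa>[OF elim(2)] by simp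
    qed
    with p_lim[OF x m_lim] show ?thesis by (rule Lim_transform_eventually)
  qed
  have conv: "weak_conv_m \<kappa> M"
    unfolding weak_conv_m_def weak_conv_def
  proof (intro allI impI)
    fix x
    consider "x \<le> r" | "r < x" "x < Y" | "Y \<le> x" by linarith
    then show "(\<lambda>j. cdf (\<kappa> j) x) \<longlonglongrightarrow> cdf M x"
    proof cases
      case 1
      have "cdf M x = 0" unfolding M_def by (rule cdf_scaled_beta(1)[OF \<theta> r(2) 1])
      moreover have "(\<lambda>j. cdf (\<kappa> j) x) \<longlonglongrightarrow> 0"
      proof (rule tendstoI)
        fix e :: real assume e: "0 < e"
        \<comment> \<open>Monotonicity compares with a point slightly above \<open>r\<close>, where
          the limiting value is \<open>h powr \<theta> \<le> e / 2\<close>; the bound 1/2 keeps this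
          point below \<open>Y\<close>.\<close>
        define h where "h = min (1/2) ((e / 2) powr (1 / \<theta>))"
        have h: "0 < h" "h < 1" using e by (auto simp: h_def)
        have "h powr \<theta> \<le> ((e / 2) powr (1 / \<theta>)) powr \<theta>"
          using h \<theta> by (intro powr_mono2) (auto simp: h_def)
        also have "\<dots> = e / 2" using e \<theta> by (simp add: powr_powr)
        finally have he: "h powr \<theta> < e" using e by linarith
        define y where "y = r + (Y - r) * h"
        define d where "d = (Y - r) * h"
        have "0 < d" using h r by (simp add: d_def)
        moreover have "d < Y - r" using mult_strict_left_mono[of h 1 "Y - r"] h r by (simp add: d_def)
        ultimately have "r < y" "y < Y" unfolding y_def d_def[symmetric] by linarith+
        moreover have "(y - r) / (Y - r) = h" using r by (simp add: y_def)
        ultimately have y: "r < y" "y < Y" "(y - r) / (Y - r) = h" by simp_all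
        have "\<forall>\<^sub>F j in sequentially. cdf (\<kappa> j) y < e"
          by (rule order_tendstoD(2)[OF mid[OF y(1,2)]]) (use he y in simp)
        then show "\<forall>\<^sub>F j in sequentially. dist (cdf (\<kappa> j) x) 0 < e"
        proof eventually_elim
          case (elim j)
          have "cdf (\<kappa> j) x \<le> cdf (\<kappa> j) y" using 1 y by (intro cdf_mono) auto
          then show ?case using elim cdf_range(1)[of j x] by (simp add: dist_real_def)
        qed
      qed
      ultimately show ?thesis by simp
    next
      case 2
      then show ?thesis using mid[OF 2] cdf_scaled_beta(2)[OF \<theta> r(2) 2] by (simp add: M_def)
    next
      case 3
      have "cdf M x = 1" unfolding M_def by (rule cdf_scaled_beta(3)[OF \<theta> r(2) 3])
      moreover have "(\<lambda>j. cdf (\<kappa> j) x) \<longlonglongrightarrow> 1"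
      proof (rule tendstoI)
        fix e :: real assume e: "0 < e"
        \<comment> \<open>The mirror image at the upper end: the limiting value at the comparison
          point exceeds \<open>1 - e\<close>, and the lower bound 1/2 keeps the power away from base
          0.\<close>
        define h where "h = max (1/2) ((max (1/2) (1 - e / 2)) powr (1 / \<theta>))"
        have m: "1/2 \<le> max (1/2) (1 - e / 2)" "max (1/2) (1 - e / 2) < 1" using e by auto
        have "(max (1/2) (1 - e / 2)) powr (1 / \<theta>) < 1 powr (1 / \<theta>)"
          using m \<theta> by (intro powr_less_mono2) auto
        then have h: "0 < h" "h < 1" by (auto simp: h_def)
        have "1 - e < max (1/2) (1 - e / 2)" using e by auto
        also have "\<dots> = ((max (1/2) (1 - e / 2)) powr (1 / \<theta>)) powr \<theta>" using m \<theta> by (simp add: powr_powr)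
        also have "\<dots> \<le> h powr \<theta>" using \<theta> by (intro powr_mono2) (auto simp: h_def)
        finally have he: "1 - e < h powr \<theta>" .
        define y where "y = r + (Y - r) * h"
        define d where "d = (Y - r) * h"
        have "0 < d" using h r by (simp add: d_def)
        moreover have "d < Y - r" using mult_strict_left_mono[of h 1 "Y - r"] h r by (simp add: d_def)
        ultimately have "r < y" "y < Y" unfolding y_def d_def[symmetric] by linarith+
        moreover have "(y - r) / (Y - r) = h" using r by (simp add: y_def)
        ultimately have y: "r < y" "y < Y" "(y - r) / (Y - r) = h" by simp_all
        have "\<forall>\<^sub>F j in sequentially. 1 - e < cdf (\<kappa> j) y"
          by (rule order_tendstoD(1)[OF mid[OF y(1,2)]]) (use he y in simp)
        then show "\<forall>\<^sub>F j in sequentially. dist (cdf (\<kappa> j) x) 1 < e"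
        proof eventually_elim
          case (elim j)
          have "cdf (\<kappa> j) y \<le> cdf (\<kappa> j) x" using 3 y by (intro cdf_mono) auto
          then show ?case using elim cdf_range(2)[of j x] by (simp add: dist_real_def)
        qed
      qed
      ultimately show ?thesis by simp
    qed
  qed
  obtain \<Omega> :: "real measure" and Yn Y' where
    \<Omega>: "prob_space \<Omega>" and Yn [measurable]: "\<And>n. Yn n \<in> borel_measurable \<Omega>"
    and Yn_distr: "\<And>n. distr \<Omega> borel (Yn n) = \<kappa> n"
    and Y' [measurable]: "Y' \<in> borel_measurable \<Omega>" and Y'_distr: "distr \<Omega> borel Y' = M"
    and Y'_lim: "\<And>x. x \<in> space \<Omega> \<Longrightarrow> (\<lambda>n. Yn n x) \<longlonglongrightarrow> Y' x"
    using Skorohod[OF \<kappa>_real M_real conv] by force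
  interpret W: prob_space "\<Omega>" by (rule \<Omega>)
  \<comment> \<open>Rounds a real position back to a mass of the system. On the atoms of
    \<open>\<kappa> j\<close> it inverts \<open>pos j\<close>, and the minimum keeps the index
    within the range of the sum.\<close>
  define near where "near j z = min (nat (round ((z::real) * real (l j)))) (N j)" for j z
  have round_meas [measurable]: "(\<lambda>z. round (z * real (l j))) \<in> borel \<rightarrow>\<^sub>M count_space UNIV" for j
    unfolding round_def by measurable
  have near_meas [measurable]: "near j \<in> borel \<rightarrow>\<^sub>M count_space UNIV" for j
    unfolding near_def by measurable
  define \<psi> where "\<psi> j z = (if good j then \<phi> j (near j z) else 0)" for j z
  have \<psi>_meas [measurable]: "\<psi> j \<in> borel_measurable borel" for j
  proof -
    have "(\<lambda>z. \<phi> j (near j z)) \<in> borel_measurable borel"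
      by (rule measurable_compose[OF near_meas]) simp
    then show ?thesis by (cases "good j") (simp_all add: \<psi>_def[abs_def])
  qed
  have C: "0 \<le> C"
  proof -
    obtain j where "good j" using eventually_happens[OF good] by auto
    then have "\<bar>\<phi> j 0\<bar> \<le> C" by (simp add: good_def)
    then show ?thesis by linarith
  qed
  have "(\<lambda>j. LINT x|\<Omega>. \<psi> j (Yn j x)) \<longlonglongrightarrow> (LINT x|\<Omega>. g (Y' x))"
  proof (rule integral_dominated_convergence[where w = "\<lambda>_. C"])
    show "AE x in \<Omega>. norm (\<psi> j (Yn j x)) \<le> C" for j
      using C by (intro AE_I2) (auto simp: \<psi>_def good_def near_def)
    have "AE y in M. r < y \<and> y < Y"
      unfolding M_def
    proof (subst AE_distr_iff)
      show "AE u in beta_distribution 1 \<theta>. r < r + (Y - r) * (1 - u) \<and> r + (Y - r) * (1 - u) < Y"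
        using AE_beta_distribution[of 1 \<theta>]
      proof eventually_elim
        case (elim u)
        define d where "d = (Y - r) * (1 - u)"
        have "0 < d" using elim r by (simp add: d_def)
        moreover have "d < Y - r" using mult_strict_left_mono[of "1 - u" 1 "Y - r"] elim r by (simp add: d_def)
        ultimately show ?case unfolding d_def[symmetric] by linarith
      qed
    qed auto
    then have "AE x in \<Omega>. r < Y' x \<and> Y' x < Y"
      unfolding Y'_distr[symmetric] by (subst (asm) AE_distr_iff) auto
    then show "AE x in \<Omega>. (\<lambda>j. \<psi> j (Yn j x)) \<longlonglongrightarrow> g (Y' x)"
      using AE_space
    proof eventually_elim
      case (elim x)
      define y where "y = Y' x"
      have y: "r < y" "y < Y" using elim by (auto simp: y_def)
      have lim: "(\<lambda>j. Yn j x) \<longlonglongrightarrow> y" unfolding y_def by (rule Y'_lim[OF elim(2)])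
      have round_lim: "(\<lambda>j. real_of_int (round (Yn j x * real (l j))) / real (l j)) \<longlonglongrightarrow> y"
      proof (rule Lim_transform[OF lim], rule Lim_null_comparison)
        show "\<forall>\<^sub>F j in sequentially. norm (real_of_int (round (Yn j x * real (l j))) / real (l j) - Yn j x) \<le> 1 / real (l j)"
          using l1
        proof eventually_elim
          case (elim j)
          have "\<bar>real_of_int (round (Yn j x * real (l j))) - Yn j x * real (l j)\<bar> \<le> 1"
            using of_int_round_abs_le[of "Yn j x * real (l j)"] by linarith
          then have "\<bar>real_of_int (round (Yn j x * real (l j))) - Yn j x * real (l j)\<bar> / real (l j) \<le> 1 / real (l j)"
            by (intro divide_right_mono) auto
          moreover have "real_of_int (round (Yn j x * real (l j))) / real (l j) - Yn j x =
            (real_of_int (round (Yn j x * real (l j))) - Yn j x * real (l j)) / real (l j)"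
            using elim by (simp add: field_simps)
          ultimately show ?case by simp
        qed
        show "(\<lambda>j. 1 / real (l j)) \<longlonglongrightarrow> 0" by (rule real_tendsto_divide_at_top[OF tendsto_const l])
      qed
      have "(\<lambda>j. min (max 0 (real_of_int (round (Yn j x * real (l j))) / real (l j))) (real (N j) / real (l j)))
          \<longlonglongrightarrow> min (max 0 y) Y"
        by (intro tendsto_min tendsto_max tendsto_const round_lim N)
      also have "min (max 0 y) Y = y" using y r by auto
      finally have "(\<lambda>j. real (near j (Yn j x)) / real (l j)) \<longlonglongrightarrow> y"
      proof (rule Lim_transform_eventually)
        show "\<forall>\<^sub>F j in sequentially. min (max 0 (real_of_int (round (Yn j x * real (l j))) / real (l j))) (real (N j) / real (l j))
            = real (near j (Yn j x)) / real (l j)"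
          using l1
        proof eventually_elim
          case (elim j)
          then have lj: "0 < real (l j)" by simp
          have "real (near j (Yn j x)) = min (max 0 (real_of_int (round (Yn j x * real (l j))))) (real (N j))"
            by (simp add: near_def of_nat_min)
          then have "real (near j (Yn j x)) / real (l j) =
             min (max 0 (real_of_int (round (Yn j x * real (l j)))) / real (l j)) (real (N j) / real (l j))"
            using lj by (simp add: min_divide_distrib_right)
          then show ?case using lj by (simp add: max_divide_distrib_right)
        qed
      qed
      from \<phi>_lim[OF y this] have "(\<lambda>j. \<phi> j (near j (Yn j x))) \<longlonglongrightarrow> g y" by (simp add: near_def)
      then show ?case unfolding y_def
      proof (rule Lim_transform_eventually)
        show "\<forall>\<^sub>F j in sequentially. \<phi> j (near j (Yn j x)) = \<psi> j (Yn j x)"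
          using good by eventually_elim (simp add: \<psi>_def)
      qed
    qed
  qed auto
  also have "(LINT x|\<Omega>. g (Y' x)) = (LINT y|M. g y)"
    unfolding Y'_distr[symmetric] by (subst integral_distr) auto
  also have "\<dots> = (LINT u|beta_distribution 1 \<theta>. g (r + (Y - r) * (1 - u)))"
    unfolding M_def by (subst integral_distr) auto
  finally show ?thesis
  proof (rule Lim_transform_eventually)
    show "\<forall>\<^sub>F j in sequentially. (LINT x|\<Omega>. \<psi> j (Yn j x)) = (\<Sum>m\<le>N j. p j m * \<phi> j m)"
      using good
    proof eventually_elim
      case (elim j)
      then have lj: "0 < real (l j)" by (simp add: good_def)
      have "(LINT x|\<Omega>. \<psi> j (Yn j x)) = (LINT y|\<kappa> j. \<psi> j y)"
        unfolding Yn_distr[symmetric] by (subst integral_distr) auto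
      also have "\<dots> = (LINT m|P j. \<psi> j (pos j m))"
        using elim by (simp add: \<kappa>_def integral_distr)
      also have "\<dots> = (\<Sum>m\<le>N j. p j m * \<psi> j (pos j m))" by (rule P_int[OF elim])
      also have "\<dots> = (\<Sum>m\<le>N j. p j m * \<phi> j m)"
        using elim lj by (intro sum.cong refl) (auto simp: \<psi>_def near_def pos_def)
      finally show ?case .
    qed
  qed
qed


section \<open>Moments of the canonical mass partition\<close>

definition normalised_moment :: "(nat \<Rightarrow> nat) \<Rightarrow> (nat \<Rightarrow> real) \<Rightarrow> nat \<Rightarrow> nat \<Rightarrow> nat set \<Rightarrow> real" where
  "normalised_moment a v l N I = moment_sum a v l N I / (Z v l N * real N ^ (\<Sum>i\<in>I. a i))"

lemma normalised_moment_bounds: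
  assumes v: "\<And>n. 0 \<le> v n" and a: "\<And>i. i \<in> I \<Longrightarrow> 1 \<le> a i"
  shows "0 \<le> normalised_moment a v l N I" "normalised_moment a v l N I \<le> 1"
    "moment_sum a v l N I = Z v l N * real N ^ (\<Sum>i\<in>I. a i) * normalised_moment a v l N I"
proof -
  have ms: "0 \<le> moment_sum a v l N I" by (rule moment_sum_nonneg[OF v])
  have le: "moment_sum a v l N I \<le> Z v l N * real N ^ (\<Sum>i\<in>I. a i)" by (rule moment_sum_le[OF v a])
  have z: "0 \<le> Z v l N" by (rule Z_nonneg[OF v])
  show "0 \<le> normalised_moment a v l N I" using ms z by (simp add: normalised_moment_def)
  show "normalised_moment a v l N I \<le> 1"
    using ms le unfolding normalised_moment_def by (intro divide_le_eq_1[THEN iffD2]) linarith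
  show "moment_sum a v l N I = Z v l N * real N ^ (\<Sum>i\<in>I. a i) * normalised_moment a v l N I"
    using ms le by (cases "Z v l N * real N ^ (\<Sum>i\<in>I. a i) = 0") (auto simp: normalised_moment_def)
qed

text \<open>The free normalisation \<open>A\<close> will be the partial sum of \<open>Z\<close>, so
  that the quotients \<open>Z v (l - 1) m / A\<close> become probabilities for the remaining mass
  \<open>m\<close>. One power of the occupation is set aside to form \<open>n * v n * l\<close>,
  hence the exponent reduced by 1.\<close>

lemma normalised_moment_rec:
  assumes I: "finite I" "k \<in> I" and v: "\<And>n. 0 \<le> v n" and a: "\<And>i. i \<in> I \<Longrightarrow> 1 \<le> a i"
    and N: "0 < N" and A: "A \<noteq> 0" and l: "0 < l" and Z: "Z v l N \<noteq> 0"
  shows "normalised_moment a v l N I = (\<Sum>B\<in>Pow (I - {k}). A / (real N * Z v l N) *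
    (\<Sum>m\<le>N. Z v (l - 1) m / A *
      ((real (N - m) * v (N - m) * real l) * (real (N - m) / real N) ^ ((\<Sum>i\<in>insert k B. a i) - 1) *
        (real m / real N) ^ (\<Sum>i\<in>I - {k} - B. a i) * normalised_moment a v (l - 1) m (I - {k} - B))))"
proof -
  obtain l' where l': "l = Suc l'" using l gr0_implies_Suc by blast
  have "moment_sum a v l N I = real l *
    (\<Sum>B\<in>Pow (I - {k}). \<Sum>n\<le>N. v n * real n ^ (\<Sum>i\<in>insert k B. a i) * moment_sum a v (l - 1) (N - n) (I - {k} - B))"
    unfolding l' moment_sum_rec[OF I] by (subst sum.swap) simp
  also have "\<dots> = real l *
    (\<Sum>B\<in>Pow (I - {k}). \<Sum>m\<le>N. v (N - m) * real (N - m) ^ (\<Sum>i\<in>insert k B. a i) * moment_sum a v (l - 1) m (I - {k} - B))"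
  proof -
    have "(\<Sum>n\<le>N. f n (N - n)) = (\<Sum>m\<le>N. f (N - m) m)" for f :: "nat \<Rightarrow> nat \<Rightarrow> real"
      by (rule sum.reindex_bij_witness[where i = "\<lambda>n. N - n" and j = "\<lambda>n. N - n"]) auto
    from this[of "\<lambda>n m. v n * real n ^ (\<Sum>i\<in>insert k B. a i) * moment_sum a v (l - 1) m (I - {k} - B)" for B]
    show ?thesis by simp
  qed
  finally have "normalised_moment a v l N I = (\<Sum>B\<in>Pow (I - {k}). \<Sum>m\<le>N.
     real l * (v (N - m) * real (N - m) ^ (\<Sum>i\<in>insert k B. a i) * moment_sum a v (l - 1) m (I - {k} - B)) /
       (Z v l N * real N ^ (\<Sum>i\<in>I. a i)))"
    by (simp add: normalised_moment_def sum_distrib_left sum_divide_distrib)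
  also have "\<dots> = (\<Sum>B\<in>Pow (I - {k}). \<Sum>m\<le>N. A / (real N * Z v l N) * (Z v (l - 1) m / A *
      ((real (N - m) * v (N - m) * real l) * (real (N - m) / real N) ^ ((\<Sum>i\<in>insert k B. a i) - 1) *
        (real m / real N) ^ (\<Sum>i\<in>I - {k} - B. a i) * normalised_moment a v (l - 1) m (I - {k} - B))))"
  proof (intro sum.cong refl)
    fix B m assume B: "B \<in> Pow (I - {k})"
    have fB: "finite B" "k \<notin> B" "B \<subseteq> I" using B I finite_subset by auto
    define b where "b = (\<Sum>i\<in>insert k B. a i) - 1"
    define c where "c = (\<Sum>i\<in>I - {k} - B. a i)"
    have b: "(\<Sum>i\<in>insert k B. a i) = Suc b" using a[OF I(2)] fB by (simp add: b_def)
    have "I = insert k B \<union> (I - {k} - B)" using fB I by auto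
    then have "(\<Sum>i\<in>I. a i) = (\<Sum>i\<in>insert k B. a i) + (\<Sum>i\<in>I - {k} - B. a i)"
      using I fB by (metis Diff_disjoint Diff_insert Diff_insert2 finite_Diff finite_insert sum.union_disjoint)
    then have s: "(\<Sum>i\<in>I. a i) = Suc (b + c)" by (simp add: b c_def)
    have e: "moment_sum a v (l - 1) m (I - {k} - B) =
      Z v (l - 1) m * real m ^ c * normalised_moment a v (l - 1) m (I - {k} - B)"
      unfolding c_def by (rule normalised_moment_bounds(3)) (use v a in auto)
    have "real N \<noteq> 0" using N by simp
    then show "real l * (v (N - m) * real (N - m) ^ (\<Sum>i\<in>insert k B. a i) * moment_sum a v (l - 1) m (I - {k} - B)) /
       (Z v l N * real N ^ (\<Sum>i\<in>I. a i)) = A / (real N * Z v l N) * (Z v (l - 1) m / A *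
      ((real (N - m) * v (N - m) * real l) * (real (N - m) / real N) ^ ((\<Sum>i\<in>insert k B. a i) - 1) *
        (real m / real N) ^ (\<Sum>i\<in>I - {k} - B. a i) * normalised_moment a v (l - 1) m (I - {k} - B)))"
      unfolding s e b c_def[symmetric] using A Z by (simp add: power_divide power_add field_simps)
  qed
  finally show ?thesis by (simp only: sum_distrib_left)
qed

text \<open>The recursion satisfied by the moments \<open>c\<close> is symmetrised over the distinguished index \<open>k\<close>,
  because the recursion of the stick-breaking process singles out no index.\<close>

theorem normalised_moment_limit:
  fixes a :: "nat \<Rightarrow> nat" and c :: "nat set \<Rightarrow> real"
  assumes \<theta>: "0 < \<theta>" and a: "\<And>i. 2 \<le> a i" and c0: "c {} = 1"
    and c_rec: "\<And>I. finite I \<Longrightarrow> I \<noteq> {} \<Longrightarrow> real (\<Sum>i\<in>I. a i) * c I =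
      (\<Sum>k\<in>I. real (a k) * (\<Sum>B\<in>Pow (I - {k}).
        beta_moment \<theta> ((\<Sum>i\<in>insert k B. a i) - 1) (\<Sum>i\<in>I - {k} - B. a i) * c (I - {k} - B)))"
    and I: "finite I" and cw: "condensing_weights v l w \<theta>"
    and N: "(\<lambda>j. real (N j) / real (l j)) \<longlonglongrightarrow> Y" and Y: "critical_density w < Y"
  shows "(\<lambda>j. normalised_moment a (v j) (l j) (N j) I) \<longlonglongrightarrow> (1 - critical_density w / Y) ^ (\<Sum>i\<in>I. a i) * c I"
  using I cw N Y
\<comment> \<open>The induction hypothesis is used with one site fewer and at every density between
  the critical one and \<open>Y\<close>.\<close>
proof (induction I arbitrary: l N Y rule: finite_psubset_induct)
  case (psubset I)
  interpret condensing_weights v l w \<theta> by fact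
  note N = psubset.prems(2) and Y = psubset.prems(3)
  have a1: "1 \<le> a i" for i using a[of i] by linarith
  define \<rho> where "\<rho> = critical_density w"
  define \<alpha> where "\<alpha> = 1 - \<rho> / Y"
  have \<rho>: "0 \<le> \<rho>" "\<rho> < Y" using critical_density_nonneg Y by (auto simp: \<rho>_def)
  then have Y0: "0 < Y" by simp
  have N_lim: "filterlim (\<lambda>j. real (N j)) at_top sequentially"
  proof -
    have "filterlim (\<lambda>j. real (N j) / real (l j) * real (l j)) at_top sequentially"
      by (rule filterlim_tendsto_pos_mult_at_top[OF N Y0 l_real])
    then show ?thesis
    proof (rule filterlim_cong[OF refl refl, THEN iffD1, rotated])
      show "\<forall>\<^sub>F j in sequentially. real (N j) / real (l j) * real (l j) = real (N j)"
        using eventually_l_ge[of 1] by eventually_elim simp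
    qed
  qed
  obtain J where J: "\<forall>\<^sub>F j in sequentially. \<forall>m>J. 0 < Z (v j) (l j) m" using Z_pos by blast
  have "\<forall>\<^sub>F j in sequentially. real J < real (N j)" using N_lim unfolding filterlim_at_top_dense by blast
  with J have ZN: "\<forall>\<^sub>F j in sequentially. 0 < Z (v j) (l j) (N j) \<and> 0 < N j"
    by eventually_elim auto
  show ?case
  proof (cases "I = {}")
    case True
    show ?thesis unfolding True
      by (rule Lim_transform_eventually[OF tendsto_const])
         (use ZN in \<open>auto simp: normalised_moment_def c0 elim: eventually_mono\<close>)
  next
    case False
    define s where "s = (\<Sum>i\<in>I. a i)"
    have s_pos: "0 < s"
    proof -
      obtain k where "k \<in> I" using False by blast
      then have "a k \<le> s" unfolding s_def using \<open>finite I\<close> by (intro member_le_sum) auto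
      then show ?thesis using a[of k] by linarith
    qed
    define A where "A j = cumulative_Z j (N j)" for j
    have A_norm: "(\<lambda>j. A j / (real (N j) * Z (v j) (l j) (N j))) \<longlonglongrightarrow> \<alpha> / \<theta>"
      using cumulative_Z_normalised_limit[OF N Y] by (simp add: A_def \<alpha>_def \<rho>_def)
    have "0 < \<alpha> / \<theta>" using \<rho> Y0 \<theta> by (simp add: \<alpha>_def)
    then have A_pos: "\<forall>\<^sub>F j in sequentially. 0 < A j"
    proof -
      have "\<forall>\<^sub>F j in sequentially. 0 < A j / (real (N j) * Z (v j) (l j) (N j))"
        by (rule order_tendstoD(1)[OF A_norm \<open>0 < \<alpha> / \<theta>\<close>])
      then show ?thesis using ZN
      proof eventually_elim
        case (elim j)
        then have "0 < real (N j) * Z (v j) (l j) (N j)" by simp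
        with elim(1) show ?case by (simp only: zero_less_divide_iff) linarith
      qed
    qed
    define R where "R k = (\<Sum>B\<in>Pow (I - {k}).
        beta_moment \<theta> ((\<Sum>i\<in>insert k B. a i) - 1) (\<Sum>i\<in>I - {k} - B. a i) * c (I - {k} - B))" for k
    have lim: "(\<lambda>j. normalised_moment a (v j) (l j) (N j) I) \<longlonglongrightarrow> \<alpha> ^ s * R k" if k: "k \<in> I" for k
    proof -
      define b where "b B = (\<Sum>i\<in>insert k B. a i) - 1" for B
      define d where "d B = (\<Sum>i\<in>I - {k} - B. a i)" for B
      define \<phi> where "\<phi> B j m = (real (N j - m) * v j (N j - m) * real (l j)) *
          (real (N j - m) / real (N j)) ^ b B * (real m / real (N j)) ^ d B *
          normalised_moment a (v j) (l j - 1) m (I - {k} - B)" for B j m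
      have summand: "(\<lambda>j. \<Sum>m\<le>N j. Z (v j) (l j - 1) m / A j * \<phi> B j m) \<longlonglongrightarrow>
          \<theta> * \<alpha> ^ (b B + d B) * beta_moment \<theta> (b B) (d B) * c (I - {k} - B)"
        if B: "B \<in> Pow (I - {k})" for B
      proof -
        define I' where "I' = I - {k} - B"
        have fB: "finite B" "k \<notin> B" using B \<open>finite I\<close> finite_subset by auto
        \<comment> \<open>Exponents at least 2 leave a factor (n / N) after size-biasing. It
          compensates the sites with at most \<open>J\<close> particles, for which
          \<open>n * v j n * l j\<close> can be of the order of \<open>l j\<close>.\<close>
        have b1: "1 \<le> b B" using a[of k] fB by (simp add: b_def)
        \<comment> \<open>The limit of \<open>\<phi> B j\<close> at remaining density
          \<open>y\<close>: the marked cluster has taken \<open>Y - y\<close>, and the surplus of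
          the remaining system is \<open>y - \<rho>\<close>.\<close>
        define g where "g y = \<theta> * ((Y - y) / Y) ^ b B * ((y - \<rho>) / Y) ^ d B * c I'" for y
        have IH: "(\<lambda>j. normalised_moment a (v j) (l j - 1) (m j) I') \<longlonglongrightarrow> (1 - \<rho> / y) ^ d B * c I'"
          if y: "\<rho> < y" and m: "(\<lambda>j. real (m j) / real (l j)) \<longlonglongrightarrow> y" for m y
        proof -
          have "(\<lambda>j. real (m j) / real (l j) * (real (l j) / (real (l j) - 1))) \<longlonglongrightarrow> y * 1"
          proof (intro tendsto_mult m)
            have "((\<lambda>x :: real. x / (x - 1)) \<longlongrightarrow> 1) at_top" by real_asymp
            then show "(\<lambda>j. real (l j) / (real (l j) - 1)) \<longlonglongrightarrow> 1"
              using l_real by (rule filterlim_compose)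
          qed
          then have "(\<lambda>j. real (m j) / real (l j - 1)) \<longlonglongrightarrow> y * 1"
          proof (rule Lim_transform_eventually)
            show "\<forall>\<^sub>F j in sequentially. real (m j) / real (l j) * (real (l j) / (real (l j) - 1)) = real (m j) / real (l j - 1)"
              using eventually_l_ge[of 2] by eventually_elim (auto simp: of_nat_diff)
          qed
          then have m': "(\<lambda>j. real (m j) / real (l j - 1)) \<longlonglongrightarrow> y" by simp
          have "I' \<subset> I" using k by (auto simp: I'_def)
          from psubset.IH[OF this shift m'] y show ?thesis by (simp add: \<rho>_def d_def I'_def)
        qed
        obtain J where J: "\<forall>\<^sub>F j in sequentially. \<forall>n>J. \<theta> / 2 \<le> real n * v j n * real (l j) \<and> real n * v j n * real (l j) \<le> 2 * \<theta>"
          using cutoff by blast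
        \<comment> \<open>The first term bounds occupations above \<open>J\<close>; the second
          bounds those up to \<open>J\<close> by means of \<open>v j n \<le> 2\<close> and of
          \<open>l j / N j < 2 / Y\<close>.\<close>
        define C where "C = 2 * \<theta> + real J * 2 * (real J * (2 / Y))"
        have v_le: "\<forall>\<^sub>F j in sequentially. \<forall>n. v j n \<le> 2"
        proof -
          have "\<forall>\<^sub>F j in sequentially. \<forall>n\<in>UNIV. dist (v j n) (w n) < 1"
            using v_lim by (rule uniform_limitD) simp
          then show ?thesis
          proof eventually_elim
            case (elim j)
            have "w n \<le> 1" for n
            proof -
              have "sum w {n} \<le> suminf w" using w_sums w_nonneg by (intro sum_le_suminf) (auto simp: sums_iff)
              then show ?thesis using w_sums by (simp add: sums_iff)
            qed
            then show ?case using elim by (smt (verit) UNIV_I dist_real_def)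
          qed
        qed
        have "1 / Y < 2 / Y" using Y0 by (simp add: divide_strict_right_mono)
        moreover have "(\<lambda>j. 1 / (real (N j) / real (l j))) \<longlonglongrightarrow> 1 / Y" using Y0 by (intro tendsto_intros N) auto
        ultimately have "\<forall>\<^sub>F j in sequentially. 1 / (real (N j) / real (l j)) < 2 / Y"
          using order_tendstoD(2) by blast
        with J v_le have bound: "\<forall>\<^sub>F j in sequentially. \<forall>m\<le>N j. \<bar>\<phi> B j m\<bar> \<le> C"
          using v_nonneg ZN eventually_l_ge[of 1]
        proof eventually_elim
          case (elim j)
          show ?case
          proof (intro allI impI)
            fix m assume m: "m \<le> N j"
            define n where "n = N j - m"
            have N0: "0 < real (N j)" using elim(5) by simp
            have e: "0 \<le> normalised_moment a (v j) (l j - 1) m (I - {k} - B)"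
              "normalised_moment a (v j) (l j - 1) m (I - {k} - B) \<le> 1"
              using elim(4) a1 by (auto intro!: normalised_moment_bounds(1,2))
            have mN: "0 \<le> (real m / real (N j)) ^ d B" "(real m / real (N j)) ^ d B \<le> 1"
              using m N0 by (auto intro!: power_le_one)
            have nN: "0 \<le> real n / real (N j)" "real n / real (N j) \<le> 1" using N0 by (auto simp: n_def)
            define x where "x = real n * v j n * real (l j)"
            define q where "q = real n / real (N j)"
            have x: "0 \<le> x" using elim(4) by (simp add: x_def)
            have q: "0 \<le> q" "q \<le> 1" using nN by (simp_all add: q_def)
            have main: "x * q ^ b B \<le> C"
            proof (cases "J < n")
              case True
              then have "x \<le> 2 * \<theta>" using elim(1) by (simp add: x_def)
              moreover have "q ^ b B \<le> 1" using q by (rule power_le_one)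
              ultimately have "x * q ^ b B \<le> (2 * \<theta>) * 1" using x q \<theta> by (intro mult_mono) auto
              also have "\<dots> \<le> C" using Y0 by (simp add: C_def)
              finally show ?thesis .
            next
              case False
              have "q ^ b B \<le> q ^ 1" using q b1 by (intro power_decreasing) auto
              then have "x * q ^ b B \<le> x * q" using x by (intro mult_left_mono) auto
              also have "\<dots> = (real n * v j n) * (real n * (1 / (real (N j) / real (l j))))"
                by (simp add: x_def q_def)
              also have "\<dots> \<le> (real J * 2) * (real J * (2 / Y))"
              proof (rule mult_mono)
                show "real n * v j n \<le> real J * 2" using False elim(2,4) by (intro mult_mono) auto
                show "real n * (1 / (real (N j) / real (l j))) \<le> real J * (2 / Y)"
                  using False elim(3) by (intro mult_mono) auto
              qed (use elim(4) in auto)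
              also have "\<dots> \<le> C" using \<theta> by (simp add: C_def)
              finally show ?thesis .
            qed
            have "0 \<le> x * q ^ b B" using x q by simp
            then have "x * q ^ b B * (real m / real (N j)) ^ d B * normalised_moment a (v j) (l j - 1) m (I - {k} - B)
                \<le> C * 1 * 1"
              using main e mN by (intro mult_mono) auto
            then have "\<phi> B j m \<le> C" by (simp add: \<phi>_def n_def[symmetric] x_def q_def)
            moreover have "0 \<le> \<phi> B j m"
              unfolding \<phi>_def n_def[symmetric] x_def[symmetric] q_def[symmetric]
              using e mN x q by (intro mult_nonneg_nonneg) auto
            ultimately show "\<bar>\<phi> B j m\<bar> \<le> C" by simp
          qed
        qed
        have "(\<lambda>j. \<Sum>m\<le>N j. Z (v j) (l j - 1) m / A j * \<phi> B j m) \<longlonglongrightarrow>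
            (LINT u|beta_distribution 1 \<theta>. g (\<rho> + (Y - \<rho>) * (1 - u)))"
        proof (rule weighted_sum_limit[OF \<theta> \<rho> l_real N _ _ bound])
          show "\<forall>\<^sub>F j in sequentially. (\<forall>m. 0 \<le> Z (v j) (l j - 1) m / A j) \<and> (\<Sum>m\<le>N j. Z (v j) (l j - 1) m / A j) = 1"
            using A_pos v_nonneg
          proof eventually_elim
            case (elim j)
            have "(\<Sum>m\<le>N j. Z (v j) (l j - 1) m / A j) = A j / A j"
              unfolding sum_divide_distrib[symmetric] by (simp add: A_def cumulative_Z_def)
            then show ?case using elim by (auto intro!: divide_nonneg_pos Z_nonneg)
          qed
        next
          fix m y assume y: "\<rho> < y" "y < Y" and m: "(\<lambda>j. real (m j) / real (l j)) \<longlonglongrightarrow> y"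
          have "\<forall>\<^sub>F j in sequentially. real (m j) / real (l j) < real (N j) / real (l j)"
            by (rule eventually_less_of_tendsto[OF m y(2) N])
          then have "\<forall>\<^sub>F j in sequentially. m j \<le> N j"
            using eventually_l_ge[of 1] by eventually_elim (auto simp: divide_less_cancel)
          from cumulative_Z_ratio_limit[OF m N y(1)[unfolded \<rho>_def] Y this]
          show "(\<lambda>j. \<Sum>i\<le>m j. Z (v j) (l j - 1) i / A j) \<longlonglongrightarrow> ((y - \<rho>) / (Y - \<rho>)) powr \<theta>"
            unfolding sum_divide_distrib[symmetric] by (simp add: A_def cumulative_Z_def \<rho>_def)
        next
          fix m y assume y: "\<rho> < y" "y < Y" and m: "(\<lambda>j. real (m j) / real (l j)) \<longlonglongrightarrow> y"
            and mN: "\<And>j. m j \<le> N j"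
          have ratio: "(\<lambda>j. real (m j) / real (N j)) \<longlonglongrightarrow> y / Y"
          proof -
            have "(\<lambda>j. (real (m j) / real (l j)) / (real (N j) / real (l j))) \<longlonglongrightarrow> y / Y"
              using Y0 by (intro tendsto_intros m N) auto
            then show ?thesis
            proof (rule Lim_transform_eventually)
              show "\<forall>\<^sub>F j in sequentially. (real (m j) / real (l j)) / (real (N j) / real (l j)) = real (m j) / real (N j)"
                using eventually_l_ge[of 1] by eventually_elim auto
            qed
          qed
          have ratio': "(\<lambda>j. real (N j - m j) / real (N j)) \<longlonglongrightarrow> (Y - y) / Y"
          proof -
            have "(\<lambda>j. 1 - real (m j) / real (N j)) \<longlonglongrightarrow> 1 - y / Y" by (intro tendsto_intros ratio)
            also have "1 - y / Y = (Y - y) / Y" using Y0 by (simp add: field_simps)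
            finally show ?thesis
            proof (rule Lim_transform_eventually)
              show "\<forall>\<^sub>F j in sequentially. 1 - real (m j) / real (N j) = real (N j - m j) / real (N j)"
                using ZN by eventually_elim (use mN in \<open>auto simp: of_nat_diff field_simps\<close>)
            qed
          qed
          \<comment> \<open>Since \<open>y < Y\<close>, the marked cluster is macroscopic, which
            puts its weight into the range where the tail condition applies.\<close>
          have n_lim: "filterlim (\<lambda>j. real (N j - m j)) at_top sequentially"
          proof -
            have "filterlim (\<lambda>j. real (N j - m j) / real (N j) * real (N j)) at_top sequentially"
              by (rule filterlim_tendsto_pos_mult_at_top[OF ratio' _ N_lim]) (use y Y0 in auto)
            then show ?thesis
            proof (rule filterlim_cong[OF refl refl, THEN iffD1, rotated])
              show "\<forall>\<^sub>F j in sequentially. real (N j - m j) / real (N j) * real (N j) = real (N j - m j)"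
                using ZN by eventually_elim simp
            qed
          qed
          have \<theta>_lim: "(\<lambda>j. real (N j - m j) * v j (N j - m j) * real (l j)) \<longlonglongrightarrow> \<theta>"
          proof (rule tendstoI)
            fix e :: real assume "0 < e"
            then have "0 < e / 2" by simp
            from tail[OF this] obtain J where J: "\<forall>\<^sub>F j in sequentially. \<forall>n>J. \<bar>real n * v j n * real (l j) - \<theta>\<bar> \<le> e / 2" ..
            have "\<forall>\<^sub>F j in sequentially. real J < real (N j - m j)"
              using n_lim unfolding filterlim_at_top_dense by blast
            with J show "\<forall>\<^sub>F j in sequentially. dist (real (N j - m j) * v j (N j - m j) * real (l j)) \<theta> < e"
            proof eventually_elim
              case (elim j)
              then have "\<bar>real (N j - m j) * v j (N j - m j) * real (l j) - \<theta>\<bar> \<le> e / 2" by auto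
              then show ?case using \<open>0 < e\<close> by (simp add: dist_real_def)
            qed
          qed
          have "(\<lambda>j. \<phi> B j (m j)) \<longlonglongrightarrow> \<theta> * ((Y - y) / Y) ^ b B * (y / Y) ^ d B * ((1 - \<rho> / y) ^ d B * c I')"
            unfolding \<phi>_def I'_def
            by (intro tendsto_mult tendsto_power \<theta>_lim ratio ratio' IH[OF y(1) m, unfolded I'_def])
          also have "\<theta> * ((Y - y) / Y) ^ b B * (y / Y) ^ d B * ((1 - \<rho> / y) ^ d B * c I') = g y"
          proof -
            have "(y - \<rho>) / Y = y / Y * (1 - \<rho> / y)" using y \<rho> by (simp add: field_simps)
            then have "((y - \<rho>) / Y) ^ d B = (y / Y) ^ d B * (1 - \<rho> / y) ^ d B"
              by (simp only: power_mult_distrib)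
            then show ?thesis unfolding g_def by (simp only: mult.assoc)
          qed
          finally show "(\<lambda>j. \<phi> B j (m j)) \<longlonglongrightarrow> g y" .
        next
          show "g \<in> borel_measurable borel" unfolding g_def by measurable
        qed
        \<comment> \<open>At density \<open>\<rho> + (Y - \<rho>) * (1 - u)\<close> the marked
          cluster has relative size \<open>\<alpha> * u\<close> and the remaining surplus is
          \<open>\<alpha> * (1 - u)\<close>.\<close>
        also have "(LINT u|beta_distribution 1 \<theta>. g (\<rho> + (Y - \<rho>) * (1 - u))) =
            (LINT u|beta_distribution 1 \<theta>. (\<theta> * \<alpha> ^ (b B + d B) * c I') * (u ^ b B * (1 - u) ^ d B))"
        proof -
          have "g (\<rho> + (Y - \<rho>) * (1 - u)) = (\<theta> * \<alpha> ^ (b B + d B) * c I') * (u ^ b B * (1 - u) ^ d B)" for u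
          proof -
            have "(Y - (\<rho> + (Y - \<rho>) * (1 - u))) / Y = \<alpha> * u" "(\<rho> + (Y - \<rho>) * (1 - u) - \<rho>) / Y = \<alpha> * (1 - u)"
              using Y0 by (auto simp: \<alpha>_def field_simps)
            then show ?thesis unfolding g_def by (simp add: power_mult_distrib power_add mult_ac)
          qed
          then show ?thesis by simp
        qed
        also have "\<dots> = \<theta> * \<alpha> ^ (b B + d B) * beta_moment \<theta> (b B) (d B) * c (I - {k} - B)"
          by (simp add: integral_beta_distribution[OF \<theta>] I'_def)
        finally show ?thesis .
      qed
      have "(\<lambda>j. \<Sum>B\<in>Pow (I - {k}). A j / (real (N j) * Z (v j) (l j) (N j)) *
          (\<Sum>m\<le>N j. Z (v j) (l j - 1) m / A j * \<phi> B j m)) \<longlonglongrightarrow>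
          (\<Sum>B\<in>Pow (I - {k}). \<alpha> / \<theta> * (\<theta> * \<alpha> ^ (b B + d B) * beta_moment \<theta> (b B) (d B) * c (I - {k} - B)))"
        by (intro tendsto_sum tendsto_mult A_norm summand)
      also have "(\<Sum>B\<in>Pow (I - {k}). \<alpha> / \<theta> * (\<theta> * \<alpha> ^ (b B + d B) * beta_moment \<theta> (b B) (d B) * c (I - {k} - B))) = \<alpha> ^ s * R k"
        unfolding R_def sum_distrib_left
      proof (intro sum.cong refl)
        fix B assume B: "B \<in> Pow (I - {k})"
        have fB: "finite B" "k \<notin> B" using B \<open>finite I\<close> finite_subset by auto
        have "I = insert k B \<union> (I - {k} - B)" using k B by auto
        then have "s = (\<Sum>i\<in>insert k B. a i) + (\<Sum>i\<in>I - {k} - B. a i)"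
          unfolding s_def using \<open>finite I\<close> fB
          by (metis Diff_disjoint Diff_insert Diff_insert2 finite_Diff finite_insert sum.union_disjoint)
        moreover have "(\<Sum>i\<in>insert k B. a i) = Suc (b B)" using a[of k] fB by (simp add: b_def)
        ultimately have s: "s = Suc (b B + d B)" by (simp add: d_def)
        show "\<alpha> / \<theta> * (\<theta> * \<alpha> ^ (b B + d B) * beta_moment \<theta> (b B) (d B) * c (I - {k} - B)) =
          \<alpha> ^ s * (beta_moment \<theta> ((\<Sum>i\<in>insert k B. a i) - 1) (\<Sum>i\<in>I - {k} - B. a i) * c (I - {k} - B))"
          unfolding s using \<theta> by (simp add: b_def d_def)
      qed
      finally show ?thesis
      proof (rule Lim_transform_eventually)
        show "\<forall>\<^sub>F j in sequentially. (\<Sum>B\<in>Pow (I - {k}). A j / (real (N j) * Z (v j) (l j) (N j)) *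
          (\<Sum>m\<le>N j. Z (v j) (l j - 1) m / A j * \<phi> B j m)) = normalised_moment a (v j) (l j) (N j) I"
          using A_pos ZN v_nonneg eventually_l_ge[of 1]
        proof eventually_elim
          case (elim j)
          show ?case unfolding \<phi>_def b_def d_def
            by (rule normalised_moment_rec[symmetric, OF \<open>finite I\<close> k])
               (use elim a1 in auto)
        qed
      qed
    qed
    \<comment> \<open>Every choice of \<open>k\<close> gives a limit of the same sequence; weighting
      with \<open>a k\<close> matches the hypothesis \<open>c_rec\<close>.\<close>
    have "(\<lambda>j. \<Sum>k\<in>I. real (a k) * normalised_moment a (v j) (l j) (N j) I) \<longlonglongrightarrow> (\<Sum>k\<in>I. real (a k) * (\<alpha> ^ s * R k))"
      by (intro tendsto_sum tendsto_mult tendsto_const lim)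
    also have "(\<Sum>k\<in>I. real (a k) * (\<alpha> ^ s * R k)) = \<alpha> ^ s * (\<Sum>k\<in>I. real (a k) * R k)"
      by (simp add: sum_distrib_left mult_ac)
    also have "(\<Sum>k\<in>I. real (a k) * R k) = real s * c I"
      using c_rec[OF \<open>finite I\<close> False] by (simp add: R_def s_def)
    finally have "(\<lambda>j. real s * normalised_moment a (v j) (l j) (N j) I) \<longlonglongrightarrow> \<alpha> ^ s * (real s * c I)"
      by (simp add: s_def sum_distrib_right[symmetric])
    then have "(\<lambda>j. real s * normalised_moment a (v j) (l j) (N j) I / real s) \<longlonglongrightarrow> \<alpha> ^ s * (real s * c I) / real s"
      using s_pos by (intro tendsto_divide tendsto_const) auto
    then have "(\<lambda>j. normalised_moment a (v j) (l j) (N j) I) \<longlonglongrightarrow> \<alpha> ^ s * c I" using s_pos by simp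
    then show ?thesis by (simp add: \<alpha>_def \<rho>_def s_def)
  qed
qed


section \<open>Moments of the Poisson-Dirichlet distribution\<close>

definition unit_sequence :: "(nat \<Rightarrow> real) \<Rightarrow> bool" where
  "unit_sequence u \<longleftrightarrow> (\<forall>i. 0 < u i \<and> u i < 1)"

definition partition_sum :: "nat \<Rightarrow> (nat \<Rightarrow> real) \<Rightarrow> real" where
  "partition_sum a p = (\<Sum>i. p i ^ a)"

lemma stick_breaking_pos:
  assumes "unit_sequence u"
  shows "0 < stick_breaking u k"
  using assms by (auto simp: stick_breaking_def unit_sequence_def intro!: mult_pos_pos prod_pos)

text \<open>The product is the length of the stick left after \<open>n\<close> breaks.\<close>

lemma sum_stick_breaking: "(\<Sum>k<n. stick_breaking u k) = 1 - (\<Prod>j<n. 1 - u j)"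
  by (induction n) (auto simp: stick_breaking_def algebra_simps)

lemma sum_stick_breaking_le:
  assumes "unit_sequence u"
  shows "(\<Sum>k<n. stick_breaking u k) \<le> 1"
  unfolding sum_stick_breaking
  using assms by (auto simp: unit_sequence_def less_imp_le intro!: prod_nonneg)

lemma summable_stick_breaking:
  assumes "unit_sequence u"
  shows "summable (stick_breaking u)"
  by (rule summableI_nonneg_bounded[of _ 1])
     (use assms stick_breaking_pos sum_stick_breaking_le in \<open>auto intro: less_imp_le\<close>)

lemma stick_breaking_le_1:
  assumes "unit_sequence u"
  shows "stick_breaking u k \<le> 1"
proof -
  have "stick_breaking u k \<le> (\<Sum>i<Suc k. stick_breaking u i)"
    by (rule member_le_sum) (use assms stick_breaking_pos in \<open>auto intro: less_imp_le\<close>)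
  also have "\<dots> \<le> 1" by (rule sum_stick_breaking_le[OF assms])
  finally show ?thesis .
qed

lemma power_le_self:
  fixes x :: real
  assumes "0 \<le> x" "x \<le> 1" "1 \<le> a"
  shows "x ^ a \<le> x"
  using power_decreasing[of 1 a x] assms by simp

lemma partition_sum_bounds:
  assumes p: "\<And>i. 0 \<le> p i" "\<And>i. p i \<le> 1" "summable p" "suminf p \<le> 1" and a: "1 \<le> a"
  shows "summable (\<lambda>i. p i ^ a)" "0 \<le> partition_sum a p" "partition_sum a p \<le> 1"
proof -
  show s: "summable (\<lambda>i. p i ^ a)"
    by (rule summable_comparison_test'[OF p(3), of 0]) (use p a in \<open>auto intro: power_le_self\<close>)
  show "0 \<le> partition_sum a p" unfolding partition_sum_def by (rule suminf_nonneg[OF s]) (use p in auto)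
  have "partition_sum a p \<le> suminf p"
    unfolding partition_sum_def by (rule suminf_le[OF _ s p(3)]) (use p a in \<open>auto intro: power_le_self\<close>)
  then show "partition_sum a p \<le> 1" using p by simp
qed

lemma partition_sum_stick_breaking_bounds:
  assumes u: "unit_sequence u" and a: "1 \<le> a"
  shows "summable (\<lambda>i. stick_breaking u i ^ a)"
    "0 \<le> partition_sum a (stick_breaking u)" "partition_sum a (stick_breaking u) \<le> 1"
proof -
  have "suminf (stick_breaking u) \<le> 1"
    using suminf_le_const[OF summable_stick_breaking[OF u] sum_stick_breaking_le[OF u]] .
  note * = partition_sum_bounds[of "stick_breaking u", OF less_imp_le[OF stick_breaking_pos[OF u]]
      stick_breaking_le_1[OF u] summable_stick_breaking[OF u] this a]
  show "summable (\<lambda>i. stick_breaking u i ^ a)" "0 \<le> partition_sum a (stick_breaking u)"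
    "partition_sum a (stick_breaking u) \<le> 1" by (fact *)+
qed

lemma stick_breaking_case_nat:
  "stick_breaking (case_nat s u) 0 = s"
  "stick_breaking (case_nat s u) (Suc k) = (1 - s) * stick_breaking u k"
  by (simp_all add: stick_breaking_def prod.lessThan_Suc_shift del: prod.lessThan_Suc)

text \<open>Self-similarity of stick-breaking: after the first piece \<open>s\<close>, the rest is a
  stick-breaking sequence scaled by \<open>1 - s\<close>.\<close>

lemma partition_sum_case_nat:
  assumes u: "unit_sequence u" and a: "1 \<le> a"
  shows "partition_sum a (stick_breaking (case_nat s u)) = s ^ a + (1 - s) ^ a * partition_sum a (stick_breaking u)"
proof -
  have sm: "summable (\<lambda>i. stick_breaking u i ^ a)" by (rule partition_sum_stick_breaking_bounds(1)[OF u a])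
  have eq: "(\<lambda>k. stick_breaking (case_nat s u) (Suc k) ^ a) = (\<lambda>k. (1 - s) ^ a * stick_breaking u k ^ a)"
    by (simp add: stick_breaking_case_nat power_mult_distrib)
  have sm': "summable (\<lambda>k. stick_breaking (case_nat s u) (Suc k) ^ a)"
    unfolding eq by (rule summable_mult[OF sm])
  then have "summable (\<lambda>k. stick_breaking (case_nat s u) k ^ a)" by (subst (asm) summable_Suc_iff)
  from suminf_split_head[OF this] show ?thesis
    unfolding partition_sum_def eq by (simp add: suminf_mult[OF sm] stick_breaking_case_nat)
qed

text \<open>Sorting is a reindexing by the inverse of \<open>sort_rank\<close>, and a series of
  nonnegative terms does not depend on the order.\<close>

lemma decreasing_stick_breaking:
  assumes u: "unit_sequence u"
  shows "decreasing (stick_breaking u) \<in> mass_partitions"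
    "1 \<le> a \<Longrightarrow> partition_sum a (decreasing (stick_breaking u)) = partition_sum a (stick_breaking u)"
proof -
  define v where "v = stick_breaking u"
  have v: "\<And>i. 0 < v i" "summable v" "\<And>i. v i \<le> 1" "suminf v \<le> 1"
    using stick_breaking_pos[OF u] summable_stick_breaking[OF u] stick_breaking_le_1[OF u]
      suminf_le_const[OF summable_stick_breaking[OF u] sum_stick_breaking_le[OF u]]
    by (auto simp: v_def)
  have lim: "v \<longlonglongrightarrow> 0" by (rule summable_LIMSEQ_zero[OF v(2)])
  note bij = decreasing_bij[OF v(1) lim]
  define g where "g = inv (sort_rank v)"
  have g: "bij g" unfolding g_def by (rule bij_imp_bij_inv[OF bij(1)])
  have eq: "decreasing v = v \<circ> g"
  proof
    fix k
    have "sort_rank v (g k) = k" unfolding g_def using bij(1) by (simp add: bij_is_surj surj_f_inv_f)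
    then show "decreasing v k = (v \<circ> g) k" using fun_cong[OF bij(2), of "g k"] by simp
  qed
  have sums: "summable (\<lambda>k. decreasing v k ^ b) \<and> (\<Sum>k. decreasing v k ^ b) = (\<Sum>k. v k ^ b)" if b: "1 \<le> b" for b
  proof -
    have s: "summable (\<lambda>k. v k ^ b)"
      unfolding v_def by (rule partition_sum_stick_breaking_bounds(1)[OF u b])
    have "summable ((\<lambda>k. v k ^ b) \<circ> g)"
      using s bij_is_inj[OF g] by (rule summable_reindex) (use v(1) in \<open>auto intro: less_imp_le\<close>)
    moreover have "suminf ((\<lambda>k. v k ^ b) \<circ> g) = (\<Sum>k. v k ^ b)"
      by (rule suminf_reindex[OF s bij_is_inj[OF g]])
         (use v(1) bij_is_surj[OF g] in \<open>auto intro: less_imp_le\<close>)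
    ultimately show ?thesis by (simp add: eq o_def)
  qed
  show "partition_sum a (decreasing (stick_breaking u)) = partition_sum a (stick_breaking u)" if "1 \<le> a"
    using sums[OF that] by (simp add: partition_sum_def v_def)
  show "decreasing (stick_breaking u) \<in> mass_partitions"
    using sums[of 1] v bij(3) unfolding v_def[symmetric] mass_partitions_def
    by (auto simp: eq less_imp_le o_def)
qed

section \<open>Measurability of the sorted stick-breaking sequence\<close>

lemma stick_breaking_measurable [measurable]:
  "(\<lambda>u. stick_breaking u k) \<in> borel_measurable (Pi\<^sub>M UNIV (\<lambda>_. borel))"
  unfolding stick_breaking_def by measurable

lemma partition_sum_measurable [measurable]:
  "(\<lambda>u. partition_sum a (stick_breaking u)) \<in> borel_measurable (Pi\<^sub>M UNIV (\<lambda>_. borel))"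
  unfolding partition_sum_def by measurable

lemma sort_rank_measurable [measurable]:
  "(\<lambda>u. sort_rank (stick_breaking u) i) \<in> Pi\<^sub>M UNIV (\<lambda>_. borel) \<rightarrow>\<^sub>M count_space UNIV"
  unfolding sort_rank_def
proof (rule measurable_card)
  fix j
  let ?M = "Pi\<^sub>M UNIV (\<lambda>_. borel) :: (nat \<Rightarrow> real) measure"
  have "{u \<in> space ?M. stick_breaking u i < stick_breaking u j} \<in> sets ?M" by measurable
  moreover have "{u \<in> space ?M. stick_breaking u j = stick_breaking u i} \<in> sets ?M" by measurable
  ultimately have "{u \<in> space ?M. stick_breaking u i < stick_breaking u j} \<union>
      (if j < i then {u \<in> space ?M. stick_breaking u j = stick_breaking u i} else {}) \<in> sets ?M" by auto
  also have "{u \<in> space ?M. stick_breaking u i < stick_breaking u j} \<union>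
      (if j < i then {u \<in> space ?M. stick_breaking u j = stick_breaking u i} else {}) =
      {u \<in> space ?M. j \<in> {j. stick_breaking u i < stick_breaking u j \<or> stick_breaking u j = stick_breaking u i \<and> j < i}}"
    by auto
  finally show "{u \<in> space ?M. j \<in> {j. stick_breaking u i < stick_breaking u j \<or>
      stick_breaking u j = stick_breaking u i \<and> j < i}} \<in> sets ?M" .
qed

lemma decreasing_stick_breaking_measurable:
  "(\<lambda>u. decreasing (stick_breaking u)) \<in> borel_measurable (Pi\<^sub>M UNIV (\<lambda>_. borel))"
proof (rule measurable_coordinatewise_then_product)
  fix k
  \<comment> \<open>The index holding rank \<open>k\<close> is a measurable function with countable
    range, so evaluating the sequence at this random index stays measurable.\<close>
  have least: "(\<lambda>u. LEAST i. sort_rank (stick_breaking u) i = k) \<in> Pi\<^sub>M UNIV (\<lambda>_. borel) \<rightarrow>\<^sub>M count_space UNIV"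
    by (rule measurable_Least) measurable
  show "(\<lambda>u. decreasing (stick_breaking u) k) \<in> borel_measurable (Pi\<^sub>M UNIV (\<lambda>_. borel))"
    unfolding decreasing_def
    by (rule measurable_compose_countable[OF stick_breaking_measurable least])
qed

section \<open>The stick-breaking law and the recursion of its moments\<close>

context
  fixes \<theta> :: real
  assumes \<theta>: "0 < \<theta>"
begin

abbreviation "sticks \<equiv> Pi\<^sub>M (UNIV :: nat set) (\<lambda>_. beta_distribution 1 \<theta>)"

lemma prob_space_sticks: "prob_space sticks"
  by (intro prob_space_PiM prob_space_beta_distribution \<theta>)

lemma AE_unit_sequence: "AE u in sticks. unit_sequence u"
  unfolding unit_sequence_def AE_all_countable
  by (intro allI AE_PiM_component[where P = "\<lambda>x. 0 < x \<and> x < 1"] prob_space_beta_distribution \<theta>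
      AE_beta_distribution UNIV_I)

lemma sets_sticks: "sets sticks = sets (Pi\<^sub>M UNIV (\<lambda>_. borel))"
  by (rule sets_PiM_cong) auto

lemma decreasing_measurable: "(\<lambda>u. decreasing (stick_breaking u)) \<in> borel_measurable sticks"
  using decreasing_stick_breaking_measurable by (simp only: measurable_cong_sets[OF sets_sticks refl])

text \<open>Moments under the GEM law, that is, before sorting. Power sums ignore the order, so
  these are also the moments of the Poisson-Dirichlet law.\<close>

definition gem_moment :: "(nat \<Rightarrow> nat) \<Rightarrow> nat set \<Rightarrow> real" where
  "gem_moment a I = (LINT u|sticks. (\<Prod>i\<in>I. partition_sum (a i) (stick_breaking u)))"

lemma integrable_partition_sums:
  assumes "\<And>i. 1 \<le> a i"
  shows "integrable sticks (\<lambda>u. \<Prod>i\<in>I. partition_sum (a i) (stick_breaking u))"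
proof -
  interpret prob_space sticks by (rule prob_space_sticks)
  show ?thesis
  proof (rule integrable_const_bound[of _ 1])
    show "AE u in sticks. norm (\<Prod>i\<in>I. partition_sum (a i) (stick_breaking u)) \<le> 1"
      using AE_unit_sequence
    proof eventually_elim
      case (elim u)
      have "(\<Prod>i\<in>I. partition_sum (a i) (stick_breaking u)) \<le> 1"
        by (intro prod_le_1) (use partition_sum_stick_breaking_bounds[OF elim] assms in auto)
      moreover have "0 \<le> (\<Prod>i\<in>I. partition_sum (a i) (stick_breaking u))"
        by (intro prod_nonneg) (use partition_sum_stick_breaking_bounds[OF elim] assms in auto)
      ultimately show ?case by simp
    qed
  qed measurable
qed

text \<open>Splits off the first piece U, independent of the rest: each power sum becomes U^a + (1 -
  U)^a times the power sum of an independent copy. The set \<open>B\<close> consists of the factors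
  that take the first piece.\<close>

lemma gem_moment_split:
  assumes a: "\<And>i. 1 \<le> a i" and I: "finite I"
  shows "gem_moment a I =
    (\<Sum>B\<in>Pow I. beta_moment \<theta> (\<Sum>i\<in>B. a i) (\<Sum>i\<in>I - B. a i) * gem_moment a (I - B))"
proof -
  define \<beta> where "\<beta> = beta_distribution 1 \<theta>"
  interpret sequence_space \<beta>
    unfolding sequence_space_def \<beta>_def by (intro product_prob_spaceI prob_space_beta_distribution \<theta>)
  have S: "S = sticks" by (simp add: \<beta>_def)
  interpret \<beta>: prob_space \<beta> unfolding \<beta>_def by (rule prob_space_beta_distribution[OF \<theta>])
  interpret S: prob_space sticks by (rule prob_space_sticks)
  interpret pair_sigma_finite \<beta> sticks ..
  define Q where "Q i u = partition_sum (a i) (stick_breaking u)" for i u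
  have Q_meas [measurable]: "Q i \<in> borel_measurable sticks" for i unfolding Q_def by measurable
  \<comment> \<open>Prepending an independent beta variable to the sequence reproduces its
    law.\<close>
  have iter: "distr (\<beta> \<Otimes>\<^sub>M sticks) sticks (\<lambda>(s, u). case_nat s u) = sticks"
    using PiM_iter by (simp add: S[symmetric])
  have [measurable]: "(\<lambda>(s, u). case_nat s u) \<in> \<beta> \<Otimes>\<^sub>M sticks \<rightarrow>\<^sub>M sticks"
    unfolding S[symmetric] by measurable
  have AE_pair: "AE z in \<beta> \<Otimes>\<^sub>M sticks. unit_sequence (snd z)"
  proof -
    have "AE u in distr (\<beta> \<Otimes>\<^sub>M sticks) sticks (\<lambda>(s, u). case_nat s u). unit_sequence u"
      unfolding iter by (rule AE_unit_sequence)
    then have "AE z in \<beta> \<Otimes>\<^sub>M sticks. unit_sequence ((\<lambda>(s, u). case_nat s u) z)"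
      by (rule AE_distrD[rotated]) measurable
    then show ?thesis
    proof eventually_elim
      case (elim z)
      show ?case unfolding unit_sequence_def
      proof
        fix i show "0 < snd z i \<and> snd z i < 1"
          using elim[unfolded unit_sequence_def, rule_format, of "Suc i"] by (simp add: case_prod_beta)
      qed
    qed
  qed
  have prod: "integrable (\<beta> \<Otimes>\<^sub>M sticks) (\<lambda>z. g (fst z) * h (snd z)) \<and>
      (LINT z|(\<beta> \<Otimes>\<^sub>M sticks). g (fst z) * h (snd z)) = integral\<^sup>L \<beta> g * integral\<^sup>L sticks h"
    if g: "integrable \<beta> g" and h: "integrable sticks h" for g h :: "_ \<Rightarrow> real"
  proof -
    have [measurable]: "g \<in> borel_measurable \<beta>" "h \<in> borel_measurable sticks" using g h by auto
    have int: "integrable (\<beta> \<Otimes>\<^sub>M sticks) (\<lambda>z. g (fst z) * h (snd z))"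
    proof (rule Fubini_integrable)
      show "integrable \<beta> (\<lambda>x. LINT y|sticks. norm (g (fst (x, y)) * h (snd (x, y))))"
        using g by (simp add: abs_mult)
    qed (use h in auto)
    moreover have "(LINT z|(\<beta> \<Otimes>\<^sub>M sticks). g (fst z) * h (snd z)) = (LINT x|\<beta>. LINT y|sticks. g x * h y)"
      using integral_fst'[OF int] by simp
    ultimately show ?thesis by simp
  qed
  have "gem_moment a I = (LINT u|(distr (\<beta> \<Otimes>\<^sub>M sticks) sticks (\<lambda>(s, u). case_nat s u)). (\<Prod>i\<in>I. Q i u))"
    unfolding iter by (simp add: gem_moment_def Q_def)
  also have "\<dots> = (LINT z|(\<beta> \<Otimes>\<^sub>M sticks). (\<Prod>i\<in>I. Q i (case_nat (fst z) (snd z))))"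
    by (subst integral_distr) (auto simp: case_prod_beta)
  also have "\<dots> = (LINT z|(\<beta> \<Otimes>\<^sub>M sticks). (\<Sum>B\<in>Pow I.
      (fst z ^ (\<Sum>i\<in>B. a i) * (1 - fst z) ^ (\<Sum>i\<in>I - B. a i)) * (\<Prod>i\<in>I - B. Q i (snd z))))"
  proof (rule integral_cong_AE)
    show "AE z in \<beta> \<Otimes>\<^sub>M sticks. (\<Prod>i\<in>I. Q i (case_nat (fst z) (snd z))) = (\<Sum>B\<in>Pow I.
      (fst z ^ (\<Sum>i\<in>B. a i) * (1 - fst z) ^ (\<Sum>i\<in>I - B. a i)) * (\<Prod>i\<in>I - B. Q i (snd z)))"
      using AE_pair
    proof eventually_elim
      case (elim z)
      have "(\<Prod>i\<in>I. Q i (case_nat (fst z) (snd z))) = (\<Prod>i\<in>I. fst z ^ a i + (1 - fst z) ^ a i * Q i (snd z))"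
        unfolding Q_def by (intro prod.cong refl partition_sum_case_nat elim a)
      also have "\<dots> = (\<Sum>B\<in>Pow I. (\<Prod>i\<in>B. fst z ^ a i) * (\<Prod>i\<in>I - B. (1 - fst z) ^ a i * Q i (snd z)))"
        by (rule prod_add[OF I])
      finally show ?case by (simp add: prod.distrib power_sum mult.assoc)
    qed
    have "(\<lambda>z. \<Prod>i\<in>I. Q i ((\<lambda>(s, u). case_nat s u) z)) \<in> borel_measurable (\<beta> \<Otimes>\<^sub>M sticks)"
      by measurable
    then show "(\<lambda>z. \<Prod>i\<in>I. Q i (case_nat (fst z) (snd z))) \<in> borel_measurable (\<beta> \<Otimes>\<^sub>M sticks)"
      by (simp add: case_prod_beta)
    have [measurable]: "fst \<in> borel_measurable (\<beta> \<Otimes>\<^sub>M sticks)"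
      using measurable_fst[of \<beta> sticks] by (simp add: \<beta>_def)
    show "(\<lambda>z. \<Sum>B\<in>Pow I. (fst z ^ (\<Sum>i\<in>B. a i) * (1 - fst z) ^ (\<Sum>i\<in>I - B. a i)) * (\<Prod>i\<in>I - B. Q i (snd z)))
        \<in> borel_measurable (\<beta> \<Otimes>\<^sub>M sticks)" by measurable
  qed
  also have "\<dots> = (\<Sum>B\<in>Pow I. LINT z|(\<beta> \<Otimes>\<^sub>M sticks). (fst z ^ (\<Sum>i\<in>B. a i) * (1 - fst z) ^ (\<Sum>i\<in>I - B. a i)) * (\<Prod>i\<in>I - B. Q i (snd z)))"
    by (rule Bochner_Integration.integral_sum, rule conjunct1, rule prod)
       (auto simp: \<beta>_def Q_def intro!: integral_beta_distribution(2)[OF \<theta>] integrable_partition_sums a)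
  also have "\<dots> = (\<Sum>B\<in>Pow I. beta_moment \<theta> (\<Sum>i\<in>B. a i) (\<Sum>i\<in>I - B. a i) * gem_moment a (I - B))"
  proof (rule sum.cong[OF refl])
    fix B
    have "(LINT z|(\<beta> \<Otimes>\<^sub>M sticks). (fst z ^ (\<Sum>i\<in>B. a i) * (1 - fst z) ^ (\<Sum>i\<in>I - B. a i)) * (\<Prod>i\<in>I - B. Q i (snd z))) =
      (LINT s|\<beta>. s ^ (\<Sum>i\<in>B. a i) * (1 - s) ^ (\<Sum>i\<in>I - B. a i)) * (LINT u|sticks. (\<Prod>i\<in>I - B. Q i u))"
      by (rule conjunct2, rule prod)
         (auto simp: \<beta>_def Q_def intro!: integral_beta_distribution(2)[OF \<theta>] integrable_partition_sums a)
    then show "(LINT z|(\<beta> \<Otimes>\<^sub>M sticks). (fst z ^ (\<Sum>i\<in>B. a i) * (1 - fst z) ^ (\<Sum>i\<in>I - B. a i)) * (\<Prod>i\<in>I - B. Q i (snd z))) =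
      beta_moment \<theta> (\<Sum>i\<in>B. a i) (\<Sum>i\<in>I - B. a i) * gem_moment a (I - B)"
      by (simp add: \<beta>_def integral_beta_distribution[OF \<theta>] gem_moment_def Q_def)
  qed
  finally show ?thesis .
qed

lemma gem_moment_empty: "gem_moment a {} = 1"
proof -
  interpret prob_space sticks by (rule prob_space_sticks)
  show ?thesis by (simp add: gem_moment_def prob_space)
qed

text \<open>Stick-breaking marks no index and allows \<open>B = {}\<close>, in which case
  \<open>gem_moment a I\<close> recurs on the right with coefficient \<open>\<theta>\<close> / (s +
  \<open>\<theta>\<close>). Moving that term to the left leaves the factor s / (s +
  \<open>\<theta>\<close>), and the functional equation of the beta function supplies s +
  \<open>\<theta>\<close>.\<close>

lemma gem_moment_rec:
  assumes a: "\<And>i. 1 \<le> a i" and I: "finite I" "I \<noteq> {}"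
  shows "real (\<Sum>i\<in>I. a i) * gem_moment a I = (\<Sum>k\<in>I. real (a k) * (\<Sum>B\<in>Pow (I - {k}).
     beta_moment \<theta> ((\<Sum>i\<in>insert k B. a i) - 1) (\<Sum>i\<in>I - {k} - B. a i) * gem_moment a (I - {k} - B)))"
proof -
  define s where "s = (\<Sum>i\<in>I. a i)"
  define A where "A B = (\<Sum>i\<in>B. a i)" for B
  define f where "f B = beta_moment \<theta> (A B - 1) (A (I - B)) * gem_moment a (I - B)" for B
  have s: "s = A B + A (I - B)" if "B \<subseteq> I" for B
    unfolding s_def A_def by (subst sum.subset_diff[OF that I(1)]) (rule add.commute)
  have "(\<Sum>k\<in>I. real (a k) * (\<Sum>B\<in>Pow (I - {k}).
     beta_moment \<theta> ((\<Sum>i\<in>insert k B. a i) - 1) (\<Sum>i\<in>I - {k} - B. a i) * gem_moment a (I - {k} - B))) =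
     (\<Sum>k\<in>I. \<Sum>B\<in>Pow (I - {k}). real (a k) * f (insert k B))"
    unfolding sum_distrib_left f_def A_def
    by (intro sum.cong refl) (simp only: Diff_insert2[of I, symmetric])
  \<comment> \<open>The index \<open>k\<close> is absorbed into \<open>B\<close>; exchanging the
    sums then collects the weight \<open>A B\<close> in front of each set.\<close>
  also have "\<dots> = (\<Sum>k\<in>I. \<Sum>B\<in>{B \<in> Pow I. k \<in> B}. real (a k) * f B)"
  proof (rule sum.cong[OF refl])
    fix k assume "k \<in> I"
    then show "(\<Sum>B\<in>Pow (I - {k}). real (a k) * f (insert k B)) = (\<Sum>B\<in>{B \<in> Pow I. k \<in> B}. real (a k) * f B)"
      by (intro sum.reindex_bij_witness[where i = "\<lambda>B. B - {k}" and j = "insert k"]) auto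
  qed
  also have "\<dots> = (\<Sum>B\<in>Pow I. \<Sum>k\<in>{k \<in> I. k \<in> B}. real (a k) * f B)"
    by (rule sum.swap_restrict) (use I in auto)
  also have "\<dots> = (\<Sum>B\<in>Pow I. real (A B) * f B)"
  proof (rule sum.cong[OF refl])
    fix B assume "B \<in> Pow I"
    then have "{k \<in> I. k \<in> B} = B" by auto
    then show "(\<Sum>k\<in>{k \<in> I. k \<in> B}. real (a k) * f B) = real (A B) * f B"
      by (simp add: A_def sum_distrib_right)
  qed
  \<comment> \<open>The empty set has weight \<open>A {} = 0\<close>, and it must go because the
    exponent \<open>A B - 1\<close> would be truncated there.\<close>
  also have "\<dots> = (\<Sum>B\<in>Pow I - {{}}. real (A B) * f B)"
    by (rule sum.mono_neutral_right) (use I in \<open>auto simp: A_def\<close>)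
  also have "\<dots> = (\<Sum>B\<in>Pow I - {{}}. (real s + \<theta>) * (beta_moment \<theta> (A B) (A (I - B)) * gem_moment a (I - B)))"
  proof (rule sum.cong[OF refl])
    fix B assume B: "B \<in> Pow I - {{}}"
    then obtain k where k: "k \<in> B" by auto
    have "a k \<le> A B" unfolding A_def using B I k finite_subset by (intro member_le_sum) auto
    with a[of k] have "0 < A B" by linarith
    from beta_moment_Suc[OF \<theta> this, of "A (I - B)"] B
    show "real (A B) * f B = (real s + \<theta>) * (beta_moment \<theta> (A B) (A (I - B)) * gem_moment a (I - B))"
      by (simp add: f_def s[of B] mult.assoc[symmetric])
  qed
  also have "\<dots> = (real s + \<theta>) * (gem_moment a I - beta_moment \<theta> 0 s * gem_moment a I)"
  proof -
    have "gem_moment a I = (\<Sum>B\<in>Pow I. beta_moment \<theta> (A B) (A (I - B)) * gem_moment a (I - B))"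
      unfolding A_def by (rule gem_moment_split[OF a I(1)])
    also have "\<dots> = beta_moment \<theta> (A {}) (A (I - {})) * gem_moment a (I - {}) +
       (\<Sum>B\<in>Pow I - {{}}. beta_moment \<theta> (A B) (A (I - B)) * gem_moment a (I - B))"
      by (rule sum.remove) (use I in auto)
    finally have "(\<Sum>B\<in>Pow I - {{}}. beta_moment \<theta> (A B) (A (I - B)) * gem_moment a (I - B)) =
      gem_moment a I - beta_moment \<theta> 0 s * gem_moment a I" by (simp add: A_def s_def)
    then show ?thesis by (simp only: sum_distrib_left[symmetric])
  qed
  also have "\<dots> = real s * gem_moment a I"
    using \<theta> by (simp add: beta_moment_0 field_simps)
  finally show ?thesis by (simp add: s_def)
qed

lemma scaled_decreasing_measurable:
  "(\<lambda>u i. \<alpha> * decreasing (stick_breaking u) i) \<in> borel_measurable sticks"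
proof (rule measurable_coordinatewise_then_product)
  fix i
  show "(\<lambda>u. \<alpha> * decreasing (stick_breaking u) i) \<in> borel_measurable sticks"
    using measurable_product_then_coordinatewise[OF decreasing_measurable] by simp
qed

lemma scaled_poisson_dirichlet_eq:
  "scaled_poisson_dirichlet \<alpha> \<theta> = distr sticks borel (\<lambda>u i. \<alpha> * decreasing (stick_breaking u) i)"
proof -
  have "(\<lambda>p::nat \<Rightarrow> real. (\<lambda>i. \<alpha> * p i)) \<in> borel_measurable borel"
    by (rule measurable_coordinatewise_then_product) measurable
  then show ?thesis
    unfolding scaled_poisson_dirichlet_def poisson_dirichlet_def
    by (subst distr_distr) (auto simp: o_def decreasing_measurable)
qed

lemma prob_space_scaled_poisson_dirichlet: "prob_space (scaled_poisson_dirichlet \<alpha> \<theta>)"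
  unfolding scaled_poisson_dirichlet_eq
  by (rule prob_space.prob_space_distr[OF prob_space_sticks scaled_decreasing_measurable])

lemma scale_mass_partition:
  assumes "p \<in> mass_partitions" "0 \<le> \<alpha>" "\<alpha> \<le> 1"
  shows "(\<lambda>i. \<alpha> * p i) \<in> mass_partitions"
proof -
  have p: "\<And>i. 0 \<le> p i" "\<And>i. p i \<le> 1" "summable p" "suminf p \<le> 1" "antimono p"
    using assms(1) by (auto simp: mass_partitions_def)
  have "\<alpha> * suminf p \<le> 1 * 1" using p assms suminf_nonneg[OF p(3)] by (intro mult_mono) auto
  moreover have "\<alpha> * p i \<le> 1 * 1" for i using p assms by (intro mult_mono) auto
  ultimately show ?thesis
    using p assms by (auto simp: mass_partitions_def suminf_mult summable_mult antimono_def intro!: mult_left_mono)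
qed

text \<open>Power sums are homogeneous and unaffected by sorting, and almost surely the scaled
  sorted sequence lies in \<open>mass_partitions\<close>, so the indicator equals 1.\<close>

lemma integral_scaled_poisson_dirichlet:
  assumes \<alpha>: "0 \<le> \<alpha>" "\<alpha> \<le> 1" and a: "\<And>i. 1 \<le> a i"
    and meas: "(\<lambda>p. indicator mass_partitions p *\<^sub>R (\<Prod>i\<in>I. partition_sum (a i) p)) \<in> borel_measurable borel"
  shows "(LINT p:mass_partitions|scaled_poisson_dirichlet \<alpha> \<theta>. (\<Prod>i\<in>I. partition_sum (a i) p)) =
    \<alpha> ^ (\<Sum>i\<in>I. a i) * gem_moment a I"
proof -
  have "(LINT p:mass_partitions|scaled_poisson_dirichlet \<alpha> \<theta>. (\<Prod>i\<in>I. partition_sum (a i) p)) =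
    (LINT u|sticks. indicator mass_partitions (\<lambda>i. \<alpha> * decreasing (stick_breaking u) i) *\<^sub>R
       (\<Prod>i\<in>I. partition_sum (a i) (\<lambda>i. \<alpha> * decreasing (stick_breaking u) i)))"
    unfolding scaled_poisson_dirichlet_eq set_lebesgue_integral_def
    by (rule integral_distr[OF scaled_decreasing_measurable meas])
  also have "\<dots> = (LINT u|sticks. \<alpha> ^ (\<Sum>i\<in>I. a i) * (\<Prod>i\<in>I. partition_sum (a i) (stick_breaking u)))"
  proof (rule integral_cong_AE)
    show "AE u in sticks. indicator mass_partitions (\<lambda>i. \<alpha> * decreasing (stick_breaking u) i) *\<^sub>R
       (\<Prod>i\<in>I. partition_sum (a i) (\<lambda>i. \<alpha> * decreasing (stick_breaking u) i)) =
       \<alpha> ^ (\<Sum>i\<in>I. a i) * (\<Prod>i\<in>I. partition_sum (a i) (stick_breaking u))"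
      using AE_unit_sequence
    proof eventually_elim
      case (elim u)
      have mp: "decreasing (stick_breaking u) \<in> mass_partitions"
        by (rule decreasing_stick_breaking(1)[OF elim])
      have "partition_sum (a i) (\<lambda>i. \<alpha> * decreasing (stick_breaking u) i) =
         \<alpha> ^ a i * partition_sum (a i) (stick_breaking u)" for i
      proof -
        have "summable (\<lambda>k. decreasing (stick_breaking u) k ^ a i)"
          by (rule partition_sum_bounds(1)) (use mp a in \<open>auto simp: mass_partitions_def\<close>)
        then have "partition_sum (a i) (\<lambda>i. \<alpha> * decreasing (stick_breaking u) i) =
            \<alpha> ^ a i * partition_sum (a i) (decreasing (stick_breaking u))"
          unfolding partition_sum_def by (simp add: power_mult_distrib suminf_mult)
        then show ?thesis using decreasing_stick_breaking(2)[OF elim a] by simp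
      qed
      then show ?case using scale_mass_partition[OF mp \<alpha>] by (simp add: prod.distrib power_sum)
    qed
    show "(\<lambda>u. indicator mass_partitions (\<lambda>i. \<alpha> * decreasing (stick_breaking u) i) *\<^sub>R
       (\<Prod>i\<in>I. partition_sum (a i) (\<lambda>i. \<alpha> * decreasing (stick_breaking u) i))) \<in> borel_measurable sticks"
      using measurable_compose[OF scaled_decreasing_measurable meas] by simp
  qed measurable
  also have "\<dots> = \<alpha> ^ (\<Sum>i\<in>I. a i) * gem_moment a I" by (simp add: gem_moment_def)
  finally show ?thesis .
qed

end


section \<open>Weak convergence of mass partitions\<close>

text \<open>Replaces the conditions on the series by inequalities in finitely many coordinates each,
  which are closed in the product topology.\<close>

lemma mass_partitions_eq:
  "mass_partitions = {p. (\<forall>i. 0 \<le> p i) \<and> (\<forall>i. p i \<le> 1) \<and> (\<forall>n. (\<Sum>i<n. p i) \<le> 1) \<and> (\<forall>i. p (Suc i) \<le> p i)}"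
proof (intro set_eqI iffI)
  fix p :: "nat \<Rightarrow> real" assume p: "p \<in> mass_partitions"
  have "(\<Sum>i<n. p i) \<le> 1" for n
  proof -
    have "(\<Sum>i<n. p i) \<le> suminf p" using p by (intro sum_le_suminf) (auto simp: mass_partitions_def)
    then show ?thesis using p by (auto simp: mass_partitions_def)
  qed
  then show "p \<in> {p. (\<forall>i. 0 \<le> p i) \<and> (\<forall>i. p i \<le> 1) \<and> (\<forall>n. (\<Sum>i<n. p i) \<le> 1) \<and> (\<forall>i. p (Suc i) \<le> p i)}"
    using p by (auto simp: mass_partitions_def antimono_def)
next
  fix p :: "nat \<Rightarrow> real"
  assume p: "p \<in> {p. (\<forall>i. 0 \<le> p i) \<and> (\<forall>i. p i \<le> 1) \<and> (\<forall>n. (\<Sum>i<n. p i) \<le> 1) \<and> (\<forall>i. p (Suc i) \<le> p i)}"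
  then have s: "summable p" by (intro summableI_nonneg_bounded[of _ 1]) auto
  have "suminf p \<le> 1" by (rule suminf_le_const[OF s]) (use p in auto)
  moreover have "antimono p" using p by (intro decseq_SucI) auto
  ultimately show "p \<in> mass_partitions" using p s by (auto simp: mass_partitions_def)
qed

lemma closed_mass_partitions: "closed mass_partitions"
  unfolding mass_partitions_eq
  by (intro closed_Collect_conj closed_Collect_all closed_Collect_le continuous_intros continuous_on_product_coordinates)

text \<open>Tychonoff's theorem for the cube, of which the partitions form a closed subset.\<close>

lemma compact_mass_partitions: "compact mass_partitions"
proof -
  have "compactin (product_topology (\<lambda>i. euclidean) UNIV) (PiE UNIV (\<lambda>_::nat. {0..1::real}))"
    by (simp add: compactin_PiE compactin_euclidean_iff)
  then have "compact (PiE UNIV (\<lambda>_::nat. {0..1::real}))"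
    by (simp add: euclidean_product_topology compactin_euclidean_iff)
  then have "compact (PiE UNIV (\<lambda>_::nat. {0..1::real}) \<inter> mass_partitions)"
    by (rule compact_Int_closed[OF _ closed_mass_partitions])
  moreover have "PiE UNIV (\<lambda>_::nat. {0..1::real}) \<inter> mass_partitions = mass_partitions"
    by (auto simp: mass_partitions_def)
  ultimately show ?thesis by simp
qed

lemma mass_partitions_borel [measurable, simp]: "mass_partitions \<in> sets borel"
  using closed_mass_partitions by (rule borel_closed)

text \<open>The first \<open>i + 1\<close> entries are at least \<open>p i\<close> and sum to at
  most 1. The bound is the same for all partitions.\<close>

lemma mass_partition_le:
  assumes "p \<in> mass_partitions"
  shows "p i \<le> 1 / real (Suc i)"
proof -
  have "real (Suc i) * p i = (\<Sum>j<Suc i. p i)" by simp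
  also have "\<dots> \<le> (\<Sum>j<Suc i. p j)"
    using assms by (intro sum_mono) (auto simp: mass_partitions_def antimono_def)
  also have "\<dots> \<le> 1" using assms by (auto simp: mass_partitions_eq simp del: sum.lessThan_Suc)
  finally show ?thesis by (simp add: field_simps)
qed

text \<open>For exponents at least 2 the majorant 1 / (i + 1)^2 gives uniform convergence. With
  exponent 1 continuity fails: n equal entries 1 / n tend to the zero sequence while their sum stays
  1.\<close>

lemma continuous_on_partition_sum:
  assumes "2 \<le> a"
  shows "continuous_on mass_partitions (partition_sum a)"
proof -
  have "uniform_limit mass_partitions (\<lambda>n p. \<Sum>i<n. p i ^ a) (\<lambda>p. \<Sum>i. p i ^ a) sequentially"
  proof (rule Weierstrass_m_test)
    fix i and p :: "nat \<Rightarrow> real" assume p: "p \<in> mass_partitions"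
    have p01: "0 \<le> p i" "p i \<le> 1" using p by (auto simp: mass_partitions_eq)
    have "norm (p i ^ a) \<le> p i ^ 2" using p01 assms by (simp add: power_decreasing)
    also have "\<dots> \<le> (1 / real (Suc i)) ^ 2" using p01 mass_partition_le[OF p] by (intro power_mono) auto
    finally show "norm (p i ^ a) \<le> inverse (real (Suc i) ^ 2)"
      by (simp add: power_one_over inverse_eq_divide)
  next
    have "summable (\<lambda>n. inverse (real n ^ 2))" by (rule inverse_power_summable) simp
    then show "summable (\<lambda>i. inverse (real (Suc i) ^ 2))"
      by (subst summable_Suc_iff[where f = "\<lambda>n. inverse (real n ^ 2)"])
  qed
  then have "continuous_on mass_partitions (\<lambda>p. \<Sum>i. p i ^ a)"
    by (rule uniform_limit_theorem[rotated])
       (auto intro!: always_eventually continuous_intros continuous_on_subset[OF continuous_on_product_coordinates])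
  then show ?thesis by (simp add: partition_sum_def[abs_def])
qed

text \<open>At the first index where two partitions differ, the larger entry dominates the sums of high order.\<close>

lemma partition_sums_separate:
  assumes p: "p \<in> mass_partitions" and q: "q \<in> mass_partitions" and ne: "p \<noteq> q"
  shows "\<exists>a\<ge>2. partition_sum a p \<noteq> partition_sum a q"
proof (rule ccontr)
  assume "\<not> (\<exists>a\<ge>2. partition_sum a p \<noteq> partition_sum a q)"
  then have eq: "partition_sum a p = partition_sum a q" if "2 \<le> a" for a using that by blast
  define k where "k = (LEAST k. p k \<noteq> q k)"
  have "\<exists>k. p k \<noteq> q k" using ne by auto
  then have k: "p k \<noteq> q k" and less: "\<And>i. i < k \<Longrightarrow> p i = q i"
    unfolding k_def by (rule LeastI_ex, use not_less_Least in blast)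
  have contradiction: False
    if p: "p \<in> mass_partitions" and q: "q \<in> mass_partitions" and gt: "q k < p k"
      and less: "\<And>i. i < k \<Longrightarrow> p i = q i" and eq: "\<And>a. 2 \<le> a \<Longrightarrow> partition_sum a p = partition_sum a q"
    for p q
  proof -
    have p': "\<And>i. 0 \<le> p i" "\<And>i. p i \<le> 1" "summable p" "suminf p \<le> 1" "antimono p"
      and q': "\<And>i. 0 \<le> q i" "\<And>i. q i \<le> 1" "summable q" "suminf q \<le> 1" "antimono q"
      using p q by (auto simp: mass_partitions_def)
    have tail: "partition_sum a r = (\<Sum>i. r (i + k) ^ a) + (\<Sum>i<k. r i ^ a)" "summable (\<lambda>i. r (i + k) ^ a)"
      if "1 \<le> a" "r \<in> mass_partitions" for a r
    proof -
      have "summable (\<lambda>i. r i ^ a)"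
        by (rule partition_sum_bounds(1)) (use that in \<open>auto simp: mass_partitions_def\<close>)
      then show "partition_sum a r = (\<Sum>i. r (i + k) ^ a) + (\<Sum>i<k. r i ^ a)" "summable (\<lambda>i. r (i + k) ^ a)"
        unfolding partition_sum_def
        using suminf_split_initial_segment summable_ignore_initial_segment[where f = "\<lambda>i. r i ^ a"] by auto
    qed
    \<comment> \<open>The terms before \<open>k\<close> cancel, so the power of \<open>p k\<close>
      is at most the tail sum of \<open>q\<close>, in which one factor is kept to sum to at most 1
      and the others are bounded by \<open>q k\<close>.\<close>
    have le: "p k ^ (n + 1) \<le> q k ^ n" for n
    proof (cases "n = 0")
      case True
      then show ?thesis using p' by simp
    next
      case False
      have a: "2 \<le> n + 1" "1 \<le> n + 1" using False by auto
      have "p k ^ (n + 1) \<le> (\<Sum>i. p (i + k) ^ (n + 1))"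
        using sum_le_suminf[OF tail(2)[OF a(2) p], of "{0}"] p' by simp
      also have "\<dots> = (\<Sum>i. q (i + k) ^ (n + 1))"
      proof -
        have "(\<Sum>i<k. p i ^ (n + 1)) = (\<Sum>i<k. q i ^ (n + 1))" by (intro sum.cong refl) (simp add: less)
        then show ?thesis using eq[OF a(1)] tail(1)[OF a(2) p] tail(1)[OF a(2) q] by simp
      qed
      also have "\<dots> \<le> (\<Sum>i. q k ^ n * q (i + k))"
      proof (rule suminf_le[OF _ tail(2)[OF a(2) q]])
        show "q (i + k) ^ (n + 1) \<le> q k ^ n * q (i + k)" for i
        proof -
          have "q (i + k) ^ n \<le> q k ^ n" using q' by (intro power_mono) (auto simp: antimono_def)
          then have "q (i + k) * q (i + k) ^ n \<le> q (i + k) * q k ^ n" using q'(1) by (rule mult_left_mono)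
          then show ?thesis by (simp add: mult.commute)
        qed
        show "summable (\<lambda>i. q k ^ n * q (i + k))"
          by (intro summable_mult summable_ignore_initial_segment q')
      qed
      also have "\<dots> = q k ^ n * (\<Sum>i. q (i + k))"
        by (rule suminf_mult) (intro summable_ignore_initial_segment q')
      also have "\<dots> \<le> q k ^ n * 1"
      proof (rule mult_left_mono)
        have "(\<Sum>i<k. q i) \<ge> 0" using q' by (intro sum_nonneg) auto
        then show "(\<Sum>i. q (i + k)) \<le> 1"
          using suminf_split_initial_segment[OF q'(3), of k] q'(4) by linarith
      qed (use q' in auto)
      finally show ?thesis by simp
    qed
    have pk: "0 < p k" using gt q'(1)[of k] by linarith
    define x where "x = q k / p k"
    have x: "0 \<le> x" "x < 1" using gt pk q' by (auto simp: x_def)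
    have "p k \<le> x ^ n" for n
      using le[of n] pk by (simp add: x_def power_divide field_simps)
    moreover have "(\<lambda>n. x ^ n) \<longlonglongrightarrow> 0" using x by (intro LIMSEQ_realpow_zero) auto
    ultimately have "p k \<le> 0" by (intro LIMSEQ_le_const) auto
    with pk show False by simp
  qed
  show False
  proof (cases "q k < p k")
    case True
    then show ?thesis using contradiction[OF p q True] less eq by blast
  next
    case False
    then have "p k < q k" using k by simp
    then show ?thesis using contradiction[OF q p, OF _ less[symmetric] eq[symmetric]] by blast
  qed
qed

text \<open>Linear combinations of products, so that convergence of integrals reduces to single
  products. Constants arise from the empty product, \<open>n = 0\<close>.\<close>

inductive_set partition_sum_ring :: "((nat \<Rightarrow> real) \<Rightarrow> real) set" where
  product: "(\<And>i::nat. 2 \<le> a i) \<Longrightarrow> (\<lambda>p. c * (\<Prod>i<n. partition_sum (a i) p)) \<in> partition_sum_ring"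
| add: "f \<in> partition_sum_ring \<Longrightarrow> g \<in> partition_sum_ring \<Longrightarrow> (\<lambda>p. f p + g p) \<in> partition_sum_ring"

lemma partition_sum_ring_mult:
  assumes "f \<in> partition_sum_ring" "g \<in> partition_sum_ring"
  shows "(\<lambda>p. f p * g p) \<in> partition_sum_ring"
  using assms
proof (induction f)
  case (product a c n)
  from product(2) show ?case
  proof (induction g)
    case (product b d m)
    \<comment> \<open>Concatenates the two lists of exponents.\<close>
    define e where "e i = (if i < n then a i else b (i - n))" for i
    have "(\<Prod>i<n + m. partition_sum (e i) p) =
       (\<Prod>i<n. partition_sum (a i) p) * (\<Prod>i<m. partition_sum (b i) p)" for p
    proof -
      have "(\<Prod>i<n + m. partition_sum (e i) p) =
         (\<Prod>i<n. partition_sum (e i) p) * (\<Prod>i\<in>{n..<n + m}. partition_sum (e i) p)"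
        by (subst prod.union_disjoint[symmetric]) (auto intro!: prod.cong)
      also have "(\<Prod>i\<in>{n..<n + m}. partition_sum (e i) p) = (\<Prod>i<m. partition_sum (b i) p)"
        by (rule prod.reindex_bij_witness[where i = "\<lambda>i. i + n" and j = "\<lambda>i. i - n"]) (auto simp: e_def)
      finally show ?thesis by (simp add: e_def)
    qed
    then have "(\<lambda>p. c * (\<Prod>i<n. partition_sum (a i) p) * (d * (\<Prod>i<m. partition_sum (b i) p))) =
       (\<lambda>p. (c * d) * (\<Prod>i<n + m. partition_sum (e i) p))" by (simp add: mult_ac)
    also have "\<dots> \<in> partition_sum_ring"
      by (rule partition_sum_ring.product) (use \<open>\<And>i. 2 \<le> a i\<close> product in \<open>auto simp: e_def\<close>)
    finally show ?case .
  next
    case (add f g)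
    then show ?case by (auto simp: distrib_left intro: partition_sum_ring.add)
  qed
next
  case (add f1 f2)
  then show ?case by (auto simp: distrib_right intro: partition_sum_ring.add)
qed

lemma continuous_on_partition_sum_ring:
  "f \<in> partition_sum_ring \<Longrightarrow> continuous_on mass_partitions f"
  by (induction rule: partition_sum_ring.induct)
     (auto intro!: continuous_intros continuous_on_partition_sum)

lemma function_ring_on_partition_sum_ring: "function_ring_on partition_sum_ring mass_partitions"
proof
  show "compact mass_partitions" by (rule compact_mass_partitions)
  show "continuous_on mass_partitions f" if "f \<in> partition_sum_ring" for f
    using that by (rule continuous_on_partition_sum_ring)
  show "(\<lambda>p. f p + g p) \<in> partition_sum_ring" if "f \<in> partition_sum_ring" "g \<in> partition_sum_ring" for f g
    using that by (rule partition_sum_ring.add)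
  show "(\<lambda>p. f p * g p) \<in> partition_sum_ring" if "f \<in> partition_sum_ring" "g \<in> partition_sum_ring" for f g
    using that by (rule partition_sum_ring_mult)
  show "(\<lambda>_. c) \<in> partition_sum_ring" for c
    using partition_sum_ring.product[of "\<lambda>_. 2" c 0] by simp
  show "\<exists>f\<in>partition_sum_ring. f x \<noteq> f y" if xy: "x \<in> mass_partitions" "y \<in> mass_partitions" "x \<noteq> y" for x y
  proof -
    obtain a where "2 \<le> a" "partition_sum a x \<noteq> partition_sum a y" using partition_sums_separate[OF xy] by blast
    then show ?thesis using partition_sum_ring.product[of "\<lambda>_. a" 1 1] by (intro bexI) auto
  qed
qed

section \<open>From power sums to weak convergence\<close>

lemma measurable_indicator_mass_partitions:
  fixes f :: "(nat \<Rightarrow> real) \<Rightarrow> real"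
  assumes "continuous_on mass_partitions f"
  shows "(\<lambda>p. indicator mass_partitions p *\<^sub>R f p) \<in> borel_measurable borel"
  using assms by (intro borel_measurable_continuous_on_indicator) auto

lemma set_integrable_mass_partitions:
  fixes f :: "(nat \<Rightarrow> real) \<Rightarrow> real"
  assumes f: "continuous_on mass_partitions f" and M: "prob_space M" "sets M = sets borel"
  shows "set_integrable M mass_partitions f"
proof -
  interpret prob_space M by fact
  have "bounded (f ` mass_partitions)"
    using compact_continuous_image[OF f compact_mass_partitions] by (rule compact_imp_bounded)
  then obtain b where b: "\<And>p. p \<in> mass_partitions \<Longrightarrow> norm (f p) \<le> b" by (auto simp: bounded_iff)
  show ?thesis unfolding set_integrable_def
  proof (rule integrable_const_bound[of _ "max b 0"])
    show "AE p in M. norm (indicator mass_partitions p *\<^sub>R f p) \<le> max b 0"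
      using b by (intro AE_I2) (auto simp: indicator_def intro: max.coboundedI1)
    show "(\<lambda>p. indicator mass_partitions p *\<^sub>R f p) \<in> borel_measurable M"
      using measurable_indicator_mass_partitions[OF f] by (simp only: measurable_cong_sets[OF M(2) refl])
  qed
qed

lemma set_integral_mass_partitions_close:
  fixes f g :: "(nat \<Rightarrow> real) \<Rightarrow> real"
  assumes f: "continuous_on mass_partitions f" and g: "continuous_on mass_partitions g"
    and M: "prob_space M" "sets M = sets borel" and e: "\<And>p. p \<in> mass_partitions \<Longrightarrow> \<bar>f p - g p\<bar> \<le> e" "0 \<le> e"
  shows "\<bar>(LINT p:mass_partitions|M. f p) - (LINT p:mass_partitions|M. g p)\<bar> \<le> e"
proof -
  interpret prob_space M by fact
  have int: "set_integrable M mass_partitions f" "set_integrable M mass_partitions g"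
    by (intro set_integrable_mass_partitions f g M)+
  have "\<bar>(LINT p:mass_partitions|M. f p) - (LINT p:mass_partitions|M. g p)\<bar> =
     \<bar>LINT p|M. indicator mass_partitions p *\<^sub>R f p - indicator mass_partitions p *\<^sub>R g p\<bar>"
    using int unfolding set_lebesgue_integral_def set_integrable_def by simp
  also have "\<dots> \<le> (LINT p|M. \<bar>indicator mass_partitions p *\<^sub>R f p - indicator mass_partitions p *\<^sub>R g p\<bar>)"
    by (rule integral_abs_bound)
  also have "\<dots> \<le> (LINT p|M. e)"
    using int e unfolding set_integrable_def
    by (intro integral_mono) (auto simp: indicator_def)
  finally show ?thesis by (simp add: prob_space)
qed

text \<open>A uniform approximation of the test function within a third of the error transfers
  convergence from the ring. Being a probability measure is asked only eventually, since early
  partition functions may vanish.\<close>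

lemma weakly_converges_on_mass_partitions:
  assumes M: "\<forall>\<^sub>F k in sequentially. prob_space (M k)" "\<And>k. sets (M k) = sets borel"
    and M': "prob_space M'" "sets M' = sets borel"
    and lim: "\<And>a (n::nat). (\<And>i. 2 \<le> a i) \<Longrightarrow>
      (\<lambda>k. LINT p:mass_partitions|M k. (\<Prod>i<n. partition_sum (a i) p)) \<longlonglongrightarrow>
      (LINT p:mass_partitions|M'. (\<Prod>i<n. partition_sum (a i) p))"
  shows "weakly_converges_on mass_partitions M M'"
  unfolding weakly_converges_on_def
proof (intro allI impI)
  fix f :: "(nat \<Rightarrow> real) \<Rightarrow> real" assume f: "continuous_on mass_partitions f"
  have ring: "(\<lambda>k. LINT p:mass_partitions|M k. g p) \<longlonglongrightarrow> (LINT p:mass_partitions|M'. g p)"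
    if "g \<in> partition_sum_ring" for g
    using that
  proof induction
    case (product a c n)
    then show ?case by (auto intro!: tendsto_mult_left lim)
  next
    case (add f g)
    note cont = continuous_on_partition_sum_ring[OF add(1)] continuous_on_partition_sum_ring[OF add(2)]
    have split: "(LINT p:mass_partitions|N. f p + g p) = (LINT p:mass_partitions|N. f p) + (LINT p:mass_partitions|N. g p)"
      if "prob_space N" "sets N = sets borel" for N
      by (intro set_integral_add set_integrable_mass_partitions cont that)
    have "(\<lambda>k. (LINT p:mass_partitions|M k. f p) + (LINT p:mass_partitions|M k. g p)) \<longlonglongrightarrow>
        (LINT p:mass_partitions|M'. f p + g p)"
      unfolding split[OF M'] by (intro tendsto_add add)
    then show ?case
      by (rule Lim_transform_eventually) (use M split in \<open>auto elim: eventually_mono\<close>)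
  qed
  show "(\<lambda>k. LINT p:mass_partitions|M k. f p) \<longlonglongrightarrow> (LINT p:mass_partitions|M'. f p)"
  proof (rule tendstoI)
    fix e :: real assume e: "0 < e"
    then have e3: "0 < e / 3" by simp
    obtain g where g: "g \<in> partition_sum_ring" "\<And>p. p \<in> mass_partitions \<Longrightarrow> \<bar>f p - g p\<bar> < e / 3"
      using function_ring_on.Stone_Weierstrass_basic[OF function_ring_on_partition_sum_ring f e3] by blast
    have close: "\<bar>(LINT p:mass_partitions|N. f p) - (LINT p:mass_partitions|N. g p)\<bar> \<le> e / 3"
      if "prob_space N" "sets N = sets borel" for N
      by (rule set_integral_mass_partitions_close[OF f continuous_on_partition_sum_ring[OF g(1)] that])
         (use g(2) e in \<open>auto intro: less_imp_le\<close>)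
    show "\<forall>\<^sub>F k in sequentially. dist (LINT p:mass_partitions|M k. f p) (LINT p:mass_partitions|M'. f p) < e"
      using tendstoD[OF ring[OF g(1)] e3] M(1)
    proof eventually_elim
      case (elim k)
      then show ?case using close[OF elim(2) M(2)] close[OF M'] unfolding dist_real_def by linarith
    qed
  qed
qed


section \<open>Site limits\<close>

context condensing_weights
begin

section \<open>Inverting the tilted mean\<close>

lemma tilt_mean_0: "tilt_mean w 0 = 0"
proof -
  have "(\<lambda>n. real n * w n * 0 ^ n) = (\<lambda>n. 0)" by (auto simp: power_0_left)
  then show ?thesis unfolding tilt_mean_def by simp
qed

lemma tilt_continuous:
  "continuous_on {0..1} (tilt_norm w)" "continuous_on {0..1} (tilt_mean w)"
proof -
  obtain J where J: "\<forall>n>J. w n = 0" using w_support by blast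
  have norm: "tilt_norm w = (\<lambda>\<phi>. \<Sum>n\<le>J. w n * \<phi> ^ n)" using sum_cutoff(3)[OF J] by blast
  have mean: "tilt_mean w = (\<lambda>\<phi>. (\<Sum>n\<le>J. real n * w n * \<phi> ^ n) / tilt_norm w \<phi>)"
    unfolding norm using sum_cutoff(4)[OF J] by blast
  show c: "continuous_on {0..1} (tilt_norm w)" unfolding norm by (intro continuous_intros)
  show "continuous_on {0..1} (tilt_mean w)"
    unfolding mean by (intro continuous_intros c) (use tilt_norm_pos in force)
qed

lemma ex_tilt:
  assumes "0 < \<rho>" "\<rho> \<le> critical_density w"
  shows "\<exists>\<phi>. 0 < \<phi> \<and> \<phi> \<le> 1 \<and> tilt_mean w \<phi> = \<rho>"
proof -
  have "\<exists>\<phi>\<ge>0. \<phi> \<le> 1 \<and> tilt_mean w \<phi> = \<rho>"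
    by (rule IVT'[OF _ _ _ tilt_continuous(2)]) (use assms tilt_mean_0 tilt_mean_1 in auto)
  then show ?thesis using assms tilt_mean_0 by (metis less_eq_real_def less_irrefl)
qed

text \<open>A covariance inequality: i - m and x^i - x^m have opposite signs for 0 < x < 1, and the
  first has mean zero under the tilted law with mean m. Strictness comes from i = 0, where
  \<open>w 0\<close> and m are positive. Since m is real, \<open>powr\<close> is used.\<close>

lemma tilt_mean_strict_mono:
  assumes \<phi>: "0 < \<phi>'" "\<phi>' < \<phi>" "\<phi> \<le> 1" and pos: "0 < tilt_mean w \<phi>"
  shows "tilt_mean w \<phi>' < tilt_mean w \<phi>"
proof -
  obtain J where J: "\<forall>n>J. w n = 0" using w_support by blast
  define m where "m = tilt_mean w \<phi>"
  define x where "x = \<phi>' / \<phi>"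
  define g where "g i = w i * \<phi> ^ i" for i
  have x: "0 < x" "x < 1" using \<phi> by (auto simp: x_def)
  have g0: "0 \<le> g i" for i using \<phi> w_nonneg by (auto simp: g_def)
  have gx: "g i * x ^ i = w i * \<phi>' ^ i" for i using \<phi> by (simp add: g_def x_def power_divide)
  have norm: "0 < (\<Sum>i\<le>J. g i)" using tilt_norm_pos[of \<phi>] \<phi> by (simp add: sum_cutoff(3)[OF J] g_def)
  have zero: "(\<Sum>i\<le>J. (real i - m) * g i) = 0"
  proof -
    have "m * (\<Sum>i\<le>J. g i) = (\<Sum>i\<le>J. real i * g i)"
      using norm unfolding m_def sum_cutoff(4)[OF J] g_def by (simp add: mult.assoc)
    then show ?thesis by (simp add: left_diff_distrib sum_subtractf sum_distrib_left[symmetric])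
  qed
  have le: "(real i - m) * g i * (x powr real i - x powr m) \<le> 0" for i
  proof (cases "real i \<le> m")
    case True
    then have "x powr m \<le> x powr real i" using x by (simp add: powr_mono')
    then show ?thesis using True g0[of i] by (simp add: mult_nonpos_nonneg mult_nonneg_nonneg mult_nonpos_nonpos zero_le_mult_iff mult_le_0_iff)
  next
    case False
    then have "x powr real i \<le> x powr m" using x by (simp add: powr_mono')
    then show ?thesis using False g0[of i] by (simp add: mult_le_0_iff zero_le_mult_iff)
  qed
  have strict: "(real 0 - m) * g 0 * (x powr real 0 - x powr m) < 0"
  proof -
    have "x powr m < 1" using x pos powr_less_mono'[of x 0 m] by (simp add: m_def)
    then show ?thesis using w0 pos x by (simp add: g_def m_def mult_less_0_iff)
  qed
  have "(\<Sum>i\<le>J. (real i - m) * g i * (x powr real i - x powr m)) < (\<Sum>i\<le>J. 0)"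
  proof (rule sum_strict_mono_ex1)
    show "\<exists>i\<in>{..J}. (real i - m) * g i * (x powr real i - x powr m) < 0" by (intro bexI[of _ 0] strict) simp
  qed (use le in auto)
  also have "(\<Sum>i\<le>J. (real i - m) * g i * (x powr real i - x powr m)) =
      (\<Sum>i\<le>J. (real i - m) * g i * x ^ i) - (\<Sum>i\<le>J. (real i - m) * g i) * x powr m"
    using x by (simp add: right_diff_distrib sum_subtractf sum_distrib_right powr_realpow)
  finally have "(\<Sum>i\<le>J. (real i - m) * (g i * x ^ i)) < 0" by (simp add: zero mult.assoc)
  then have "(\<Sum>i\<le>J. real i * w i * \<phi>' ^ i) < m * (\<Sum>i\<le>J. w i * \<phi>' ^ i)"
    by (simp add: gx left_diff_distrib sum_subtractf sum_distrib_left mult.assoc)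
  moreover have "0 < (\<Sum>i\<le>J. w i * \<phi>' ^ i)" using tilt_norm_pos[of \<phi>'] \<phi> by (simp add: sum_cutoff(3)[OF J])
  ultimately show ?thesis unfolding m_def[symmetric] by (simp add: sum_cutoff(4)[OF J] divide_less_eq)
qed

text \<open>The lower bound for \<open>Z\<close> needs a tilted mean strictly below
  \<open>\<rho>\<close>, so a smaller tilt \<open>x\<close> is used first; the price of the gap
  vanishes as \<open>x\<close> approaches \<open>\<phi>\<close>. With \<open>\<phi> = 1\<close> this
  includes the critical density.\<close>

lemma site_prob_tilted_limit:
  assumes N: "(\<lambda>j. real (N j) / real (l j)) \<longlonglongrightarrow> \<rho>"
    and \<phi>: "0 < \<phi>" "\<phi> \<le> 1" "tilt_mean w \<phi> = \<rho>" and \<rho>: "0 < \<rho>"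
  shows "(\<lambda>j. site_prob (v j) (l j) (N j) n) \<longlonglongrightarrow> w n * \<phi> ^ n / tilt_norm w \<phi>"
proof (rule tendsto_of_exponential_bounds)
  fix t \<kappa> :: real assume \<kappa>: "0 < \<kappa>"
  \<comment> \<open>The right side of the exponential bound for tilt \<open>x\<close>. The factor 2
    comes from the choice \<open>r2 = 2 * \<rho> - tilt_mean w x\<close>, which lies above
    \<open>\<rho>\<close> by the same gap.\<close>
  define h where "h x = w n * x ^ n / tilt_norm w x * (exp t - 1) + 2 * (\<rho> - tilt_mean w x) * ln (1 / x) + \<kappa> / 2" for x
  have pos: "0 < x" "x \<le> 1" "0 < tilt_norm w x" if "x \<in> {\<phi> / 2..\<phi>}" for x
  proof -
    have "\<phi> / 2 \<le> x" "x \<le> \<phi>" using that by auto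
    then show "0 < x" "x \<le> 1" using \<phi>(1,2) by linarith+
    then show "0 < tilt_norm w x" by (intro tilt_norm_pos) auto
  qed
  have sub: "{\<phi> / 2..\<phi>} \<subseteq> {0..1}"
  proof
    fix x assume "x \<in> {\<phi> / 2..\<phi>}"
    from pos(1,2)[OF this] show "x \<in> {0..1}" by simp
  qed
  have "continuous_on {\<phi> / 2..\<phi>} (\<lambda>x. w n * x ^ n / tilt_norm w x)"
  proof (intro continuous_on_divide continuous_on_subset[OF tilt_continuous(1) sub])
    show "\<forall>x\<in>{\<phi> / 2..\<phi>}. tilt_norm w x \<noteq> 0"
    proof
      fix x assume "x \<in> {\<phi> / 2..\<phi>}"
      from pos(3)[OF this] show "tilt_norm w x \<noteq> 0" by simp
    qed
  qed (intro continuous_intros)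
  moreover have "continuous_on {\<phi> / 2..\<phi>} (\<lambda>x. ln (1 / x))"
  proof (intro continuous_on_ln continuous_on_divide continuous_on_const continuous_on_id)
    have "x \<noteq> 0 \<and> 1 / x \<noteq> 0" if "x \<in> {\<phi> / 2..\<phi>}" for x using pos(1)[OF that] by simp
    then show "\<forall>x\<in>{\<phi> / 2..\<phi>}. x \<noteq> 0" "\<forall>x\<in>{\<phi> / 2..\<phi>}. 1 / x \<noteq> 0" by blast+
  qed
  ultimately have "continuous_on {\<phi> / 2..\<phi>} h"
    unfolding h_def
    by (intro continuous_on_add continuous_on_mult continuous_on_diff continuous_on_const
        continuous_on_subset[OF tilt_continuous(2) sub])
  then have "(h \<longlongrightarrow> h \<phi>) (at \<phi> within {\<phi> / 2..\<phi>})" using \<phi> by (auto simp: continuous_on_def)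
  moreover have "h \<phi> < w n * \<phi> ^ n / tilt_norm w \<phi> * (exp t - 1) + \<kappa>" using \<kappa> \<phi> by (simp add: h_def)
  ultimately have "\<forall>\<^sub>F x in at \<phi> within {\<phi> / 2..\<phi>}. h x < w n * \<phi> ^ n / tilt_norm w \<phi> * (exp t - 1) + \<kappa>"
    by (rule order_tendstoD(2))
  moreover have "\<forall>\<^sub>F x in at \<phi> within {\<phi> / 2..\<phi>}. x \<in> {\<phi> / 2..\<phi>} \<and> x \<noteq> \<phi>"
    by (auto simp: eventually_at_filter)
  ultimately have "\<forall>\<^sub>F x in at \<phi> within {\<phi> / 2..\<phi>}.
      h x < w n * \<phi> ^ n / tilt_norm w \<phi> * (exp t - 1) + \<kappa> \<and> (x \<in> {\<phi> / 2..\<phi>} \<and> x \<noteq> \<phi>)"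
    by (rule eventually_conj)
  moreover have "at \<phi> within {\<phi> / 2..\<phi>} \<noteq> bot"
    using \<phi>(1) by (subst at_within_Icc_at_left) auto
  ultimately have "\<exists>x. h x < w n * \<phi> ^ n / tilt_norm w \<phi> * (exp t - 1) + \<kappa> \<and> (x \<in> {\<phi> / 2..\<phi>} \<and> x \<noteq> \<phi>)"
    using eventually_happens' by blast
  then obtain x where x: "h x < w n * \<phi> ^ n / tilt_norm w \<phi> * (exp t - 1) + \<kappa>" "\<phi> / 2 \<le> x" "x < \<phi>"
    by force
  have x': "0 < x" "x \<le> 1" using x \<phi> by auto
  have m: "tilt_mean w x < \<rho>" using tilt_mean_strict_mono[of x \<phi>] x x' \<phi> \<rho> by simp
  define r1 where "r1 = (tilt_mean w x + \<rho>) / 2"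
  define r2 where "r2 = 2 * \<rho> - tilt_mean w x"
  have r: "tilt_mean w x < r1" "r1 < \<rho>" "\<rho> < r2" using m by (auto simp: r1_def r2_def)
  have "\<forall>\<^sub>F j in sequentially. r1 * real (l j) \<le> real (N j) \<and> real (N j) \<le> r2 * real (l j)"
    using order_tendstoD(1)[OF N r(2)] order_tendstoD(2)[OF N r(3)] eventually_l_ge[of 1]
    by eventually_elim (simp add: field_simps)
  from site_prob_exponential_bound[OF x' r(1) this, of "\<kappa> / 2" t n] \<kappa>
  have "\<forall>\<^sub>F j in sequentially. t * site_prob (v j) (l j) (N j) n \<le>
     w n * x ^ n / tilt_norm w x * (exp t - 1) + (r2 - tilt_mean w x) * ln (1 / x) + \<kappa> / 2" by simp
  then show "\<forall>\<^sub>F j in sequentially. t * site_prob (v j) (l j) (N j) n \<le>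
      w n * \<phi> ^ n / tilt_norm w \<phi> * (exp t - 1) + \<kappa>"
  proof eventually_elim
    case (elim j)
    have "(r2 - tilt_mean w x) = 2 * (\<rho> - tilt_mean w x)" by (simp add: r2_def)
    with elim x(1) show ?case by (simp add: h_def)
  qed
qed

lemma eventually_Z_pos:
  assumes "filterlim N at_top sequentially"
  shows "\<forall>\<^sub>F j in sequentially. 0 < Z (v j) (l j) (N j)"
proof -
  obtain J where J: "\<forall>\<^sub>F j in sequentially. \<forall>m>J. 0 < Z (v j) (l j) m" using Z_pos by blast
  have "\<forall>\<^sub>F j in sequentially. Suc J \<le> N j" using assms by (auto simp: filterlim_at_top)
  with J show ?thesis by eventually_elim auto
qed

lemma site_prob_limit_0:
  assumes N: "(\<lambda>j. real (N j) / real (l j)) \<longlonglongrightarrow> 0" and N_lim: "filterlim N at_top sequentially"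
  shows "(\<lambda>j. site_prob (v j) (l j) (N j) n) \<longlonglongrightarrow> (if n = 0 then 1 else 0)"
proof -
  have *: "\<forall>\<^sub>F j in sequentially. 0 \<le> site_prob (v j) (l j) (N j) n \<and>
     \<bar>site_prob (v j) (l j) (N j) n - (if n = 0 then 1 else 0)\<bar> \<le> real (N j) / real (l j)"
    using eventually_Z_pos[OF N_lim] v_nonneg eventually_l_ge[of 1] N_lim[unfolded filterlim_at_top, rule_format, of n]
  proof eventually_elim
    case (elim j)
    define p where "p m = site_prob (v j) (l j) (N j) m" for m
    have p0: "0 \<le> p m" for m unfolding p_def by (rule site_prob_nonneg) (use elim in auto)
    have mean: "(\<Sum>m\<le>N j. real m * p m) = real (N j) / real (l j)"
      using sum_mean_site_prob[of "l j" "v j" "N j"] elim by (simp add: p_def field_simps)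
    have total: "(\<Sum>m\<le>N j. p m) = 1" unfolding p_def by (rule sum_site_prob) (use elim in auto)
    show ?case
    proof (cases "n = 0")
      case True
      have "(\<Sum>m\<le>N j. p m) = p 0 + (\<Sum>m\<in>{..N j} - {0}. p m)" by (rule sum.remove) auto
      moreover have "(\<Sum>m\<in>{..N j} - {0}. p m) \<le> (\<Sum>m\<in>{..N j} - {0}. real m * p m)"
      proof (rule sum_mono)
        fix m assume "m \<in> {..N j} - {0}"
        then have "1 * p m \<le> real m * p m" by (intro mult_right_mono p0) auto
        then show "p m \<le> real m * p m" by simp
      qed
      moreover have "(\<Sum>m\<in>{..N j} - {0}. real m * p m) \<le> (\<Sum>m\<le>N j. real m * p m)"
        by (intro sum_mono2) (auto intro!: mult_nonneg_nonneg p0)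
      moreover have "0 \<le> (\<Sum>m\<in>{..N j} - {0}. p m)" by (intro sum_nonneg p0)
      ultimately have "\<bar>p 0 - 1\<bar> \<le> real (N j) / real (l j)" using mean total by linarith
      then show ?thesis using True p0[of 0] by (simp add: p_def)
    next
      case False
      have "1 * p n \<le> real n * p n" using False by (intro mult_right_mono p0) auto
      also have "\<dots> \<le> (\<Sum>m\<le>N j. real m * p m)" using elim by (intro member_le_sum) (auto intro!: mult_nonneg_nonneg p0)
      finally show ?thesis using False p0[of n] mean by (simp add: p_def)
    qed
  qed
  have "(\<lambda>j. site_prob (v j) (l j) (N j) n - (if n = 0 then 1 else 0)) \<longlonglongrightarrow> 0"
    by (rule Lim_null_comparison[OF _ N]) (use * in \<open>auto elim: eventually_mono\<close>)
  then show ?thesis by (simp add: LIM_zero_iff)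
qed

lemma ex_tilted_pmf:
  assumes \<phi>: "0 \<le> \<phi>" "\<phi> \<le> 1"
  shows "\<exists>\<nu>. (\<forall>n. pmf \<nu> n = w n * \<phi> ^ n / tilt_norm w \<phi>) \<and> pmf_mean \<nu> = ennreal (tilt_mean w \<phi>)"
proof -
  obtain J where J: "\<forall>n>J. w n = 0" using w_support by blast
  define f where "f n = w n * \<phi> ^ n / tilt_norm w \<phi>" for n
  have f0: "0 \<le> f n" for n using \<phi> w_nonneg tilt_norm_pos[of \<phi>] by (simp add: f_def)
  have fJ: "f n = 0" if "n > J" for n using J that by (simp add: f_def)
  have total: "(\<Sum>n\<le>J. f n) = 1"
    using tilt_norm_pos[OF \<phi>] unfolding f_def sum_divide_distrib[symmetric] by (simp add: sum_cutoff(3)[OF J])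
  have "(\<integral>\<^sup>+n. ennreal (f n) \<partial>count_space UNIV) = (\<Sum>n\<le>J. ennreal (f n))"
    by (rule nn_integral_count_space') (use fJ in \<open>auto simp: not_le[symmetric]\<close>)
  also have "\<dots> = 1" using total f0 by (simp add: sum_ennreal)
  finally have int: "(\<integral>\<^sup>+n. ennreal (f n) \<partial>count_space UNIV) = 1" .
  define \<nu> where "\<nu> = embed_pmf f"
  have pmf: "pmf \<nu> n = f n" for n unfolding \<nu>_def by (rule pmf_embed_pmf[OF f0 int])
  have supp: "set_pmf \<nu> \<subseteq> {..J}" using fJ pmf by (force simp: set_pmf_iff not_le[symmetric])
  then have "finite (set_pmf \<nu>)" using finite_subset by blast
  then have "pmf_mean \<nu> = ennreal (LINT n|measure_pmf \<nu>. real n)"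
    unfolding pmf_mean_def ennreal_of_nat_eq_real_of_nat
    by (intro nn_integral_eq_integral integrable_measure_pmf_finite) auto
  also have "(LINT n|measure_pmf \<nu>. real n) = (\<Sum>n\<le>J. real n * pmf \<nu> n)"
    by (rule integral_measure_pmf_real) (use supp in auto)
  also have "\<dots> = tilt_mean w \<phi>"
    unfolding pmf f_def sum_cutoff(4)[OF J] sum_cutoff(3)[OF J] by (simp add: sum_divide_distrib mult.assoc)
  finally show ?thesis using pmf by (auto simp: f_def)
qed

lemma site_prob_limit:
  assumes N: "(\<lambda>j. real (N j) / real (l j)) \<longlonglongrightarrow> \<rho>" and N_lim: "filterlim N at_top sequentially"
    and \<phi>: "\<phi> = 1 \<and> critical_density w \<le> \<rho> \<or> 0 \<le> \<phi> \<and> \<phi> \<le> 1 \<and> tilt_mean w \<phi> = \<rho> \<and> (\<rho> = 0 \<longrightarrow> \<phi> = 0)"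
  shows "(\<lambda>j. site_prob (v j) (l j) (N j) n) \<longlonglongrightarrow> w n * \<phi> ^ n / tilt_norm w \<phi>"
proof -
  have norm1: "tilt_norm w 1 = 1" using w_sums by (simp add: tilt_norm_def sums_iff)
  consider "\<phi> = 1" "critical_density w < \<rho>" | "0 < \<rho>" "0 < \<phi>" "\<phi> \<le> 1" "tilt_mean w \<phi> = \<rho>"
    | "\<rho> = 0" "\<phi> = 1 \<and> critical_density w = 0 \<or> \<phi> = 0"
  proof -
    have \<rho>0: "0 \<le> \<rho>" by (rule tendsto_lowerbound[OF N]) auto
    show ?thesis
    proof (cases "\<rho> = 0")
      case True
      then show ?thesis using \<phi> critical_density_nonneg that(3) by force
    next
      case False
      show ?thesis
      proof (cases "\<phi> = 1 \<and> critical_density w < \<rho>")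
        case True
        then show ?thesis using that(1) by blast
      next
        case 1: False
        then have "0 \<le> \<phi> \<and> \<phi> \<le> 1 \<and> tilt_mean w \<phi> = \<rho>" using \<phi> tilt_mean_1 by auto
        moreover from this have "\<phi> \<noteq> 0" using False tilt_mean_0 by auto
        ultimately show ?thesis using that(2) False \<rho>0 by force
      qed
    qed
  qed
  then show ?thesis
  proof cases
    case 1
    define \<delta> where "\<delta> = (\<rho> - critical_density w) / 2"
    have "0 < \<delta>" "critical_density w + \<delta> < \<rho>" "\<rho> < \<rho> + 1" using 1 by (auto simp: \<delta>_def field_simps)
    from site_prob_supercritical[OF this(1) eventually_supercritical_range[OF N this(2,3)]]
    show ?thesis by (simp add: 1 norm1)
  next
    case 2
    show ?thesis by (rule site_prob_tilted_limit[OF N 2(2-4,1)])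
  next
    case 3
    have lim: "(\<lambda>j. site_prob (v j) (l j) (N j) n) \<longlonglongrightarrow> (if n = 0 then 1 else 0)"
      using N N_lim unfolding 3(1) by (rule site_prob_limit_0)
    have "(if n = 0 then 1 else 0) = w n * \<phi> ^ n / tilt_norm w \<phi>"
    proof (cases "\<phi> = 0")
      case True
      have "tilt_norm w 0 = (\<Sum>n\<in>{0}. w n * 0 ^ n)"
        unfolding tilt_norm_def by (rule suminf_finite) auto
      then have "tilt_norm w 0 = w 0" by simp
      then show ?thesis using True w0 by (simp add: power_0_left)
    next
      case False
      then have \<phi>1: "\<phi> = 1" "critical_density w = 0" using 3 by auto
      obtain J where J: "\<forall>n>J. w n = 0" using w_support by blast
      \<comment> \<open>A vanishing mean leaves no weight outside 0.\<close>
      have wz: "w n = 0" if "n \<noteq> 0" for n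
      proof (cases "n \<le> J")
        case True
        have "real n * w n \<le> (\<Sum>n\<le>J. real n * w n)"
          by (rule member_le_sum) (use True w_nonneg in auto)
        then have "real n * w n \<le> 0" using \<phi>1 by (simp add: sum_cutoff(2)[OF J])
        then show ?thesis using w_nonneg[of n] that by (simp add: mult_le_0_iff)
      qed (use J in auto)
      have "w 0 = (\<Sum>n\<le>J. w n)" by (subst sum.remove[of _ 0]) (auto simp: wz)
      then show ?thesis using \<phi>1 wz by (simp add: norm1 sum_cutoff(1)[OF J])
    qed
    with lim show ?thesis by simp
  qed
qed

end

section \<open>Integrals against the canonical distribution\<close>

lemma integral_canonical:
  fixes f :: "nat list \<Rightarrow> real"
  assumes "\<And>n. 0 \<le> v n"
  shows "(LINT \<eta>|canonical v l N. f \<eta>) = (\<Sum>\<eta>\<in>configs l N. config_weight v \<eta> * f \<eta>) / Z v l N"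
  unfolding canonical_def
  by (subst lebesgue_integral_point_measure_finite)
     (auto intro!: divide_nonneg_nonneg config_weight_nonneg Z_nonneg assms simp: sum_divide_distrib)

lemma measurable_canonical:
  "f \<in> space (canonical v l N) \<rightarrow> space M \<Longrightarrow> f \<in> canonical v l N \<rightarrow>\<^sub>M M"
  by (auto simp: measurable_def canonical_def sets_point_measure space_point_measure)

lemma prob_space_canonical:
  assumes v: "\<And>n. 0 \<le> v n" and Z: "0 < Z v l N"
  shows "prob_space (canonical v l N)"
proof
  have "emeasure (canonical v l N) (space (canonical v l N)) =
     (\<Sum>\<eta>\<in>configs l N. ennreal (config_weight v \<eta> / Z v l N))"
    by (simp add: canonical_def space_point_measure emeasure_point_measure_finite)
  also have "\<dots> = ennreal (\<Sum>\<eta>\<in>configs l N. config_weight v \<eta> / Z v l N)"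
    by (intro sum_ennreal divide_nonneg_nonneg config_weight_nonneg Z_nonneg v)
  also have "(\<Sum>\<eta>\<in>configs l N. config_weight v \<eta> / Z v l N) = 1"
    using Z by (simp add: sum_divide_distrib[symmetric] partition_function_def)
  finally show "emeasure (canonical v l N) (space (canonical v l N)) = 1" by simp
qed

lemma integral_site_marginal:
  fixes f :: "nat \<Rightarrow> real"
  assumes v: "\<And>n. 0 \<le> v n" and x: "x < l"
  shows "(LINT n:UNIV|site_marginal v l N x. f n) = (\<Sum>n\<le>N. site_prob v l N n * f n)"
proof -
  obtain k where k: "l = Suc k" using x by (cases l) auto
  have "(LINT n:UNIV|site_marginal v l N x. f n) = (LINT \<eta>|canonical v l N. f (\<eta> ! x))"
    unfolding set_lebesgue_integral_def site_marginal_def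
    by (subst integral_distr) (auto intro: measurable_canonical)
  also have "\<dots> = (\<Sum>\<eta>\<in>configs (Suc k) N. (\<lambda>n \<eta>'. v n * config_weight v \<eta>' * f n) (\<eta> ! x) (remove_site x \<eta>)) / Z v l N"
    unfolding integral_canonical[OF v] k
    by (intro arg_cong2[where f = "(/)"] sum.cong refl)
       (use x k in \<open>auto simp: configs_def config_weight_remove_site\<close>)
  also have "(\<Sum>\<eta>\<in>configs (Suc k) N. (\<lambda>n \<eta>'. v n * config_weight v \<eta>' * f n) (\<eta> ! x) (remove_site x \<eta>)) =
      (\<Sum>n\<le>N. \<Sum>\<eta>'\<in>configs k (N - n). v n * config_weight v \<eta>' * f n)"
    by (rule sum_configs_pick_site) (use x k in simp)
  also have "\<dots> / Z v l N = (\<Sum>n\<le>N. site_prob v l N n * f n)"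
    by (simp add: site_prob_def k sum_divide_distrib partition_function_def sum_distrib_left sum_distrib_right)
  finally show ?thesis .
qed

text \<open>Pointwise convergence of mass functions suffices because the limit puts total mass 1 on
  \<open>{..J}\<close>: the mass of the marginals beyond \<open>J\<close> must vanish, and it bounds
  the error for a bounded test function.\<close>

lemma weakly_converges_site_marginal:
  assumes v: "\<forall>\<^sub>F k in sequentially. \<forall>n. 0 \<le> v k n" and Z: "\<forall>\<^sub>F k in sequentially. 0 < Z (v k) (L k) (N k)"
    and L: "filterlim L at_top sequentially" and N: "filterlim N at_top sequentially"
    and lim: "\<And>n. (\<lambda>k. site_prob (v k) (L k) (N k) n) \<longlonglongrightarrow> pmf \<nu> n"
    and supp: "set_pmf \<nu> \<subseteq> {..J}"
  shows "weakly_converges_on UNIV (\<lambda>k. site_marginal (v k) (L k) (N k) x) (measure_pmf \<nu>)"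
  unfolding weakly_converges_on_def
proof (intro allI impI)
  fix f :: "nat \<Rightarrow> real" assume "bounded (f ` UNIV)"
  then obtain b where b: "\<And>n. \<bar>f n\<bar> \<le> b" by (auto simp: bounded_iff)
  define p where "p k n = site_prob (v k) (L k) (N k) n" for k n
  have int: "(LINT n:UNIV|measure_pmf \<nu>. f n) = (\<Sum>n\<le>J. pmf \<nu> n * f n)"
    unfolding set_lebesgue_integral_def
    by (subst integral_measure_pmf_real[of "{..J}"]) (use supp in \<open>auto simp: mult.commute\<close>)
  have one: "(\<Sum>n\<le>J. pmf \<nu> n) = 1" using supp by (intro sum_pmf_eq_1) auto
  have bulk: "(\<lambda>k. \<Sum>n\<le>J. p k n * f n) \<longlonglongrightarrow> (\<Sum>n\<le>J. pmf \<nu> n * f n)"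
    unfolding p_def by (intro tendsto_intros lim)
  have "(\<lambda>k. (LINT n:UNIV|site_marginal (v k) (L k) (N k) x. f n) - (\<Sum>n\<le>J. p k n * f n)) \<longlonglongrightarrow> 0"
  proof (rule Lim_null_comparison)
    have "(\<lambda>k. b * (1 - (\<Sum>n\<le>J. p k n))) \<longlonglongrightarrow> b * (1 - (\<Sum>n\<le>J. pmf \<nu> n))"
      unfolding p_def by (intro tendsto_intros lim)
    then show "(\<lambda>k. b * (1 - (\<Sum>n\<le>J. p k n))) \<longlonglongrightarrow> 0" by (simp add: one)
    show "\<forall>\<^sub>F k in sequentially. norm ((LINT n:UNIV|site_marginal (v k) (L k) (N k) x. f n) - (\<Sum>n\<le>J. p k n * f n))
        \<le> b * (1 - (\<Sum>n\<le>J. p k n))"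
      using v Z L[unfolded filterlim_at_top, rule_format, of "Suc x"] N[unfolded filterlim_at_top, rule_format, of J]
    proof eventually_elim
      case (elim k)
      have p0: "0 \<le> p k n" for n unfolding p_def by (rule site_prob_nonneg) (use elim in auto)
      have total: "(\<Sum>n\<le>N k. p k n) = 1" unfolding p_def by (rule sum_site_prob) (use elim in auto)
      have split: "(\<Sum>n\<le>N k. g n) = (\<Sum>n\<le>J. g n) + (\<Sum>n\<in>{J<..N k}. g n)" for g :: "nat \<Rightarrow> real"
      proof -
        have "{..N k} = {..J} \<union> {J<..N k}" using elim by auto
        then show ?thesis by (simp add: sum.union_disjoint ivl_disj_int)
      qed
      have "(LINT n:UNIV|site_marginal (v k) (L k) (N k) x. f n) = (\<Sum>n\<le>N k. p k n * f n)"
        unfolding p_def by (rule integral_site_marginal) (use elim in auto)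
      then have "norm ((LINT n:UNIV|site_marginal (v k) (L k) (N k) x. f n) - (\<Sum>n\<le>J. p k n * f n)) =
          \<bar>\<Sum>n\<in>{J<..N k}. p k n * f n\<bar>" by (simp add: split)
      also have "\<dots> \<le> (\<Sum>n\<in>{J<..N k}. \<bar>p k n * f n\<bar>)" by (rule sum_abs)
      also have "\<dots> \<le> (\<Sum>n\<in>{J<..N k}. p k n * b)"
        by (intro sum_mono) (use p0 b in \<open>auto simp: abs_mult intro!: mult_left_mono\<close>)
      also have "\<dots> = b * (1 - (\<Sum>n\<le>J. p k n))"
        using total split[of "p k"] by (simp add: sum_distrib_right[symmetric])
      finally show ?case .
    qed
  qed
  from tendsto_add[OF this bulk] show "(\<lambda>k. (LINT n:UNIV|site_marginal (v k) (L k) (N k) x. f n)) \<longlonglongrightarrow> (LINT n:UNIV|measure_pmf \<nu>. f n)"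
    by (simp add: int)
qed


section \<open>The limit theorem\<close>

lemma sum_sorted_config:
  assumes "length \<eta> = l"
  shows "(\<Sum>i<l. h (rev (sort \<eta>) ! i)) = sum_list (map h \<eta>)"
proof -
  have "(\<Sum>i<l. h (rev (sort \<eta>) ! i)) = sum_list (map h (rev (sort \<eta>)))"
    by (rule sum_nth_eq_sum_list) (use assms in simp)
  also have "\<dots> = sum_mset (image_mset h (mset (rev (sort \<eta>))))" by (metis mset_map sum_mset_sum_list)
  also have "\<dots> = sum_list (map h \<eta>)" by (metis mset_map sum_mset_sum_list mset_rev mset_sort)
  finally show ?thesis .
qed

lemma to_partition_in_mass_partitions:
  assumes \<eta>: "\<eta> \<in> configs l N" and N: "0 < N"
  shows "to_partition l N \<eta> \<in> mass_partitions"
proof -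
  define p where "p = to_partition l N \<eta>"
  have len: "length \<eta> = l" and total: "sum_list \<eta> = N" using \<eta> by (auto simp: configs_def)
  have p0: "0 \<le> p i" for i by (simp add: p_def to_partition_def)
  have "(\<Sum>i<l. real (rev (sort \<eta>) ! i)) = sum_list (map real \<eta>)" by (rule sum_sorted_config[OF len])
  also have "\<dots> = real N" unfolding total[symmetric] by (induction \<eta>) auto
  finally have one: "(\<Sum>i<l. p i) = 1"
    using N by (simp add: p_def to_partition_def sum_divide_distrib[symmetric])
  have le: "(\<Sum>i<n. p i) \<le> 1" for n
  proof -
    have "(\<Sum>i<n. p i) \<le> (\<Sum>i<max n l. p i)" by (rule sum_mono2) (use p0 in auto)
    also have "\<dots> = (\<Sum>i<l. p i)" by (rule sum.mono_neutral_right) (auto simp: p_def to_partition_def)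
    finally show ?thesis using one by simp
  qed
  have "p i \<le> 1" for i
  proof -
    have "p i \<le> (\<Sum>i<Suc i. p i)" by (rule member_le_sum) (use p0 in auto)
    then show ?thesis using le[of "Suc i"] by linarith
  qed
  moreover have "p (Suc i) \<le> p i" for i
  proof (cases "Suc i < l")
    case True
    have "sort \<eta> ! (l - Suc (Suc i)) \<le> sort \<eta> ! (l - Suc i)"
      by (rule sorted_nth_mono) (use True len in auto)
    then have "rev (sort \<eta>) ! Suc i \<le> rev (sort \<eta>) ! i" using True len by (simp add: rev_nth)
    then show ?thesis using True by (simp add: p_def to_partition_def divide_right_mono)
  next
    case False
    then show ?thesis using p0[of i] by (simp add: p_def to_partition_def)
  qed
  ultimately show ?thesis using p0 le by (simp add: mass_partitions_eq p_def)
qed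

lemma partition_sum_to_partition:
  assumes \<eta>: "\<eta> \<in> configs l N" and a: "1 \<le> a"
  shows "partition_sum a (to_partition l N \<eta>) = power_sum a \<eta> / real N ^ a"
proof -
  have len: "length \<eta> = l" using \<eta> by (auto simp: configs_def)
  have "partition_sum a (to_partition l N \<eta>) = (\<Sum>i<l. to_partition l N \<eta> i ^ a)"
    unfolding partition_sum_def by (rule suminf_finite) (use a in \<open>auto simp: to_partition_def\<close>)
  also have "\<dots> = (\<Sum>i<l. real (rev (sort \<eta>) ! i) ^ a) / real N ^ a"
    by (simp add: to_partition_def power_divide sum_divide_distrib)
  also have "(\<Sum>i<l. real (rev (sort \<eta>) ! i) ^ a) = power_sum a \<eta>"
    unfolding power_sum_def by (rule sum_sorted_config[OF len])
  finally show ?thesis .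
qed

lemma to_partition_measurable: "to_partition l N \<in> canonical v l N \<rightarrow>\<^sub>M borel"
  by (rule measurable_canonical) auto

lemma integral_partition_law:
  assumes v: "\<And>n. 0 \<le> v n" and N: "0 < N" and a: "\<And>i. 2 \<le> a i"
  shows "(LINT p:mass_partitions|partition_law v l N. (\<Prod>i<(n::nat). partition_sum (a i) p)) =
    normalised_moment a v l N {..<n}"
proof -
  have a1: "1 \<le> a i" for i using a[of i] by linarith
  have meas: "(\<lambda>p. indicator mass_partitions p *\<^sub>R (\<Prod>i<n. partition_sum (a i) p)) \<in> borel_measurable borel"
    by (intro measurable_indicator_mass_partitions continuous_on_prod continuous_on_partition_sum a)
  have "(LINT p:mass_partitions|partition_law v l N. (\<Prod>i<n. partition_sum (a i) p)) =
     (\<Sum>\<eta>\<in>configs l N. config_weight v \<eta> * (indicator mass_partitions (to_partition l N \<eta>) *\<^sub>R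
        (\<Prod>i<n. partition_sum (a i) (to_partition l N \<eta>)))) / Z v l N"
    unfolding set_lebesgue_integral_def partition_law_def
    by (subst integral_distr[OF to_partition_measurable meas]) (rule integral_canonical[OF v])
  also have "\<dots> = (\<Sum>\<eta>\<in>configs l N. config_weight v \<eta> * (\<Prod>i<n. power_sum (a i) \<eta>) / real N ^ (\<Sum>i<n. a i)) / Z v l N"
  proof (intro arg_cong2[where f = "(/)"] sum.cong refl)
    fix \<eta> assume \<eta>: "\<eta> \<in> configs l N"
    have "(\<Prod>i<n. partition_sum (a i) (to_partition l N \<eta>)) = (\<Prod>i<n. power_sum (a i) \<eta> / real N ^ a i)"
      by (intro prod.cong refl partition_sum_to_partition[OF \<eta> a1])
    then show "config_weight v \<eta> * (indicator mass_partitions (to_partition l N \<eta>) *\<^sub>R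
        (\<Prod>i<n. partition_sum (a i) (to_partition l N \<eta>))) =
        config_weight v \<eta> * (\<Prod>i<n. power_sum (a i) \<eta>) / real N ^ (\<Sum>i<n. a i)"
      using to_partition_in_mass_partitions[OF \<eta> N] by (simp add: prod_dividef power_sum)
  qed
  also have "\<dots> = normalised_moment a v l N {..<n}"
    by (simp add: normalised_moment_def moment_sum_def sum_divide_distrib[symmetric] mult.commute)
  finally show ?thesis .
qed

context condensing_weights
begin

text \<open>All factors but one are bounded by 1, and that one by the fraction of mass at sites with
  more than \<open>J\<close> particles plus a term of order 1 / N. At the critical density the bulk
  carries all mass, so this fraction tends to 0.\<close>

lemma normalised_moment_critical:
  assumes N: "(\<lambda>j. real (N j) / real (l j)) \<longlonglongrightarrow> critical_density w" and pos: "0 < critical_density w"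
    and N_lim: "filterlim N at_top sequentially"
    and a: "\<And>i. 2 \<le> a i" and I: "finite I" "I \<noteq> {}"
  shows "(\<lambda>j. normalised_moment a (v j) (l j) (N j) I) \<longlonglongrightarrow> 0"
proof -
  define \<rho> where "\<rho> = critical_density w"
  obtain J where J: "\<forall>n>J. w n = 0" using w_support by blast
  obtain k where k: "k \<in> I" using I by blast
  have a1: "1 \<le> a i" for i using a[of i] by linarith
  have norm1: "tilt_norm w 1 = 1" using w_sums by (simp add: tilt_norm_def sums_iff)
  have p_lim: "(\<lambda>j. site_prob (v j) (l j) (N j) n) \<longlonglongrightarrow> w n" for n
    using site_prob_limit[OF N N_lim, of 1 n] by (simp add: norm1)
  \<comment> \<open>The term \<open>J / N j\<close> accounts for sites with at most \<open>J\<close>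
    particles, each of relative size at most \<open>J / N j\<close>; the remainder is the fraction
    of mass at larger sites.\<close>
  define u where "u j = real J / real (N j) + 1 -
     (\<Sum>n\<le>J. real n * site_prob (v j) (l j) (N j) n) / (real (N j) / real (l j))" for j
  have N_real: "filterlim (\<lambda>j. real (N j)) at_top sequentially"
    by (rule filterlim_compose[OF filterlim_real_sequentially N_lim])
  have "u \<longlonglongrightarrow> 0 + 1 - (\<Sum>n\<le>J. real n * w n) / \<rho>"
    unfolding u_def \<rho>_def
    by (intro tendsto_add tendsto_diff tendsto_divide tendsto_sum tendsto_mult tendsto_const p_lim N
        real_tendsto_divide_at_top[OF tendsto_const N_real]) (use pos in auto)
  also have "0 + 1 - (\<Sum>n\<le>J. real n * w n) / \<rho> = 0"
    using pos by (simp add: \<rho>_def sum_cutoff(2)[OF J, symmetric])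
  finally have u_lim: "u \<longlonglongrightarrow> 0" .
  show ?thesis
  proof (rule Lim_null_comparison[OF _ u_lim])
    show "\<forall>\<^sub>F j in sequentially. norm (normalised_moment a (v j) (l j) (N j) I) \<le> u j"
      using v_nonneg eventually_Z_pos[OF N_lim] eventually_l_ge[of 1]
        N_lim[unfolded filterlim_at_top, rule_format, of "Suc J"]
    proof eventually_elim
      case (elim j)
      define n where "n = N j"
      define p where "p m = site_prob (v j) (l j) n m" for m
      have n0: "0 < real n" "J \<le> n" using elim by (auto simp: n_def)
      have v0: "0 \<le> v j i" for i using elim by blast
      have p0: "0 \<le> p m" for m unfolding p_def by (rule site_prob_nonneg) (use elim in auto)
      have mean: "(\<Sum>m\<le>n. real m * p m) = real n / real (l j)"
        using sum_mean_site_prob[of "l j" "v j" n] elim by (simp add: p_def n_def field_simps)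
      obtain l' where l': "l j = Suc l'" using elim(3) by (cases "l j") auto
      have "moment_sum a (v j) (l j) n I \<le> moment_sum a (v j) (l j) n {k} * real n ^ (\<Sum>i\<in>I - {k}. a i)"
        unfolding moment_sum_def sum_distrib_right
      proof (rule sum_mono)
        fix \<eta> assume \<eta>: "\<eta> \<in> configs (l j) n"
        have "(\<Prod>i\<in>I. power_sum (a i) \<eta>) = power_sum (a k) \<eta> * (\<Prod>i\<in>I - {k}. power_sum (a i) \<eta>)"
          by (rule prod.remove[OF I(1) k])
        also have "\<dots> \<le> power_sum (a k) \<eta> * (\<Prod>i\<in>I - {k}. real n ^ a i)"
        proof (intro mult_left_mono prod_mono conjI power_sum_nonneg)
          show "power_sum (a i) \<eta> \<le> real n ^ a i" for i
            using power_sum_le[OF a1[of i], of \<eta>] \<eta> by (simp add: configs_def)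
        qed
        finally show "config_weight (v j) \<eta> * (\<Prod>i\<in>I. power_sum (a i) \<eta>) \<le>
            config_weight (v j) \<eta> * (\<Prod>i\<in>{k}. power_sum (a i) \<eta>) * real n ^ (\<Sum>i\<in>I - {k}. a i)"
          using config_weight_nonneg[of "v j" \<eta>, OF v0] by (simp add: power_sum mult_left_mono mult.assoc)
      qed
      also have "moment_sum a (v j) (l j) n {k} = real (l j) * (\<Sum>m\<le>n. v j m * real m ^ a k * Z (v j) l' (n - m))"
        unfolding l' by (subst moment_sum_rec[of "{k}" k]) auto
      also have "\<dots> = real (l j) * (\<Sum>m\<le>n. real m ^ a k * p m) * Z (v j) (l j) n"
      proof -
        have "v j m * real m ^ a k * Z (v j) l' (n - m) = real m ^ a k * p m * Z (v j) (l j) n" if "m \<le> n" for m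
          using elim(2) that by (simp add: p_def site_prob_def l' n_def)
        then have "(\<Sum>m\<le>n. v j m * real m ^ a k * Z (v j) l' (n - m)) =
            (\<Sum>m\<le>n. real m ^ a k * p m) * Z (v j) (l j) n"
          unfolding sum_distrib_right by (intro sum.cong) auto
        then show ?thesis by simp
      qed
      finally have le: "moment_sum a (v j) (l j) n I \<le>
         real (l j) * (\<Sum>m\<le>n. real m ^ a k * p m) * Z (v j) (l j) n * real n ^ (\<Sum>i\<in>I - {k}. a i)" .
      have s: "(\<Sum>i\<in>I. a i) = a k + (\<Sum>i\<in>I - {k}. a i)" by (rule sum.remove[OF I(1) k])
      have "normalised_moment a (v j) (l j) n I \<le>
         (real (l j) * (\<Sum>m\<le>n. real m ^ a k * p m) * Z (v j) (l j) n * real n ^ (\<Sum>i\<in>I - {k}. a i)) /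
         (Z (v j) (l j) n * real n ^ (\<Sum>i\<in>I. a i))"
        unfolding normalised_moment_def using elim(2) by (intro divide_right_mono le) (auto simp: n_def)
      also have "\<dots> = real (l j) * (\<Sum>m\<le>n. (real m / real n) ^ a k * p m)"
      proof -
        have "(\<Sum>m\<le>n. (real m / real n) ^ a k * p m) = (\<Sum>m\<le>n. real m ^ a k * p m) / real n ^ a k"
          by (simp add: power_divide sum_divide_distrib)
        then show ?thesis using elim(2) n0 by (simp add: s power_add n_def)
      qed
      \<comment> \<open>With relative size \<open>q = m / n\<close> one has
        \<open>q ^ a k \<le> q * q\<close>; one factor \<open>q\<close> is bounded by
        \<open>J / n\<close> for small sites and by 1 for large ones.\<close>
      also have "\<dots> \<le> real (l j) * (\<Sum>m\<le>n. real J / real n * (real m * p m / real n) +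
          (if m \<le> J then 0 else real m * p m / real n))"
      proof (intro mult_left_mono sum_mono)
        fix m assume m: "m \<in> {..n}"
        define q where "q = real m / real n"
        have q: "0 \<le> q" "q \<le> 1" using m n0 by (auto simp: q_def)
        have "q ^ a k \<le> q ^ 2" using q a by (intro power_decreasing) auto
        also have "\<dots> = q * q" by (simp add: power2_eq_square)
        also have "q * q \<le> real J / real n * q + (if m \<le> J then 0 else q)"
        proof (cases "m \<le> J")
          case True
          then have "q \<le> real J / real n" using n0 by (simp add: q_def divide_right_mono)
          then have "q * q \<le> real J / real n * q" using q(1) by (rule mult_right_mono)
          then show ?thesis using True by simp
        next
          case False
          have "q * q \<le> 1 * q" using q by (intro mult_right_mono)
          moreover have "0 \<le> real J / real n * q" using q by simp
          ultimately show ?thesis using False by simp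
        qed
        finally have "q ^ a k * p m \<le> (real J / real n * q + (if m \<le> J then 0 else q)) * p m"
          by (intro mult_right_mono p0)
        then show "(real m / real n) ^ a k * p m \<le> real J / real n * (real m * p m / real n) +
          (if m \<le> J then 0 else real m * p m / real n)"
          by (auto simp: q_def algebra_simps)
      qed simp
      also have "\<dots> = real (l j) / real n * (real J / real n * (\<Sum>m\<le>n. real m * p m) +
          ((\<Sum>m\<le>n. real m * p m) - (\<Sum>m\<le>J. real m * p m)))"
      proof -
        have "(\<Sum>m\<le>n. if m \<le> J then 0 else real m * p m / real n) =
            (\<Sum>m\<le>n. real m * p m / real n) - (\<Sum>m\<le>n. if m \<le> J then real m * p m / real n else 0)"
          unfolding sum_subtractf[symmetric] by (intro sum.cong) auto
        also have "(\<Sum>m\<le>n. if m \<le> J then real m * p m / real n else 0) = (\<Sum>m\<in>{m \<in> {..n}. m \<le> J}. real m * p m / real n)"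
          by (rule sum.inter_filter[symmetric]) simp
        also have "{m \<in> {..n}. m \<le> J} = {..J}" using n0 by auto
        finally have C: "(\<Sum>m\<le>n. if m \<le> J then 0 else real m * p m / real n) =
            ((\<Sum>m\<le>n. real m * p m) - (\<Sum>m\<le>J. real m * p m)) / real n"
          by (simp add: sum_divide_distrib diff_divide_distrib)
        have "L * (x * (y / z) + (y - t) / z) = L / z * (x * y + (y - t))" for L x y z t :: real
          by (simp add: add_divide_distrib diff_divide_distrib algebra_simps)
        then show ?thesis
          unfolding sum.distrib sum_distrib_left[symmetric] C sum_divide_distrib[symmetric] by blast
      qed
      also have "\<dots> = u j" using n0 elim(3) unfolding mean u_def
        by (simp add: n_def p_def field_simps)
      finally have "normalised_moment a (v j) (l j) (N j) I \<le> u j" by (simp add: n_def)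
      moreover have "0 \<le> normalised_moment a (v j) (l j) (N j) I"
        by (rule normalised_moment_bounds(1)) (use v0 a1 in auto)
      ultimately show ?case by simp
    qed
  qed
qed

lemma partition_law_limit:
  assumes N: "(\<lambda>j. real (N j) / real (l j)) \<longlonglongrightarrow> \<rho>" and N_lim: "filterlim N at_top sequentially"
    and \<rho>: "0 < \<rho>" "critical_density w \<le> \<rho>"
  shows "weakly_converges_on mass_partitions (\<lambda>j. partition_law (v j) (l j) (N j))
     (scaled_poisson_dirichlet (1 - critical_density w / \<rho>) \<theta>)"
proof (rule weakly_converges_on_mass_partitions)
  define \<alpha> where "\<alpha> = 1 - critical_density w / \<rho>"
  have \<alpha>: "0 \<le> \<alpha>" "\<alpha> \<le> 1" using \<rho> critical_density_nonneg by (auto simp: \<alpha>_def)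
  show "\<forall>\<^sub>F j in sequentially. prob_space (partition_law (v j) (l j) (N j))"
    using v_nonneg eventually_Z_pos[OF N_lim]
  proof eventually_elim
    case (elim j)
    then have "prob_space (canonical (v j) (l j) (N j))" by (intro prob_space_canonical) auto
    then show ?case unfolding partition_law_def
      by (rule prob_space.prob_space_distr) (rule to_partition_measurable)
  qed
  show "prob_space (scaled_poisson_dirichlet (1 - critical_density w / \<rho>) \<theta>)"
    by (rule prob_space_scaled_poisson_dirichlet[OF theta_pos])
  fix a :: "nat \<Rightarrow> nat" and n :: nat assume a: "\<And>i. 2 \<le> a i"
  have a1: "1 \<le> a i" for i using a[of i] by linarith
  have meas: "(\<lambda>p. indicator mass_partitions p *\<^sub>R (\<Prod>i<n. partition_sum (a i) p)) \<in> borel_measurable borel"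
    by (intro measurable_indicator_mass_partitions continuous_on_prod continuous_on_partition_sum a)
  have rhs: "(LINT p:mass_partitions|scaled_poisson_dirichlet \<alpha> \<theta>. (\<Prod>i<n. partition_sum (a i) p)) =
      \<alpha> ^ (\<Sum>i<n. a i) * gem_moment \<theta> a {..<n}"
    by (rule integral_scaled_poisson_dirichlet[OF theta_pos \<alpha> a1 meas])
  have "(\<lambda>j. normalised_moment a (v j) (l j) (N j) {..<n}) \<longlonglongrightarrow> \<alpha> ^ (\<Sum>i<n. a i) * gem_moment \<theta> a {..<n}"
  proof (cases "critical_density w < \<rho>")
    case True
    show ?thesis unfolding \<alpha>_def
      by (rule normalised_moment_limit[where c = "gem_moment \<theta> a", OF theta_pos a
            gem_moment_empty[OF theta_pos] gem_moment_rec[OF theta_pos a1] _ condensing_weights_axioms N True]) auto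
  next
    case False
    then have eq: "critical_density w = \<rho>" using \<rho> by simp
    then have \<alpha>0: "\<alpha> = 0" using \<rho> by (simp add: \<alpha>_def)
    \<comment> \<open>At criticality \<open>\<alpha> = 0\<close>. The empty product has moment 1 on
      both sides; any other product has a positive total exponent, so the right side
      vanishes.\<close>
    show ?thesis
    proof (cases "n = 0")
      case True
      have "(\<lambda>j. normalised_moment a (v j) (l j) (N j) {}) \<longlonglongrightarrow> 1"
        by (rule Lim_transform_eventually[OF tendsto_const])
           (use eventually_Z_pos[OF N_lim] in \<open>auto simp: normalised_moment_def elim: eventually_mono\<close>)
      then show ?thesis using True gem_moment_empty[OF theta_pos] by simp
    next
      case False
      have "0 < (\<Sum>i<n. a i)" using False a1[of 0] by (intro sum_pos2[of _ 0]) auto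
      moreover have "(\<lambda>j. normalised_moment a (v j) (l j) (N j) {..<n}) \<longlonglongrightarrow> 0"
        using normalised_moment_critical[of N a "{..<n}"] N N_lim \<rho> eq a False by auto
      ultimately show ?thesis by (simp only: \<alpha>0 zero_power mult_zero_left)
    qed
  qed
  then have "(\<lambda>j. LINT p:mass_partitions|partition_law (v j) (l j) (N j). (\<Prod>i<n. partition_sum (a i) p)) \<longlonglongrightarrow>
      \<alpha> ^ (\<Sum>i<n. a i) * gem_moment \<theta> a {..<n}"
  proof (rule Lim_transform_eventually)
    show "\<forall>\<^sub>F j in sequentially. normalised_moment a (v j) (l j) (N j) {..<n} =
        (LINT p:mass_partitions|partition_law (v j) (l j) (N j). (\<Prod>i<n. partition_sum (a i) p))"
      using v_nonneg N_lim[unfolded filterlim_at_top, rule_format, of 1]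
    proof eventually_elim
      case (elim j)
      show ?case by (rule integral_partition_law[symmetric]) (use elim a in auto)
    qed
  qed
  then show "(\<lambda>j. LINT p:mass_partitions|partition_law (v j) (l j) (N j). (\<Prod>i<n. partition_sum (a i) p)) \<longlonglongrightarrow>
      (LINT p:mass_partitions|scaled_poisson_dirichlet (1 - critical_density w / \<rho>) \<theta>. (\<Prod>i<n. partition_sum (a i) p))"
    unfolding \<alpha>_def[symmetric] rhs .
qed (simp_all add: partition_law_def scaled_poisson_dirichlet_def)

end

text \<open>Without such a sequence \<open>site_limit\<close> would hold vacuously; its existence
  makes the limit law unique.\<close>

lemma ex_thermodynamic_sequence:
  assumes "0 \<le> \<rho>"
  shows "\<exists>L N. thermodynamic_sequence \<rho> L N"
proof -
  define L where "L k = (Suc k)\<^sup>2" for k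
  \<comment> \<open>The summand \<open>Suc k\<close> drives the mass to infinity even when
    \<open>\<rho> = 0\<close>, yet is negligible against \<open>(Suc k)\<close> squared
    sites.\<close>
  define N where "N k = nat \<lfloor>\<rho> * real (L k)\<rfloor> + Suc k" for k
  have "filterlim L at_top sequentially"
    by (rule filterlim_at_top_mono[OF filterlim_Suc]) (simp add: L_def power2_eq_square)
  moreover have "filterlim N at_top sequentially"
    by (rule filterlim_at_top_mono[OF filterlim_Suc]) (simp add: N_def)
  moreover have "(\<lambda>k. real (N k) / real (L k)) \<longlonglongrightarrow> \<rho>"
  proof (rule Lim_transform[OF tendsto_const], rule Lim_null_comparison)
    show "\<forall>\<^sub>F k in sequentially. norm (real (N k) / real (L k) - \<rho>) \<le> 1 / real (Suc k)"
    proof (intro always_eventually allI)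
      fix k
      have L: "real (L k) = real (Suc k) * real (Suc k)" unfolding L_def power2_eq_square by (rule of_nat_mult)
      have "0 \<le> \<rho> * real (L k)" using assms by simp
      then have "real (N k) \<le> \<rho> * real (L k) + real (Suc k)" "\<rho> * real (L k) \<le> real (N k)"
        unfolding N_def by linarith+
      then have "\<bar>real (N k) - \<rho> * real (L k)\<bar> / real (L k) \<le> real (Suc k) / real (L k)"
        by (intro divide_right_mono) auto
      moreover have "real (N k) / real (L k) - \<rho> = (real (N k) - \<rho> * real (L k)) / real (L k)"
        by (simp add: L diff_divide_distrib)
      moreover have "real (Suc k) / real (L k) = 1 / real (Suc k)" by (simp add: L)
      ultimately show "norm (real (N k) / real (L k) - \<rho>) \<le> 1 / real (Suc k)" by simp
    qed
    show "(\<lambda>k. 1 / real (Suc k)) \<longlonglongrightarrow> 0" using LIMSEQ_Suc[OF lim_1_over_n] by simp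
  qed
  ultimately show ?thesis unfolding thermodynamic_sequence_def by blast
qed

text \<open>Indicators of single points are bounded and continuous for the discrete topology, so the
  limit law is determined. The claim on the mean above criticality is about every site
  limit.\<close>

lemma site_limit_unique:
  assumes "0 \<le> \<rho>" "site_limit w \<rho> \<nu>" "site_limit w \<rho> \<nu>'"
  shows "\<nu> = \<nu>'"
proof (rule pmf_eqI)
  fix n
  obtain L N where LN: "thermodynamic_sequence \<rho> L N" using ex_thermodynamic_sequence[OF assms(1)] by blast
  define f :: "nat \<Rightarrow> real" where "f = indicator {n}"
  have b: "bounded (range f)" by (rule boundedI[of _ 1]) (auto simp: f_def indicator_def)
  have int: "(LINT m:UNIV|measure_pmf \<mu>. f m) = pmf \<mu> n" for \<mu>
    by (simp add: set_lebesgue_integral_def f_def measure_pmf_single)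
  have "(\<lambda>k. LINT m:UNIV|site_marginal (w (L k)) (L k) (N k) 0. f m) \<longlonglongrightarrow> pmf \<mu> n"
    if "site_limit w \<rho> \<mu>" for \<mu>
  proof -
    have "weakly_converges_on UNIV (\<lambda>k. site_marginal (w (L k)) (L k) (N k) 0) (measure_pmf \<mu>)"
      using that LN by (simp add: site_limit_def)
    then show ?thesis using b unfolding weakly_converges_on_def int[symmetric] by simp
  qed
  from this[OF assms(2)] this[OF assms(3)] show "pmf \<nu> n = pmf \<nu>' n" by (rule LIMSEQ_unique)
qed

theorem theorem1p7:
  fixes wL :: "nat \<Rightarrow> nat \<Rightarrow> real" and w :: "nat \<Rightarrow> real" and \<theta> :: real
  assumes nonneg: "\<And>L n. L \<ge> 1 \<Longrightarrow> 0 \<le> wL L n"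
    and B1_lim: "uniform_limit UNIV wL w sequentially"
    and B1_sum: "w sums 1"
    and B1_pos: "w 0 = 1 \<or> (w 0 > 0 \<and> (SUP n\<in>{1..}. min (w (n - 1)) (w n)) > 0)"
    and theta: "0 < \<theta>" "\<theta> \<le> 1"
    and B2: "\<exists>s :: nat \<Rightarrow> ereal.
        (\<forall>\<^sub>F J in sequentially.
           (\<lambda>L. SUP n\<in>{J<..}. ereal \<bar>real n * wL L n * real L - \<theta>\<bar>) \<longlonglongrightarrow> s J) \<and>
        s \<longlonglongrightarrow> 0"
  shows "summable (\<lambda>n. real n * w n) \<and>
    condensation_transition wL (critical_density w) \<and>
    (\<forall>\<rho>\<ge>critical_density w. \<forall>\<nu>. site_limit wL \<rho> \<nu> \<longrightarrow>
       pmf_mean \<nu> = ennreal (critical_density w)) \<and>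
    (\<forall>\<rho>>0. \<rho> \<ge> critical_density w \<longrightarrow>
       (\<forall>L N. thermodynamic_sequence \<rho> L N \<longrightarrow>
          weakly_converges_on mass_partitions
            (\<lambda>k. partition_law (wL (L k)) (L k) (N k))
            (scaled_poisson_dirichlet (1 - critical_density w / \<rho>) \<theta>)))"
proof -
  \<comment> \<open>Unfolds the iterated limit in (B2): one \<open>J\<close> whose inner limit lies
    below \<open>\<epsilon>\<close> gives, for all large \<open>L\<close>, the bound for every
    \<open>n > J\<close> at once.\<close>
  have tail: "\<exists>J. \<forall>\<^sub>F L in sequentially. \<forall>n>J. \<bar>real n * wL L n * real L - \<theta>\<bar> \<le> \<epsilon>" if "0 < \<epsilon>" for \<epsilon>
  proof -
    obtain s :: "nat \<Rightarrow> ereal" where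
      s: "\<forall>\<^sub>F J in sequentially. (\<lambda>L. SUP n\<in>{J<..}. ereal \<bar>real n * wL L n * real L - \<theta>\<bar>) \<longlonglongrightarrow> s J"
        "s \<longlonglongrightarrow> 0" using B2 by blast
    have "\<forall>\<^sub>F J in sequentially. s J < ereal \<epsilon>"
      by (rule order_tendstoD(2)[OF s(2)]) (use that in simp)
    then obtain J where J: "s J < ereal \<epsilon>"
      "(\<lambda>L. SUP n\<in>{J<..}. ereal \<bar>real n * wL L n * real L - \<theta>\<bar>) \<longlonglongrightarrow> s J"
      using eventually_happens'[OF sequentially_bot eventually_conj[OF _ s(1)]] by blast
    from order_tendstoD(2)[OF J(2,1)]
    have "\<forall>\<^sub>F L in sequentially. \<forall>n>J. \<bar>real n * wL L n * real L - \<theta>\<bar> \<le> \<epsilon>"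
    proof eventually_elim
      case (elim L)
      show ?case
      proof (intro allI impI)
        fix n assume "J < n"
        then have "ereal \<bar>real n * wL L n * real L - \<theta>\<bar> \<le> (SUP n\<in>{J<..}. ereal \<bar>real n * wL L n * real L - \<theta>\<bar>)"
          by (intro SUP_upper) simp
        also note elim
        finally show "\<bar>real n * wL L n * real L - \<theta>\<bar> \<le> \<epsilon>" by simp
      qed
    qed
    then show ?thesis by blast
  qed
  have cw: "condensing_weights (\<lambda>j. wL (L j)) L w \<theta>" if L: "filterlim L at_top sequentially" for L
  proof (unfold_locales, goal_cases)
    case 2
    have "\<forall>\<^sub>F j in sequentially. 1 \<le> L j" using L by (auto simp: filterlim_at_top)
    then show ?case by eventually_elim (use nonneg in auto)
  next
    case 3
    show ?case by (rule filterlim_compose[OF B1_lim L])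
  next
    case (7 \<epsilon>)
    then show ?case using tail[OF 7] eventually_compose_filterlim[OF _ L] by blast
  qed (use L B1_sum B1_pos theta in auto)
  \<comment> \<open>Facts about \<open>w\<close> alone do not depend on the sequence of systems;
    they are read off from the plain sequence with \<open>j\<close> sites.\<close>
  interpret base: condensing_weights "\<lambda>j. wL j" "\<lambda>j. j" w \<theta>
    by (rule cw[of "\<lambda>j. j"]) (simp add: filterlim_ident)
  define \<rho>c where "\<rho>c = critical_density w"
  obtain J where J: "\<forall>n>J. w n = 0" using base.w_support by blast
  have site: "site_limit wL \<rho> \<nu>"
    if \<phi>: "\<phi> = 1 \<and> \<rho>c \<le> \<rho> \<or> 0 \<le> \<phi> \<and> \<phi> \<le> 1 \<and> tilt_mean w \<phi> = \<rho> \<and> (\<rho> = 0 \<longrightarrow> \<phi> = 0)"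
      and \<nu>: "\<And>n. pmf \<nu> n = w n * \<phi> ^ n / tilt_norm w \<phi>" for \<rho> \<phi> \<nu>
    unfolding site_limit_def
  proof (intro allI impI)
    fix L N x assume "thermodynamic_sequence \<rho> L N"
    then have L: "filterlim L at_top sequentially" and N: "filterlim N at_top sequentially"
      and lim: "(\<lambda>k. real (N k) / real (L k)) \<longlonglongrightarrow> \<rho>" by (auto simp: thermodynamic_sequence_def)
    interpret condensing_weights "\<lambda>k. wL (L k)" L w \<theta> by (rule cw[OF L])
    show "weakly_converges_on UNIV (\<lambda>k. site_marginal (wL (L k)) (L k) (N k) x) (measure_pmf \<nu>)"
    proof (rule weakly_converges_site_marginal[OF v_nonneg eventually_Z_pos[OF N] L N])
      show "(\<lambda>k. site_prob (wL (L k)) (L k) (N k) n) \<longlonglongrightarrow> pmf \<nu> n" for n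
        unfolding \<nu> by (rule site_prob_limit[OF lim N \<phi>[unfolded \<rho>c_def]])
      show "set_pmf \<nu> \<subseteq> {..J}"
      proof
        fix n assume "n \<in> set_pmf \<nu>"
        then have "w n \<noteq> 0" using \<nu>[of n] by (auto simp: set_pmf_iff)
        then show "n \<in> {..J}" using J by (meson atMost_iff not_le)
      qed
    qed
  qed
  \<comment> \<open>The law with mass function \<open>w\<close>; it serves as the limit for every
    density from the critical one on.\<close>
  obtain \<nu>c where \<nu>c: "\<And>n. pmf \<nu>c n = w n * 1 ^ n / tilt_norm w 1" "pmf_mean \<nu>c = ennreal \<rho>c"
    using base.ex_tilted_pmf[of 1] base.tilt_mean_1 by (auto simp: \<rho>c_def)
  have \<nu>c_limit: "site_limit wL \<rho> \<nu>c" if "\<rho>c \<le> \<rho>" for \<rho>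
    by (rule site[of 1]) (use that \<nu>c in auto)
  have \<rho>c: "0 \<le> \<rho>c" using base.critical_density_nonneg by (simp add: \<rho>c_def)
  have "summable (\<lambda>n. real n * w n)"
    by (rule summable_finite[of "{..J}"]) (use J in auto)
  moreover have "condensation_transition wL \<rho>c"
    unfolding condensation_transition_def
  proof (intro conjI allI impI)
    fix \<rho> :: real assume \<rho>: "0 \<le> \<rho>"
    show "\<exists>\<nu>. site_limit wL \<rho> \<nu> \<and> (\<rho> < \<rho>c \<longrightarrow> pmf_mean \<nu> = ennreal \<rho>) \<and> (\<rho>c < \<rho> \<longrightarrow> pmf_mean \<nu> < ennreal \<rho>)"
    proof (cases "\<rho>c \<le> \<rho>")
      case True
      then show ?thesis using \<nu>c_limit \<nu>c(2) \<rho>c by (intro exI[of _ \<nu>c]) (auto simp: ennreal_less_iff)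
    next
      case False
      obtain \<phi> where \<phi>: "0 \<le> \<phi>" "\<phi> \<le> 1" "tilt_mean w \<phi> = \<rho>" "\<rho> = 0 \<longrightarrow> \<phi> = 0"
      proof (cases "\<rho> = 0")
        case True
        then show ?thesis using that[of 0] base.tilt_mean_0 by auto
      next
        case nz: False
        then have "0 < \<rho>" "\<rho> \<le> critical_density w" using \<rho> False by (auto simp: \<rho>c_def)
        from base.ex_tilt[OF this] obtain \<phi> where "0 < \<phi>" "\<phi> \<le> 1" "tilt_mean w \<phi> = \<rho>" by blast
        then show ?thesis using that[of \<phi>] nz by simp
      qed
      obtain \<nu> where "\<And>n. pmf \<nu> n = w n * \<phi> ^ n / tilt_norm w \<phi>" "pmf_mean \<nu> = ennreal (tilt_mean w \<phi>)"
        using base.ex_tilted_pmf[OF \<phi>(1,2)] by blast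
      then show ?thesis using site[of \<phi> \<rho> \<nu>] \<phi> False by auto
    qed
  qed (rule \<rho>c)
  moreover have "pmf_mean \<nu> = ennreal \<rho>c" if "\<rho>c \<le> \<rho>" "site_limit wL \<rho> \<nu>" for \<rho> \<nu>
    using site_limit_unique[OF _ that(2) \<nu>c_limit[OF that(1)]] \<rho>c that(1) \<nu>c(2) by auto
  moreover have "weakly_converges_on mass_partitions (\<lambda>k. partition_law (wL (L k)) (L k) (N k))
      (scaled_poisson_dirichlet (1 - \<rho>c / \<rho>) \<theta>)"
    if "0 < \<rho>" "\<rho>c \<le> \<rho>" "thermodynamic_sequence \<rho> L N" for \<rho> L N
  proof -
    have L: "filterlim L at_top sequentially" and N: "filterlim N at_top sequentially"
      and lim: "(\<lambda>k. real (N k) / real (L k)) \<longlonglongrightarrow> \<rho>" using that(3) by (auto simp: thermodynamic_sequence_def)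
    interpret condensing_weights "\<lambda>k. wL (L k)" L w \<theta> by (rule cw[OF L])
    show ?thesis using partition_law_limit[OF lim N that(1)] that(2) by (simp add: \<rho>c_def)
  qed
  ultimately show ?thesis unfolding \<rho>c_def by blast
qed

end
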